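(* Let $\tau_L,\tau_R\in\mathbb{R}$ and $\delta_L,\delta_R>0$, and let $f:\mathbb{R}^2\to\mathbb{R}^2$ be the two-dimensional border-collision normal form $$f(x)=\begin{cases}f_L(x)=A_Lx+(1,0)^{\sf T},&x_1\le0,\\ f_R(x)=A_Rx+(1,0)^{\sf T},&x_1\ge0,\end{cases}\qquad A_L=\begin{bmatrix}\tau_L&1\\-\delta_L&0\end{bmatrix},\quad A_R=\begin{bmatrix}\tau_R&1\\-\delta_R&0\end{bmatrix}.$$ If the detection algorithm described in the context (performed with exact arithmetic, with any parameters $\beta_{\rm min}>0$, $\beta_{\rm step}>0$, $\beta_{\rm max}$) outputs $\chi_{\rm chaos}=\text{true}$, then $f$ has an attractor with a positive Lyapunov exponent; that is, there is a trapping region $\Omega_{\rm trap}$ for $f$ with attracting set $\Lambda=\bigcap_{i\ge0}f^i(\Omega_{\rm trap})$ such that for every $x\in\Lambda$ there exists $v\in\mathbb{R}^2$ with $\lambda(x,v)>0$.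
   Context: General notions. A trapping region is a nonempty compact set $\Omega_{\rm trap}$ with $f(\Omega_{\rm trap})\subseteq\mathrm{int}(\Omega_{\rm trap})$. $\lambda(x,v)=\limsup_{n\to\infty}\frac1n\ln\|\mathrm{D}^+_vf^n(x)\|$ with $\|\cdot\|$ the Euclidean norm and $\mathrm{D}^+_v\phi(x)=\lim_{\delta\to0^+}\frac{\phi(x+\delta v)-\phi(x)}{\delta}$ (which exists for $\phi=f^n$). Since $\delta_L,\delta_R>0$, $f$ is a homeomorphism. $\Sigma=\{x\mid x_1=0\}$, $\Pi_L=\{x_1\le0\}$, $\Pi_R=\{x_1\ge0\}$; $f(\Sigma)=\{x_2=0\}$. Given $\beta>0$, put $X=(0,\beta)$. (C1) There exist $i,j\ge1$ with $f^i(X)\in\Pi_L$ and $f^{-j}(X)\in\Pi_R$; let $r$ and $\ell$ be the smallest such $i$ and $j$, respectively. When (C1) holds, let $Z=f^r(X)$; let $Y$ be the intersection of the line through $Z$ and $f^{-1}(Z)$ with $\Sigma$; let $V=f^{-(\ell-1)}(X)$; let $U$ be the intersection of the line through $V$ and $f(V)$ with $f(\Sigma)$. (C2) $Y$ lies (strictly) above $f^{-1}(U)$ (both lie on $\Sigma$); $Z$ lies above the line through $f^{-1}(U)$ and $V$; and $Z$ lies to the right of the line through $V$ and $f(V)$. For $x\in\Pi_L$ let $\chi_L(x)$ be the smallest $p\ge1$ with $f_L^p(x)\notin\Pi_L$ ($\infty$ if none). When (C1),(C2) hold let $p_{\rm max}=\max[\chi_L(Y),\chi_L(Z)]$ (which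 is finite). For $j\in\{1,\dots,p_{\rm max}+1\}$ let $M^{(j)}=A_L^{j-1}A_R=\begin{bmatrix}a_j&b_j\\c_j&d_j\end{bmatrix}$, and $G_j(m)=\frac{c_j+d_jm}{a_j+b_jm}$, $H_j(m)=(b_j^2+d_j^2-1)m^2+2(a_jb_j+c_jd_j)m+a_j^2+c_j^2-1$. (C3) For every $j$: $0<\det(M^{(j)})<\frac14\mathrm{trace}(M^{(j)})^2$ and $b_j\ne0$. Under (C3), $G_j$ has exactly two fixed points: $m^{(j)}_{\rm stab}$, at which $0<\frac{dG_j}{dm}<1$, and $m^{(j)}_{\rm unstab}$, at which $\frac{dG_j}{dm}>1$. Let $m_{\rm stab,min}$, $m_{\rm stab,max}$ be the minimum and maximum of the $m^{(j)}_{\rm stab}$ over $j$. (C4) For every $j$: $m^{(j)}_{\rm unstab}\notin[m_{\rm stab,min},m_{\rm stab,max}]$. (C5) For every $j$: - if $b_j^2+d_j^2\neq1$, then $H_j$ has two distinct real roots, $m^{(j)}_{\rm incr}$ (where $H_j$ is increasing) and $m^{(j)}_{\rm decr}$ (where $H_j$ is decreasing), and two of the three inequalities $m_{\rm stab,max}<m^{(j)}_{\rm decr}$, $m^{(j)}_{\rm decr}<m^{(j)}_{\rm incr}$, $m^{(j)}_{\rm incr}<m_{\rm stab,min}$ hold; - if $b_j^2+d_j^2=1$, then $a_jb_j+c_jd_j\ne0$ and, with $m^{(j)}_{\rm root}=-\frac{a_j^2+c_j^2-1}{2(a_jb_j+c_jd_j)}$, one has $m^{(j)}_{\rm root}>m_{\rm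 stab,max}$ if $a_jb_j+c_jd_j<0$, and $m^{(j)}_{\rm root}<m_{\rm stab,min}$ if $a_jb_j+c_jd_j>0$. The algorithm: run through $\beta=\beta_{\rm min},\beta_{\rm min}+\beta_{\rm step},\beta_{\rm min}+2\beta_{\rm step},\dots$ (while $\beta\le\beta_{\rm max}$) until the first $\beta$ for which (C1) and (C2) both hold. If there is none, output $\chi_{\rm chaos}=\text{false}$. Otherwise fix this $\beta$; output $\chi_{\rm chaos}=\text{true}$ if (C3), (C4), (C5) all hold, and $\text{false}$ otherwise. *)

theory Defs
  imports "HOL-Analysis.Analysis"
begin

section \<open>Trapping regions and Lyapunov exponents\<close>

definition trapping_region :: "('a::topological_space \<Rightarrow> 'a) \<Rightarrow> 'a set \<Rightarrow> bool" where
  "trapping_region f \<Omega> \<longleftrightarrow> \<Omega> \<noteq> {} \<and> compact \<Omega> \<and> f ` \<Omega> \<subseteq> interior \<Omega>"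

definition attracting_set :: "('a \<Rightarrow> 'a) \<Rightarrow> 'a set \<Rightarrow> 'a set" where
  "attracting_set f \<Omega> = (\<Inter>i. (f ^^ i) ` \<Omega>)"

definition one_sided_deriv :: "('a::real_normed_vector \<Rightarrow> 'a) \<Rightarrow> 'a \<Rightarrow> 'a \<Rightarrow> 'a" where
  "one_sided_deriv \<phi> v x = Lim (at_right 0) (\<lambda>\<delta>. (\<phi> (x + \<delta> *\<^sub>R v) - \<phi> x) /\<^sub>R \<delta>)"

text \<open>The real \<open>ln\<close> has \<open>ln 0 = 0\<close>; the exponent uses the usual value \<open>-\<infinity>\<close> instead.\<close>

definition ext_ln :: "real \<Rightarrow> ereal" where
  "ext_ln t = (if t = 0 then -\<infinity> else ereal (ln t))"

definition lyapunov_exponent :: "('a::real_normed_vector \<Rightarrow> 'a) \<Rightarrow> 'a \<Rightarrow> 'a \<Rightarrow> ereal" where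
  "lyapunov_exponent f x v =
     limsup (\<lambda>n. ereal (1 / real n) * ext_ln (norm (one_sided_deriv (f ^^ n) v x)))"


section \<open>The border-collision normal form\<close>

definition bc_matrix :: "real \<Rightarrow> real \<Rightarrow> real^2^2" where
  "bc_matrix \<tau> \<delta> = vector [vector [\<tau>, 1], vector [- \<delta>, 0]]"

definition bc_piece :: "real^2^2 \<Rightarrow> real^2 \<Rightarrow> real^2" where
  "bc_piece A x = A *v x + vector [1, 0]"

text \<open>On \<open>x $ 1 = 0\<close> the two pieces agree, since the second columns of
  \<open>bc_matrix \<tau> \<delta>\<close> do not depend on \<open>\<tau>\<close> and \<open>\<delta>\<close>.\<close>

definition bcnf :: "real \<Rightarrow> real \<Rightarrow> real \<Rightarrow> real \<Rightarrow> real^2 \<Rightarrow> real^2" where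
  "bcnf \<tau>L \<delta>L \<tau>R \<delta>R x =
     (if x $ 1 \<le> 0 then bc_piece (bc_matrix \<tau>L \<delta>L) x else bc_piece (bc_matrix \<tau>R \<delta>R) x)"

definition Sigma_line :: "(real^2) set" where
  "Sigma_line = {x. x $ 1 = 0}"

definition Pi_L :: "(real^2) set" where
  "Pi_L = {x. x $ 1 \<le> 0}"

definition Pi_R :: "(real^2) set" where
  "Pi_R = {x. x $ 1 \<ge> 0}"


section \<open>The points constructed from \<open>X = (0, \<beta>)\<close>\<close>

text \<open>Below, \<open>f\<close> is meant to be a bijection, so that \<open>inv f ^^ j\<close> is its \<open>-j\<close>-th iterate,
  and the line through two distinct points is their affine hull.\<close>

definition pt_X :: "real \<Rightarrow> real^2" where
  "pt_X \<beta> = vector [0, \<beta>]"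

definition cond_C1 :: "(real^2 \<Rightarrow> real^2) \<Rightarrow> real \<Rightarrow> bool" where
  "cond_C1 f \<beta> \<longleftrightarrow>
     (\<exists>i\<ge>1. (f ^^ i) (pt_X \<beta>) \<in> Pi_L) \<and> (\<exists>j\<ge>1. (inv f ^^ j) (pt_X \<beta>) \<in> Pi_R)"

definition idx_r :: "(real^2 \<Rightarrow> real^2) \<Rightarrow> real \<Rightarrow> nat" where
  "idx_r f \<beta> = (LEAST i. i \<ge> 1 \<and> (f ^^ i) (pt_X \<beta>) \<in> Pi_L)"

definition idx_l :: "(real^2 \<Rightarrow> real^2) \<Rightarrow> real \<Rightarrow> nat" where
  "idx_l f \<beta> = (LEAST j. j \<ge> 1 \<and> (inv f ^^ j) (pt_X \<beta>) \<in> Pi_R)"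

definition pt_Z :: "(real^2 \<Rightarrow> real^2) \<Rightarrow> real \<Rightarrow> real^2" where
  "pt_Z f \<beta> = (f ^^ idx_r f \<beta>) (pt_X \<beta>)"

definition pt_Y :: "(real^2 \<Rightarrow> real^2) \<Rightarrow> real \<Rightarrow> real^2" where
  "pt_Y f \<beta> = (THE y. y \<in> affine hull {pt_Z f \<beta>, inv f (pt_Z f \<beta>)} \<inter> Sigma_line)"

definition pt_V :: "(real^2 \<Rightarrow> real^2) \<Rightarrow> real \<Rightarrow> real^2" where
  "pt_V f \<beta> = (inv f ^^ (idx_l f \<beta> - 1)) (pt_X \<beta>)"

definition pt_U :: "(real^2 \<Rightarrow> real^2) \<Rightarrow> real \<Rightarrow> real^2" where
  "pt_U f \<beta> = (THE u. u \<in> affine hull {pt_V f \<beta>, f (pt_V f \<beta>)} \<inter> f ` Sigma_line)"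

text \<open>These are used for a non-vertical line through \<open>p\<close>, \<open>q\<close> and for a non-horizontal one,
  respectively, so the witness \<open>s\<close> is unique.\<close>

definition above_line :: "real^2 \<Rightarrow> real^2 \<Rightarrow> real^2 \<Rightarrow> bool" where
  "above_line z p q \<longleftrightarrow> (\<exists>s \<in> affine hull {p, q}. s $ 1 = z $ 1 \<and> s $ 2 < z $ 2)"

definition right_of_line :: "real^2 \<Rightarrow> real^2 \<Rightarrow> real^2 \<Rightarrow> bool" where
  "right_of_line z p q \<longleftrightarrow> (\<exists>s \<in> affine hull {p, q}. s $ 2 = z $ 2 \<and> s $ 1 < z $ 1)"

definition cond_C2 :: "(real^2 \<Rightarrow> real^2) \<Rightarrow> real \<Rightarrow> bool" where
  "cond_C2 f \<beta> \<longleftrightarrow>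
     pt_Y f \<beta> $ 2 > inv f (pt_U f \<beta>) $ 2 \<and>
     above_line (pt_Z f \<beta>) (inv f (pt_U f \<beta>)) (pt_V f \<beta>) \<and>
     right_of_line (pt_Z f \<beta>) (pt_V f \<beta>) (f (pt_V f \<beta>))"


section \<open>The matrices \<open>M\<^bsup>(j)\<^esup>\<close> and the cone conditions\<close>

definition chi_L :: "real^2^2 \<Rightarrow> real^2 \<Rightarrow> enat" where
  "chi_L A\<^sub>L x =
     (if \<exists>p\<ge>1. (bc_piece A\<^sub>L ^^ p) x \<notin> Pi_L
      then enat (LEAST p. p \<ge> 1 \<and> (bc_piece A\<^sub>L ^^ p) x \<notin> Pi_L) else \<infinity>)"

definition p_max :: "(real^2 \<Rightarrow> real^2) \<Rightarrow> real^2^2 \<Rightarrow> real \<Rightarrow> enat" where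
  "p_max f A\<^sub>L \<beta> = max (chi_L A\<^sub>L (pt_Y f \<beta>)) (chi_L A\<^sub>L (pt_Z f \<beta>))"

definition idx_set :: "(real^2 \<Rightarrow> real^2) \<Rightarrow> real^2^2 \<Rightarrow> real \<Rightarrow> nat set" where
  "idx_set f A\<^sub>L \<beta> = {j. 1 \<le> j \<and> enat j \<le> p_max f A\<^sub>L \<beta> + 1}"

text \<open>\<open>A\<^sub>L\<^bsup>j-1\<^esup> A\<^sub>R\<close> for the matrix product; \<open>^\<close> and \<open>*\<close> would be componentwise
  on \<^typ>\<open>real^2^2\<close>.\<close>

definition word_matrix :: "real^2^2 \<Rightarrow> real^2^2 \<Rightarrow> nat \<Rightarrow> real^2^2" where
  "word_matrix A\<^sub>L A\<^sub>R j = (((**) A\<^sub>L) ^^ (j - 1)) A\<^sub>R"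

definition G_map :: "real^2^2 \<Rightarrow> real \<Rightarrow> real" where
  "G_map M m = (M$2$1 + M$2$2 * m) / (M$1$1 + M$1$2 * m)"

definition H_map :: "real^2^2 \<Rightarrow> real \<Rightarrow> real" where
  "H_map M m = ((M$1$2)\<^sup>2 + (M$2$2)\<^sup>2 - 1) * m\<^sup>2
     + 2 * (M$1$1 * M$1$2 + M$2$1 * M$2$2) * m + (M$1$1)\<^sup>2 + (M$2$1)\<^sup>2 - 1"

text \<open>The first conjunct keeps \<open>m\<close> in the domain of \<open>G\<close>: because \<open>x / 0 = 0\<close>, the value \<open>0\<close>
  would otherwise pass for a fixed point when \<open>M$1$1 = 0\<close>.\<close>

definition G_fixpoint :: "real^2^2 \<Rightarrow> real \<Rightarrow> bool" where
  "G_fixpoint M m \<longleftrightarrow> M$1$1 + M$1$2 * m \<noteq> 0 \<and> G_map M m = m"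

definition m_stab :: "real^2^2 \<Rightarrow> real" where
  "m_stab M = (THE m. G_fixpoint M m \<and> 0 < deriv (G_map M) m \<and> deriv (G_map M) m < 1)"

definition m_unstab :: "real^2^2 \<Rightarrow> real" where
  "m_unstab M = (THE m. G_fixpoint M m \<and> deriv (G_map M) m > 1)"

definition m_incr :: "real^2^2 \<Rightarrow> real" where
  "m_incr M = (THE m. H_map M m = 0 \<and> deriv (H_map M) m > 0)"

definition m_decr :: "real^2^2 \<Rightarrow> real" where
  "m_decr M = (THE m. H_map M m = 0 \<and> deriv (H_map M) m < 0)"

definition m_root :: "real^2^2 \<Rightarrow> real" where
  "m_root M = - ((M$1$1)\<^sup>2 + (M$2$1)\<^sup>2 - 1) / (2 * (M$1$1 * M$1$2 + M$2$1 * M$2$2))"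

definition cond_C3 :: "(nat \<Rightarrow> real^2^2) \<Rightarrow> nat set \<Rightarrow> bool" where
  "cond_C3 M J \<longleftrightarrow>
     (\<forall>j\<in>J. 0 < det (M j) \<and> det (M j) < 1 / 4 * (trace (M j))\<^sup>2 \<and> M j $ 1 $ 2 \<noteq> 0)"

definition m_stab_min :: "(nat \<Rightarrow> real^2^2) \<Rightarrow> nat set \<Rightarrow> real" where
  "m_stab_min M J = Min ((\<lambda>j. m_stab (M j)) ` J)"

definition m_stab_max :: "(nat \<Rightarrow> real^2^2) \<Rightarrow> nat set \<Rightarrow> real" where
  "m_stab_max M J = Max ((\<lambda>j. m_stab (M j)) ` J)"

definition cond_C4 :: "(nat \<Rightarrow> real^2^2) \<Rightarrow> nat set \<Rightarrow> bool" where
  "cond_C4 M J \<longleftrightarrow> (\<forall>j\<in>J. m_unstab (M j) \<notin> {m_stab_min M J .. m_stab_max M J})"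

text \<open>All three inequalities of the first case cannot hold at once, so ``two of the three''
  is rendered as ``at least two''.\<close>

definition cond_C5_at :: "real \<Rightarrow> real \<Rightarrow> real^2^2 \<Rightarrow> bool" where
  "cond_C5_at smin smax M \<longleftrightarrow>
     ((M$1$2)\<^sup>2 + (M$2$2)\<^sup>2 \<noteq> 1 \<longrightarrow>
        card {m. H_map M m = 0} = 2 \<and>
        (smax < m_decr M \<and> m_decr M < m_incr M \<or>
         smax < m_decr M \<and> m_incr M < smin \<or>
         m_decr M < m_incr M \<and> m_incr M < smin)) \<and>
     ((M$1$2)\<^sup>2 + (M$2$2)\<^sup>2 = 1 \<longrightarrow>
        M$1$1 * M$1$2 + M$2$1 * M$2$2 \<noteq> 0 \<and>
        (M$1$1 * M$1$2 + M$2$1 * M$2$2 < 0 \<longrightarrow> m_root M > smax) \<and>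
        (M$1$1 * M$1$2 + M$2$1 * M$2$2 > 0 \<longrightarrow> m_root M < smin))"

definition cond_C5 :: "(nat \<Rightarrow> real^2^2) \<Rightarrow> nat set \<Rightarrow> bool" where
  "cond_C5 M J \<longleftrightarrow> (\<forall>j\<in>J. cond_C5_at (m_stab_min M J) (m_stab_max M J) (M j))"


section \<open>The detection algorithm\<close>

text \<open>\<open>beta_stops f \<beta>min \<beta>step \<beta>max k\<close>: the search through \<open>\<beta>min + k \<beta>step\<close>, \<open>k = 0, 1, \<dots>\<close>,
  subject to \<open>\<beta> \<le> \<beta>max\<close>, ends successfully at step \<open>k\<close>.\<close>

definition beta_stops ::
    "(real^2 \<Rightarrow> real^2) \<Rightarrow> real \<Rightarrow> real \<Rightarrow> real \<Rightarrow> nat \<Rightarrow> bool" where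
  "beta_stops f \<beta>min \<beta>step \<beta>max k \<longleftrightarrow>
     \<beta>min + real k * \<beta>step \<le> \<beta>max \<and>
     cond_C1 f (\<beta>min + real k * \<beta>step) \<and> cond_C2 f (\<beta>min + real k * \<beta>step) \<and>
     (\<forall>i<k. \<not> (cond_C1 f (\<beta>min + real i * \<beta>step) \<and> cond_C2 f (\<beta>min + real i * \<beta>step)))"

definition chi_chaos ::
    "real \<Rightarrow> real \<Rightarrow> real \<Rightarrow> real \<Rightarrow> real \<Rightarrow> real \<Rightarrow> real \<Rightarrow> bool" where
  "chi_chaos \<tau>L \<delta>L \<tau>R \<delta>R \<beta>min \<beta>step \<beta>max \<longleftrightarrow>
     (let f = bcnf \<tau>L \<delta>L \<tau>R \<delta>R;
          A\<^sub>L = bc_matrix \<tau>L \<delta>L;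
          M = word_matrix A\<^sub>L (bc_matrix \<tau>R \<delta>R)
      in \<exists>k. beta_stops f \<beta>min \<beta>step \<beta>max k \<and>
           (let J = idx_set f A\<^sub>L (\<beta>min + real k * \<beta>step)
            in cond_C3 M J \<and> cond_C4 M J \<and> cond_C5 M J))"

end

theory Submission
  imports Defs
begin

text \<open>
  Segments joining consecutive points of the orbit of \<open>X\<close> bound a polygon \<open>\<Omega>\<close>, made of
  a convex part in each half-plane. Both pieces of \<open>f\<close> are affine and map the edges along the boundary, so
  \<open>\<Omega>\<close> is described by linear inequalities that \<open>f\<close> passes on from one edge to the next; (C2) makes the
  last one strict, and some iterate of \<open>\<Omega>\<close> lies in the interior. The edges turn clockwise because the orbit
  would otherwise never return to the switching line.

  A point entering the left half-plane is a convex combination of \<open>0\<close>, \<open>Y\<close>, \<open>Z\<close> and \<open>f(Y)\<close>. A Sturm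
  comparison shows that a point that has left the half-plane remains outside as long as some other point
  stays inside, so the combination leaves no later than \<open>Y\<close> and \<open>Z\<close> do. Hence the derivatives along
  an orbit are products of the matrices \<open>M\<^bsup>(j)\<^esup>\<close>, and (C3) to (C5) give a cone which all of these map into
  itself and expand.
\<close>

section \<open>Affine second-order recurrences\<close>

text \<open>Both half-planes reduce to one scalar recurrence for \<open>s\<close>, with
  \<open>\<mu> = 1\<close> for the forward orbit and \<open>\<mu> = - 1 / \<delta>L\<close> for the
  backward one; the orbit points are \<open>(a, b) = (s (k + 1), s k)\<close>. Two quadratic
  quantities carry the geometry. \<open>D k\<close> is the cross product of consecutive edges and is
  merely multiplied by \<open>\<delta>\<close>, so its sign is constant. \<open>E k\<close> is minus
  the value of the edge function \<open>l k\<close> at the origin; its recurrence is forced by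
  \<open>\<mu>\<close>, so its positivity uses the monotonicity of \<open>s\<close> before and after
  its maximum.

  \<open>f\<close> raises the edge index on the right and lowers it on the left, where indices count
  backward time; edge 0 is the segment from \<open>X\<close> to \<open>f(X)\<close> on both sides. A
  step within one side therefore loses one inequality, which is regained from the quadrant
  containing the image. Only the passage from right to left needs (C2). Strictness enters with the
  regained inequality and moves on by one edge per step, which is why an iterate, rather than
  \<open>f\<close> itself, is shown to map into the interior.\<close>

locale return_orbit =
  fixes \<tau> \<delta> \<mu> :: real and s :: "nat \<Rightarrow> real" and N :: nat
  assumes delta_pos: "\<delta> > 0" and mu_nonzero: "\<mu> \<noteq> 0"
    and s0: "s 0 < 0" and s1: "s (Suc 0) = 0" and s2: "s 2 > 0"
    and rec: "\<And>k. s (Suc (Suc k)) = \<tau> * s (Suc k) - \<delta> * s k + \<mu>"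
    and N3: "N \<ge> 3" and s_pos: "\<And>k. 2 \<le> k \<Longrightarrow> k < N \<Longrightarrow> s k > 0" and s_N: "s N \<le> 0"
begin

definition d :: "nat \<Rightarrow> real" where "d k = s (Suc k) - s k"
definition D :: "nat \<Rightarrow> real" where "D k = (d (Suc k))\<^sup>2 - d k * d (Suc (Suc k))"
definition E :: "nat \<Rightarrow> real" where "E k = (s (Suc k))\<^sup>2 - s k * s (Suc (Suc k))"

text \<open>The edge of the orbit from \<open>(s (k + 1), s k)\<close> to \<open>(s (k + 2), s (k + 1))\<close> lies on the line
  \<open>l k a b = 0\<close>.\<close>

definition l :: "nat \<Rightarrow> real \<Rightarrow> real \<Rightarrow> real" where
  "l k a b = d k * (a - s (Suc k)) - d (Suc k) * (b - s k)"

lemma d_rec: "d (Suc (Suc k)) = \<tau> * d (Suc k) - \<delta> * d k"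
  using rec[of k] rec[of "Suc k"] by (simp add: d_def algebra_simps)

lemma D_Suc: "D (Suc k) = \<delta> * D k"
  unfolding D_def d_rec[of "Suc k"] d_rec[of k] by (simp add: power2_eq_square algebra_simps)

lemma E_Suc: "E (Suc k) = \<delta> * E k + \<mu> * d (Suc k)"
  unfolding E_def d_def rec[of "Suc k"] rec[of k] by (simp add: power2_eq_square algebra_simps)

lemma l_Suc: "l (Suc k) (\<tau> * a - \<delta> * b + \<mu>) a = \<delta> * l k a b"
  unfolding l_def d_rec[of k] rec[of k] by (simp add: algebra_simps)

lemma l_alt: "l k a b = - E k + d k * a - d (Suc k) * b"
  unfolding l_def E_def d_def by (simp add: power2_eq_square algebra_simps)

text \<open>Consecutive edge lines meet at the orbit point \<open>(s (k + 2), s (k + 1))\<close>,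
  and \<open>D k\<close> is the determinant of the two equations. Eliminating one coordinate turns
  two edge inequalities into a bound on the other.\<close>

lemma elim_a: "d (Suc k) * l k a b - d k * l (Suc k) a b = - D k * (b - s (Suc k))"
  unfolding l_def D_def d_def by (simp add: power2_eq_square algebra_simps)

lemma elim_b: "d (Suc (Suc k)) * l k a b - d (Suc k) * l (Suc k) a b = - D k * (a - s (Suc (Suc k)))"
  unfolding l_def D_def d_def by (simp add: power2_eq_square algebra_simps)

lemma d0: "d 0 > 0" and d1: "d (Suc 0) > 0"
  using s0 s1 s2 by (auto simp: d_def numeral_2_eq_2)

lemma s_nonneg: "1 \<le> k \<Longrightarrow> k < N \<Longrightarrow> s k \<ge> 0"
  using s_pos[of k] s1 by (cases "k = 1") auto

text \<open>If the orbit turned the other way, \<open>d\<close> would stay positive and \<open>s\<close> would never return.\<close>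

lemma D0: "D 0 > 0"
proof (rule ccontr)
  assume "\<not> D 0 > 0"
  then have "D k \<le> 0" for k
    using delta_pos by (induction k) (auto simp: D_Suc mult_nonneg_nonpos)
  note D = this
  have dp: "d k > 0 \<and> d (Suc k) > 0" for k
  proof (induction k)
    case 0 show ?case using d0 d1 by simp
  next
    case (Suc k)
    then have "d k * d (Suc (Suc k)) > 0"
      using D[of k] zero_less_power[of "d (Suc k)" 2] unfolding D_def by linarith
    with Suc show ?case by (simp add: zero_less_mult_iff)
  qed
  have "s (Suc k) \<ge> 0" for k
  proof (induction k)
    case 0 show ?case using s1 by simp
  next
    case (Suc k) then show ?case using dp[of "Suc k"] by (simp add: d_def)
  qed
  from this[of "N - 2"] have "s (N - 1) \<ge> 0" using N3
    by (metis One_nat_def Suc_diff_Suc Suc_1 Suc_le_eq le_less_trans lessI numeral_3_eq_3 order_less_imp_le)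
  moreover have "d (N - 1) > 0" using dp by blast
  ultimately show False using s_N N3 by (simp add: d_def)
qed

lemma D_pos: "D k > 0"
  using D0 delta_pos by (induction k) (auto simp: D_Suc)

text \<open>Edges 0 and 1 meet on the axis \<open>b = 0\<close> because \<open>s 1 = 0\<close>;
  above this axis edge 1 is the tighter constraint.\<close>

lemma l0_if_l1:
  assumes "b \<ge> 0" "l 1 a b \<le> 0"
  shows "l 0 a b \<le> 0" and "b > 0 \<or> l 1 a b < 0 \<Longrightarrow> l 0 a b < 0"
proof -
  have e: "d (Suc 0) * l 0 a b = d 0 * l 1 a b - D 0 * b"
    using elim_a[of 0 a b] s1 by simp
  have "d 0 * l 1 a b \<le> 0" "D 0 * b \<ge> 0"
    using assms d0 D0 by (auto simp: mult_nonneg_nonpos)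
  with e have "d (Suc 0) * l 0 a b \<le> 0" by linarith
  then show "l 0 a b \<le> 0" using d1 by (simp add: mult_le_0_iff)
  assume "b > 0 \<or> l 1 a b < 0"
  then have "d 0 * l 1 a b < 0 \<or> D 0 * b > 0"
    using d0 D0 by (auto simp: mult_pos_neg)
  with e \<open>d 0 * l 1 a b \<le> 0\<close> \<open>D 0 * b \<ge> 0\<close> have "d (Suc 0) * l 0 a b < 0" by linarith
  then show "l 0 a b < 0" using d1 by (simp add: mult_less_0_iff)
qed

text \<open>\<open>l_Suc\<close> hands the inequality for edge \<open>i\<close> at one point to edge
  \<open>i + 1\<close> at the next. Nothing is handed to edge 0; it is recovered by
  \<open>l0_if_l1\<close>, since the new second coordinate is nonnegative.\<close>

lemma l_point:
  assumes "\<And>i. 1 \<le> i \<Longrightarrow> i \<le> j \<Longrightarrow> s i \<ge> 0" "i \<le> j"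
  shows "l i (s (Suc j)) (s j) \<le> 0"
  using assms
proof (induction j arbitrary: i)
  case 0 then show ?case by (simp add: l_def)
next
  case (Suc j)
  have *: "l (Suc i) (s (Suc (Suc j))) (s (Suc j)) \<le> 0" if "i \<le> j" for i
    using Suc.IH[of i] that Suc.prems(1) l_Suc[of i "s (Suc j)" "s j"] delta_pos
    by (auto simp: rec mult_nonneg_nonpos)
  show ?case
  proof (cases i)
    case 0
    then show ?thesis using *[of 0] Suc.prems(1)[of "Suc j"] l0_if_l1(1) by simp
  next
    case (Suc i') then show ?thesis using * Suc.prems by simp
  qed
qed

text \<open>Otherwise the two consecutive edges \<open>k - 1\<close> and \<open>k\<close> would bound a cone to the right of
  \<open>s (k + 1)\<close> in which the orbit stays for ever.\<close>

lemma no_bounce: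
  assumes "d k \<le> 0" "Suc k < N"
  shows "d (Suc k) \<le> 0"
proof (rule ccontr)
  assume pos: "\<not> d (Suc k) \<le> 0"
  obtain k' where k': "k = Suc k'" using assms d0 by (cases k) auto
  have *: "(\<forall>i. 1 \<le> i \<and> i \<le> Suc j \<longrightarrow> s i \<ge> 0) \<and> s (Suc j) > 0" if "k \<le> j" for j
    using that
  proof (induction j rule: dec_induct)
    case base
    have "s (Suc k) > 0" using assms s_pos k' by simp
    then show ?case using assms s_nonneg by auto
  next
    case (step j)
    then have "l i (s (Suc (Suc j))) (s (Suc j)) \<le> 0" if "i \<le> Suc j" for i
      using l_point that by blast
    then have "l k' (s (Suc (Suc j))) (s (Suc j)) \<le> 0" "l k (s (Suc (Suc j))) (s (Suc j)) \<le> 0"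
      using k' step by auto
    then have "d (Suc k) * l k' (s (Suc (Suc j))) (s (Suc j)) \<le> 0"
      "d k * l k (s (Suc (Suc j))) (s (Suc j)) \<ge> 0"
      using assms pos by (auto simp: mult_nonneg_nonpos mult_nonpos_nonpos)
    with elim_b[of k' "s (Suc (Suc j))" "s (Suc j)"] k'
    have "D k' * (s (Suc (Suc j)) - s (Suc k)) \<ge> 0" by simp
    then have "s (Suc (Suc j)) \<ge> s (Suc k)" using D_pos[of k'] by (simp add: zero_le_mult_iff)
    moreover have "s (Suc k) > 0" using assms s_pos k' by simp
    ultimately show ?case using step by (auto simp: le_Suc_eq)
  qed
  have "s (Suc (N - 1)) > 0" using *[of "N - 1"] assms by linarith
  moreover have "Suc (N - 1) = N" using assms by simp
  ultimately show False using s_N by simp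
qed

section \<open>The orbit rises up to index \<open>m\<close> and falls after it\<close>

lemma d_last: "d (N - 1) < 0"
proof -
  have "Suc (N - 1) = N" "s (N - 1) > 0" using s_pos[of "N - 1"] N3 by auto
  then show ?thesis using s_N by (simp add: d_def)
qed

definition m :: nat where "m = (LEAST k. d k \<le> 0)"

lemma d_m: "d m \<le> 0" and m_le: "m \<le> N - 1"
  unfolding m_def using d_last LeastI[of "\<lambda>k. d k \<le> 0" "N - 1"] Least_le[of "\<lambda>k. d k \<le> 0" "N - 1"]
  by auto

lemma d_pos: "k < m \<Longrightarrow> d k > 0"
  unfolding m_def using not_less_Least by fastforce

lemma m_ge: "m \<ge> 2"
proof (rule ccontr)
  assume "\<not> m \<ge> 2"
  then have "m = 0 \<or> m = Suc 0" by auto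
  then show False using d_m d0 d1 by auto
qed

lemma d_nonpos: "m \<le> k \<Longrightarrow> k < N \<Longrightarrow> d k \<le> 0"
proof (induction k rule: dec_induct)
  case base show ?case by (rule d_m)
next
  case (step k) then show ?case using no_bounce[of k] by simp
qed

text \<open>A zero increment between two nonpositive ones would make \<open>D\<close> nonpositive,
  so after the return begins only the increment at \<open>m\<close> can vanish.\<close>

lemma d_neg: assumes "m < k" "k < N" shows "d k < 0"
proof (rule ccontr)
  assume "\<not> d k < 0"
  then have k0: "d k = 0" using d_nonpos[of k] assms by simp
  then have "k \<noteq> N - 1" using d_last by auto
  then have "d (Suc k) \<le> 0" using d_nonpos[of "Suc k"] assms by simp
  moreover obtain j where j: "k = Suc j" using assms by (cases k) auto
  moreover have "d j \<le> 0" using d_nonpos[of j] assms j by simp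
  ultimately have "D j \<le> 0" using k0 by (simp add: D_def mult_nonpos_nonpos)
  then show False using D_pos[of j] by simp
qed

section \<open>Position of the origin relative to the edges\<close>

lemma E_m: "E (m - 1) > 0"
proof -
  obtain j where j: "m = Suc j" using m_ge by (cases m) auto
  have "s (Suc j) > 0" using s_pos[of m] m_ge m_le N3 j by simp
  moreover have "s j \<ge> 0" using s_nonneg[of j] m_ge m_le N3 j by simp
  moreover have "s j < s (Suc j)" using d_pos[of j] j by (simp add: d_def)
  moreover have "s (Suc (Suc j)) \<le> s (Suc j)" using d_m j by (simp add: d_def)
  ultimately have "s j * s (Suc (Suc j)) < s (Suc j) * s (Suc j)"
    by (smt (verit) mult_left_mono mult_strict_right_mono)
  then show ?thesis using j by (simp add: E_def power2_eq_square)
qed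

lemma E_up: "i \<le> k \<Longrightarrow> E i > 0 \<Longrightarrow> (\<And>j. i < j \<Longrightarrow> j \<le> k \<Longrightarrow> \<mu> * d j \<ge> 0) \<Longrightarrow> E k > 0"
proof (induction k rule: dec_induct)
  case (step n)
  then have "E n > 0" "\<mu> * d (Suc n) \<ge> 0" by auto
  then show ?case using E_Suc[of n] delta_pos by (simp add: add_pos_nonneg)
qed simp

lemma E_down: "k \<le> i \<Longrightarrow> E i > 0 \<Longrightarrow> (\<And>j. k < j \<Longrightarrow> j \<le> i \<Longrightarrow> \<mu> * d j \<le> 0) \<Longrightarrow> E k > 0"
proof (induction k rule: inc_induct)
  case (step n)
  then have "E (Suc n) > 0" "\<mu> * d (Suc n) \<le> 0" by auto
  then have "\<delta> * E n > 0" using E_Suc[of n] by linarith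
  then show ?case using delta_pos by (simp add: zero_less_mult_iff)
qed simp

text \<open>By \<open>E_Suc\<close>, positivity moves up while \<open>\<mu> * d\<close> is
  nonnegative and down while it is nonpositive. For \<open>\<mu> > 0\<close> it spreads inward from
  the two ends towards \<open>m\<close>, for \<open>\<mu> < 0\<close> outward from
  \<open>E (m - 1)\<close>; only the latter covers the index \<open>N - 1\<close>.\<close>

lemma E_pos: assumes "k \<le> N - 2 \<or> \<mu> < 0 \<and> k \<le> N - 1" shows "E k > 0"
proof (cases "\<mu> > 0")
  case True
  have E0: "E 0 > 0" using s0 s1 s2 by (simp add: E_def numeral_2_eq_2 mult_neg_pos)
  have eN: "s (Suc (N - 2)) > 0" "s (N - 2) \<ge> 0" "Suc (Suc (N - 2)) = N"
    using s_pos[of "Suc (N - 2)"] s_nonneg[of "N - 2"] N3 by auto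
  then have "s (N - 2) * s (Suc (Suc (N - 2))) \<le> 0" using s_N by (simp add: mult_nonneg_nonpos)
  then have EN: "E (N - 2) > 0" using eN(1) by (simp add: E_def power2_eq_square add_pos_nonneg diff_gt_0_iff_gt) (smt (verit) mult_pos_pos)
  show ?thesis
  proof (cases "k < m")
    case True
    show ?thesis
    proof (rule E_up[OF _ E0])
      fix j assume "j \<le> k"
      with True have "d j > 0" using d_pos by simp
      then show "\<mu> * d j \<ge> 0" using \<open>\<mu> > 0\<close> by simp
    qed simp
  next
    case False
    show ?thesis
    proof (rule E_down[OF _ EN])
      fix j assume "k < j" "j \<le> N - 2"
      with False have "d j \<le> 0" using d_nonpos N3 by simp
      then show "\<mu> * d j \<le> 0" using \<open>\<mu> > 0\<close> by (simp add: mult_nonneg_nonpos)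
    qed (use assms \<open>\<mu> > 0\<close> in auto)
  qed
next
  case False
  then have mu: "\<mu> < 0" using mu_nonzero by simp
  show ?thesis
  proof (cases "k < m")
    case True
    show ?thesis
    proof (rule E_down[OF _ E_m])
      fix j assume "j \<le> m - 1"
      then have "d j > 0" using d_pos m_ge by simp
      then show "\<mu> * d j \<le> 0" using mu by (simp add: mult_nonpos_nonneg)
    qed (use True in auto)
  next
    case False
    show ?thesis
    proof (rule E_up[OF _ E_m])
      fix j assume "m - 1 < j" "j \<le> k"
      with assms have "d j \<le> 0" using d_nonpos N3 by auto
      then show "\<mu> * d j \<ge> 0" using mu by (simp add: mult_nonpos_nonpos)
    qed (use False in auto)
  qed
qed

text \<open>Where \<open>d (k + 2) \<le> 0\<close>, positivity of \<open>E\<close> decides.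
  Elsewhere the orbit is still rising, and \<open>elim_b\<close> passes the inequality on from the
  previous edge.\<close>

lemma l_p0: "k \<le> N - 2 \<Longrightarrow> l k 0 (s 0) \<le> 0"
proof (induction k)
  case 0 show ?case by (simp add: l_def s1 d_def)
next
  case (Suc k)
  show ?case
  proof (cases "d (Suc (Suc k)) \<le> 0")
    case True
    then have "d (Suc (Suc k)) * s 0 \<ge> 0" using s0 by (simp add: mult_nonpos_nonpos)
    then show ?thesis using E_pos[of "Suc k"] Suc.prems by (simp add: l_alt)
  next
    case False
    have "\<not> m \<le> Suc (Suc k)"
    proof -
      have "Suc (Suc k) < N" using Suc.prems N3 by linarith
      then show ?thesis using d_nonpos[of "Suc (Suc k)"] False by auto
    qed
    then have dk: "d (Suc k) > 0" using d_pos by simp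
    have "d (Suc (Suc k)) * l k 0 (s 0) \<le> 0" using Suc False by (simp add: mult_nonneg_nonpos)
    moreover have "D k * s (Suc (Suc k)) \<ge> 0"
      using D_pos[of k] s_nonneg[of "Suc (Suc k)"] Suc.prems N3 by auto
    ultimately have "d (Suc k) * l (Suc k) 0 (s 0) \<le> 0" using elim_b[of k 0 "s 0"] by simp
    then show ?thesis using dk by (simp add: mult_le_0_iff)
  qed
qed

text \<open>\<open>(s 2, 0)\<close> is the image of \<open>(0, s 0)\<close>, so \<open>l_Suc\<close>
  reduces edge \<open>k\<close> here to edge \<open>k - 1\<close> there.\<close>

lemma l_p1: "k \<le> N - 2 \<Longrightarrow> l k (s 2) 0 \<le> 0"
proof (cases k)
  case 0 then show ?thesis by (simp add: l_def d_def s1 numeral_2_eq_2 algebra_simps)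
next
  case (Suc i)
  assume "k \<le> N - 2"
  then have "l i 0 (s 0) \<le> 0" using l_p0 Suc by simp
  then show ?thesis using l_Suc[of i 0 "s 0"] rec[of 0] s1 Suc delta_pos
    by (simp add: numeral_2_eq_2 mult_nonneg_nonpos)
qed

text \<open>The assumptions describe the triangle with corners \<open>0\<close>, \<open>(s 2, 0)\<close> and \<open>(0, s 0)\<close>.\<close>

lemma l_triangle:
  assumes "a \<ge> 0" "b \<le> 0" "l 0 a b \<le> 0" "k \<le> N - 2"
  shows "l k a b \<le> 0" and "l 0 a b < 0 \<Longrightarrow> l k a b < 0"
proof -
  \<comment> \<open>Barycentric coordinates for the three corners. The weight \<open>t0\<close> of
    the origin equals \<open>l 0 a b\<close> up to the negative factor
    \<open>s 0 * s 2\<close>.\<close>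
  define t1 t2 t0 where "t1 = a / s 2" "t2 = b / s 0" "t0 = 1 - t1 - t2"
  have a: "a = t1 * s 2" and b: "b = t2 * s 0"
    using s0 s2 by (auto simp: t1_t2_t0_def)
  have t: "t1 \<ge> 0" "t2 \<ge> 0" using assms s0 s2
    by (auto simp: t1_t2_t0_def divide_nonpos_neg)
  have l0: "l 0 a b = s 0 * s 2 * t0"
    using s1 unfolding l_def d_def a b t1_t2_t0_def(3) by (simp add: numeral_2_eq_2 algebra_simps)
  have neg: "s 0 * s 2 < 0" using s0 s2 by (simp add: mult_neg_pos)
  have t0: "t0 \<ge> 0" using l0 neg assms(3) by (simp add: mult_le_0_iff)
  have lk: "l k a b = t1 * l k (s 2) 0 + t2 * l k 0 (s 0) - t0 * E k"
    unfolding l_alt t1_t2_t0_def(3) a b by (simp add: algebra_simps)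
  have Ek: "E k > 0" using E_pos assms by simp
  have n: "t1 * l k (s 2) 0 \<le> 0" "t2 * l k 0 (s 0) \<le> 0"
    using t l_p0 l_p1 assms by (auto simp: mult_nonneg_nonpos)
  show "l k a b \<le> 0" using lk n t0 Ek mult_nonneg_nonneg[of t0 "E k"] by linarith
  assume "l 0 a b < 0"
  then have "t0 > 0" using l0 t0 by (cases "t0 = 0") auto
  then show "l k a b < 0" using lk n Ek mult_pos_pos[of t0 "E k"] by linarith
qed

text \<open>Edges \<open>N - 2\<close> and \<open>N - 1\<close> meet at the last point, whose first
  coordinate \<open>s N\<close> is nonpositive. If \<open>d N < 0\<close>, elimination applies for
  \<open>a \<ge> 0\<close>; if \<open>d N \<ge> 0\<close>, the signs in \<open>l_alt\<close> decide.
  This regains the edge that a step within the left half-plane loses.\<close>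

lemma l_last:
  assumes "\<mu> < 0" "a \<ge> 0" "b \<ge> 0" "l (N - 2) a b \<le> 0"
  shows "l (N - 1) a b \<le> 0" and "a > 0 \<or> l (N - 2) a b < 0 \<Longrightarrow> l (N - 1) a b < 0"
proof -
  have idx: "Suc (N - 2) = N - 1" "Suc (N - 1) = N" using N3 by auto
  have dN: "d (N - 1) < 0" by (rule d_last)
  have e: "d (N - 1) * l (N - 1) a b = d N * l (N - 2) a b + D (N - 2) * (a - s N)"
    using elim_b[of "N - 2" a b] idx by simp
  have D: "D (N - 2) * (a - s N) \<ge> 0" "a > 0 \<Longrightarrow> D (N - 2) * (a - s N) > 0"
    using D_pos[of "N - 2"] s_N assms by auto
  have EN: "E (N - 1) > 0" using E_pos assms by simp
  have strict: "l (N - 1) a b < 0" if "d N \<ge> 0"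
  proof -
    have "d (N - 1) * a \<le> 0" "d N * b \<ge> 0" using dN assms that by (auto simp: mult_nonpos_nonneg)
    then show ?thesis using EN l_alt[of "N - 1" a b] unfolding idx by linarith
  qed
  show "l (N - 1) a b \<le> 0"
  proof (cases "d N \<ge> 0")
    case False
    then have "d N * l (N - 2) a b \<ge> 0" using assms by (simp add: mult_nonpos_nonpos)
    with e D have "d (N - 1) * l (N - 1) a b \<ge> 0" by simp
    then show ?thesis using dN by (simp add: zero_le_mult_iff)
  qed (use strict in simp)
  assume as: "a > 0 \<or> l (N - 2) a b < 0"
  show "l (N - 1) a b < 0"
  proof (cases "d N \<ge> 0")
    case False
    then have "d N * l (N - 2) a b \<ge> 0" "l (N - 2) a b < 0 \<Longrightarrow> d N * l (N - 2) a b > 0"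
      using assms by (auto simp: mult_nonpos_nonpos mult_neg_neg)
    with e D as have "d (N - 1) * l (N - 1) a b > 0" by (auto simp: add_pos_nonneg add_nonneg_pos)
    then show ?thesis using dN by (simp add: zero_less_mult_iff)
  qed (use strict in simp)
qed

text \<open>In this quadrant edge \<open>N - 2\<close> dominates all earlier ones, which is why (C2)
  can restrict itself to two lines.\<close>

lemma l_inner:
  assumes "a \<le> 0" "b \<ge> 0" "l (N - 2) a b \<le> 0" "k < N - 2"
  shows "l k a b < 0"
proof -
  have "l k a b \<le> 0 \<and> (k < N - 2 \<longrightarrow> l k a b < 0)" if "k \<le> N - 2" for k
    using that
  proof (induction k rule: inc_induct)
    case base then show ?case using assms by simp
  next
    case (step k)
    have Ek: "E k > 0" using E_pos step by simp
    show ?case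
    proof (cases "d (Suc k) \<le> 0")
      case False
      moreover have "Suc k < N" using step by linarith
      ultimately have "\<not> m \<le> Suc k" using d_nonpos[of "Suc k"] by auto
      then have "d k > 0" using d_pos by simp
      then have "d k * a \<le> 0" "d (Suc k) * b \<ge> 0" using assms False by (auto simp: mult_nonneg_nonpos)
      then show ?thesis using Ek by (simp add: l_alt)
    next
      case True
      have dk: "d (Suc k) \<le> 0" by fact
      then have "m \<le> Suc k" using d_pos[of "Suc k"] by (meson leI not_le)
      then have d2: "d (Suc (Suc k)) < 0" using d_neg step by simp
      have "s (Suc (Suc k)) > 0" using s_pos step by simp
      then have "D k * (a - s (Suc (Suc k))) < 0" using D_pos[of k] assms by (simp add: mult_pos_neg)
      moreover have "d (Suc k) * l (Suc k) a b \<ge> 0" using dk step by (intro mult_nonpos_nonpos) auto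
      ultimately have "d (Suc (Suc k)) * l k a b > 0" using elim_b[of k a b] by simp
      then have "l k a b < 0" using d2 by (simp add: zero_less_mult_iff)
      then show ?thesis by simp
    qed
  qed
  then show ?thesis using assms by simp
qed

text \<open>Supplies for \<open>Y\<close>, which lies on the switching line, the position relative
  to the line through \<open>V\<close> and \<open>f(V)\<close> that (C2) states for
  \<open>Z\<close>.\<close>

lemma l_last_axis:
  assumes "a \<le> 0" "l (N - 1) a 0 \<le> 0"
  shows "l (N - 2) a 0 < 0"
proof -
  have idx: "Suc (N - 2) = N - 1" "Suc (N - 1) = N" using N3 by auto
  have dN: "d (N - 1) < 0" by (rule d_last)
  show ?thesis
  proof (cases "d (N - 2) \<ge> 0")
    case True
    then have "d (N - 2) * a \<le> 0" using assms by (simp add: mult_nonneg_nonpos)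
    then show ?thesis using E_pos[of "N - 2"] by (simp add: l_alt)
  next
    case False
    then have "d (N - 2) * l (N - 1) a 0 \<ge> 0" using assms by (simp add: mult_nonpos_nonpos)
    moreover have "D (N - 2) * s (N - 1) > 0" using D_pos s_pos[of "N - 1"] N3 by simp
    ultimately have "d (N - 1) * l (N - 2) a 0 > 0"
      using elim_a[of "N - 2" a 0] idx by simp
    then show ?thesis using dN by (simp add: zero_less_mult_iff)
  qed
qed

lemma dE_last: "d (N - 1) * E (N - 2) < d (N - 2) * E (N - 1)"
proof -
  have idx: "Suc (N - 2) = N - 1" "Suc (N - 1) = N" using N3 by auto
  have "D (N - 2) * s (N - 1) > 0" using D_pos s_pos[of "N - 1"] N3 by simp
  then show ?thesis using elim_a[of "N - 2" 0 0] idx by (simp add: l_alt)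
qed

text \<open>\<open>b\<close> rises along edge \<open>m - 1\<close> and no longer along edge
  \<open>m\<close>, so the corner between them is the highest. In the same way edges
  \<open>m - 2\<close> and \<open>m - 1\<close> bound \<open>a\<close>.\<close>

lemma b_bounded:
  assumes "l (m - 1) a b \<le> 0" "l m a b \<le> 0"
  shows "b \<le> s m"
proof -
  obtain j where j: "m = Suc j" using m_ge by (cases m) auto
  have "d m * l j a b \<ge> 0" using d_m assms j by (simp add: mult_nonpos_nonpos)
  moreover have "d j * l m a b \<le> 0" using d_pos[of j] j assms by (simp add: mult_nonneg_nonpos)
  ultimately have "D j * (b - s m) \<le> 0" using elim_a[of j a b] j by simp
  then show ?thesis using D_pos[of j] by (simp add: mult_le_0_iff)
qed

lemma a_bounded:
  assumes "l (m - 2) a b \<le> 0" "l (m - 1) a b \<le> 0"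
  shows "a \<le> s m"
proof -
  obtain j where j: "m = Suc (Suc j)" using m_ge by (metis add_2_eq_Suc le_Suc_ex)
  have "d m * l j a b \<ge> 0" using d_m assms j by (simp add: mult_nonpos_nonpos)
  moreover have "d (Suc j) * l (Suc j) a b \<le> 0" using d_pos[of "Suc j"] j assms by (simp add: mult_nonneg_nonpos)
  ultimately have "D j * (a - s m) \<le> 0" using elim_b[of j a b] j by simp
  then show ?thesis using D_pos[of j] by (simp add: mult_le_0_iff)
qed

definition aF :: real where "aF = E (N - 1) / d (N - 1)"
definition bY :: real where "bY = - E (N - 2) / d (N - 1)"

text \<open>The orbit's last edge meets \<open>a = 0\<close> at \<open>(0, bY)\<close>, and \<open>(aF, 0)\<close> is the image of this point.
  The points \<open>(0, 0)\<close>, \<open>(0, bY)\<close>, \<open>(s N, s (N - 1))\<close>, \<open>(aF, 0)\<close> are the corners of the region below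
  if \<open>aF < 0\<close>, and the last one is left out otherwise.\<close>

lemma quadrilateral:
  assumes "a \<le> 0" "b \<ge> 0" "l (N - 2) a b \<le> 0" "l (N - 1) a b \<le> 0"
  obtains tZ tY tF where "tZ \<ge> 0" "tY \<ge> 0" "tF \<ge> 0" "tZ + tY + tF \<le> 1"
    "a = tZ * s N + tF * aF" "b = tZ * s (N - 1) + tY * bY" "tF = 0 \<or> aF < 0"
proof -
  have idx: "Suc (N - 2) = N - 1" "Suc (N - 1) = N" using N3 by auto
  have dN: "d (N - 1) < 0" by (rule d_last)
  have EN: "E (N - 2) > 0" using E_pos by simp
  have bYp: "bY > 0" using dN EN by (simp add: bY_def divide_pos_neg)
  have sp: "s (N - 1) > 0" using s_pos N3 by simp
  have Z1: "d (N - 2) * s N - d (N - 1) * s (N - 1) = E (N - 2)"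
    using l_alt[of "N - 2" "s N" "s (N - 1)"] unfolding idx l_def d_def by (simp add: algebra_simps)
  have Z2: "d (N - 1) * s N - d N * s (N - 1) = E (N - 1)"
    using l_alt[of "N - 1" "s N" "s (N - 1)"] unfolding idx l_def d_def by (simp add: algebra_simps)
  define t where "t = b / s (N - 1)"
  have t: "t \<ge> 0" "b = t * s (N - 1)" using sp assms by (auto simp: t_def)
  \<comment> \<open>\<open>w\<close> measures how far the point lies to the left of the ray from the
    origin through \<open>(s N, s (N - 1))\<close>. Its sign decides whether \<open>(0, bY)\<close>
    or \<open>(aF, 0)\<close> is the further corner to use.\<close>
  define w where "w = t * s N - a"
  have a: "a = t * s N - w" by (simp add: w_def)
  show ?thesis
  proof (cases "w \<ge> 0")
    case False
    then have "t * s N < a" by (simp add: w_def)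
    then have sN: "s N < 0" using t s_N assms by (cases "s N = 0") auto
    define tZ where "tZ = a / s N"
    define tY where "tY = (b - tZ * s (N - 1)) / bY"
    have tZ: "tZ \<ge> 0" "a = tZ * s N" using sN assms by (auto simp: tZ_def divide_nonpos_neg)
    have "tZ * s N > t * s N" using \<open>t * s N < a\<close> tZ by simp
    then have "tZ < t" using sN by (simp add: mult_less_cancel_right)
    then have "tZ * s (N - 1) \<le> b" using t sp by (simp add: mult_right_mono)
    then have tY: "tY \<ge> 0" "b = tZ * s (N - 1) + tY * bY" using bYp by (auto simp: tY_def)
    have bE: "d (N - 1) * bY = - E (N - 2)" using dN by (simp add: bY_def)
    have "l (N - 2) a b = - E (N - 2) + tZ * (d (N - 2) * s N - d (N - 1) * s (N - 1)) - tY * (d (N - 1) * bY)"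
      using l_alt[of "N - 2" a b] unfolding idx by (subst (asm) tZ(2), subst (asm) tY(2)) (simp add: algebra_simps tZ tY)
    also have "\<dots> = - E (N - 2) * (1 - tZ - tY)" unfolding Z1 bE by (simp add: algebra_simps)
    finally have "E (N - 2) * (1 - tZ - tY) \<ge> 0" using assms by simp
    then have "tZ + tY \<le> 1" using EN by (simp add: zero_le_mult_iff)
    then show ?thesis using that[of tZ tY 0] tZ tY by simp
  next
    case True
    have l1: "l (N - 2) a b = - E (N - 2) * (1 - t) - d (N - 2) * w"
    proof -
      have "l (N - 2) a b = - E (N - 2) + t * (d (N - 2) * s N - d (N - 1) * s (N - 1)) - d (N - 2) * w"
        using l_alt[of "N - 2" a b] unfolding idx t(2) a by (simp add: algebra_simps)
      then show ?thesis unfolding Z1 by (simp add: algebra_simps)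
    qed
    have l2: "l (N - 1) a b = - E (N - 1) * (1 - t) - d (N - 1) * w"
    proof -
      have "l (N - 1) a b = - E (N - 1) + t * (d (N - 1) * s N - d N * s (N - 1)) - d (N - 1) * w"
        using l_alt[of "N - 1" a b] unfolding idx t(2) a by (simp add: algebra_simps)
      then show ?thesis unfolding Z2 by (simp add: algebra_simps)
    qed
    have dw: "- d (N - 1) * w \<ge> 0" using dN True by (simp add: mult_nonpos_nonneg)
    show ?thesis
    proof (cases "E (N - 1) > 0")
      case E: True
      have aFn: "aF < 0" using E dN by (simp add: aF_def divide_pos_neg)
      define tF where "tF = w / (- aF)"
      have tF: "tF \<ge> 0" "w = - tF * aF" using aFn True by (auto simp: tF_def divide_nonneg_neg)
      have "d (N - 1) * aF = E (N - 1)" using dN by (simp add: aF_def)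
      then have "l (N - 1) a b = - E (N - 1) * (1 - t - tF)" unfolding l2 tF(2) by (simp add: algebra_simps)
      then have "E (N - 1) * (1 - t - tF) \<ge> 0" using assms by simp
      then have "t + tF \<le> 1" using E by (simp add: zero_le_mult_iff)
      then show ?thesis using that[of t 0 tF] t tF aFn a by simp
    next
      case E: False
      show ?thesis
      proof (cases "t \<le> 1")
        case True
        then have "E (N - 1) * (1 - t) \<le> 0" using E by (simp add: mult_nonpos_nonneg)
        with l2 dw assms have "d (N - 1) * w = 0" by linarith
        then have "w = 0" using dN by simp
        then show ?thesis using that[of t 0 0] t True a by simp
      next
        case False
        \<comment> \<open>Multiplying the two edge inequalities crosswise cancels the terms with
          \<open>c\<close>, and what remains contradicts \<open>dE_last\<close>.\<close>
        define c where "c = t - 1"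
        have c: "c > 0" "1 - t = - c" using False by (auto simp: c_def)
        have i1: "c * E (N - 2) \<le> d (N - 2) * w" and i2: "c * E (N - 1) \<le> d (N - 1) * w"
          using l1 l2 assms unfolding c by (auto simp: algebra_simps)
        have "c * E (N - 2) > 0" using c EN by simp
        with i1 True have wp: "w > 0" by (cases "w = 0") auto
        have "(- E (N - 1)) * (c * E (N - 2)) \<le> (- E (N - 1)) * (d (N - 2) * w)"
          using i1 E by (intro mult_left_mono) auto
        moreover have "E (N - 2) * (c * E (N - 1)) \<le> E (N - 2) * (d (N - 1) * w)"
          using i2 EN by (intro mult_left_mono) auto
        ultimately have "w * (d (N - 2) * E (N - 1)) \<le> w * (d (N - 1) * E (N - 2))"
          by (simp add: algebra_simps)
        then show ?thesis using dE_last wp by simp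
      qed
    qed
  qed
qed

end

section \<open>The polygonal region\<close>

lemma bc_piece_components [simp]:
  "bc_piece (bc_matrix \<tau> \<delta>) x $ 1 = \<tau> * x $ 1 + x $ 2 + 1"
  "bc_piece (bc_matrix \<tau> \<delta>) x $ 2 = - \<delta> * x $ 1"
  by (simp_all add: bc_piece_def bc_matrix_def matrix_vector_mult_def sum_2)

lemma vec2_eq_iff: "(x :: real^2) = y \<longleftrightarrow> x $ 1 = y $ 1 \<and> x $ 2 = y $ 2"
  by (simp add: vec_eq_iff forall_2)

lemma bcnf_left: "x $ 1 \<le> 0 \<Longrightarrow> bcnf \<tau>L \<delta>L \<tau>R \<delta>R x = bc_piece (bc_matrix \<tau>L \<delta>L) x"
  by (simp add: bcnf_def)

lemma bcnf_right: "x $ 1 \<ge> 0 \<Longrightarrow> bcnf \<tau>L \<delta>L \<tau>R \<delta>R x = bc_piece (bc_matrix \<tau>R \<delta>R) x"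
  by (cases "x $ 1 = 0") (auto simp: bcnf_def vec2_eq_iff)

lemma continuous_on_bc_piece: "continuous_on S (bc_piece A)"
  unfolding bc_piece_def by (intro continuous_intros)

lemma closed_left: "closed {x :: real^2. x $ 1 \<le> 0}" and closed_right: "closed {x :: real^2. x $ 1 \<ge> 0}"
  by (intro closed_Collect_le continuous_intros)+

lemma continuous_bcnf: "continuous_on UNIV (bcnf \<tau>L \<delta>L \<tau>R \<delta>R)"
proof -
  have "continuous_on ({x. x $ 1 \<le> 0} \<union> {x. x $ 1 \<ge> 0}) (bcnf \<tau>L \<delta>L \<tau>R \<delta>R)"
  proof (rule continuous_on_closed_Un)
    show "continuous_on {x. x $ 1 \<le> 0} (bcnf \<tau>L \<delta>L \<tau>R \<delta>R)"
      using continuous_on_bc_piece by (rule continuous_on_eq) (simp add: bcnf_left)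
    show "continuous_on {x. x $ 1 \<ge> 0} (bcnf \<tau>L \<delta>L \<tau>R \<delta>R)"
      using continuous_on_bc_piece by (rule continuous_on_eq) (simp add: bcnf_right)
  qed (use closed_left closed_right in auto)
  moreover have "{x :: real^2. x $ 1 \<le> 0} \<union> {x. x $ 1 \<ge> 0} = UNIV" by auto
  ultimately show ?thesis by simp
qed

text \<open>\<open>sR (k + 1)\<close> is the first coordinate of \<open>f\<^bsup>k\<^esup>(X)\<close> for \<open>k \<le> r\<close>, and \<open>- sL (k + 1)\<close> that of
  \<open>f\<^bsup>-k\<^esup>(X)\<close> for \<open>k < \<ell>\<close>, where \<open>NR = r + 1\<close> and \<open>NL = \<ell> + 1\<close>. All other values merely continue the
  recurrences; so \<open>sR 0\<close> and \<open>sL NL\<close> need not come from points of the orbit.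
  The backward orbit satisfies a recurrence of the same form, with the coordinates exchanged.\<close>

locale polygon =
  R: return_orbit \<tau>R \<delta>R 1 sR NR + L: return_orbit "\<tau>L / \<delta>L" "1 / \<delta>L" "- 1 / \<delta>L" sL NL
  for \<tau>L \<delta>L \<tau>R \<delta>R :: real and sR sL :: "nat \<Rightarrow> real" and NR NL :: nat +
  fixes \<beta> :: real
  assumes beta_pos: "\<beta> > 0"
    and sR0: "sR 0 = - \<beta> / \<delta>R" and sR2: "sR 2 = \<beta> + 1"
    and sL0: "sL 0 = - (\<beta> + 1)" and sL2: "sL 2 = \<beta> / \<delta>L"
begin

abbreviation f :: "real^2 \<Rightarrow> real^2" where "f \<equiv> bcnf \<tau>L \<delta>L \<tau>R \<delta>R"
definition fL :: "real^2 \<Rightarrow> real^2" where "fL = bc_piece (bc_matrix \<tau>L \<delta>L)"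
definition fR :: "real^2 \<Rightarrow> real^2" where "fR = bc_piece (bc_matrix \<tau>R \<delta>R)"

definition Rl :: "nat \<Rightarrow> real^2 \<Rightarrow> real" where "Rl k x = R.l k (x $ 1) (- x $ 2 / \<delta>R)"
definition Ll :: "nat \<Rightarrow> real^2 \<Rightarrow> real" where "Ll k x = L.l k (x $ 2 / \<delta>L) (- x $ 1)"

definition ptY :: "real^2" where "ptY = vector [0, - \<delta>R * R.bY]"
definition ptZ :: "real^2" where "ptZ = vector [sR NR, - \<delta>R * sR (NR - 1)]"
definition ptU :: "real^2" where "ptU = vector [- L.bY, 0]"

text \<open>The left edges run from \<open>X\<close> (index 1) backward to \<open>V\<close>, and
  index \<open>NL - 1\<close> is the line from \<open>V\<close> to the preimage of \<open>U\<close>,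
  which closes the region below. Edge 0 lies in the right half-plane and appears in
  \<open>Omega_R\<close>.\<close>

definition Omega_L :: "(real^2) set" where
  "Omega_L = {x. x $ 1 \<le> 0 \<and> (\<forall>k. 1 \<le> k \<and> k \<le> NL - 1 \<longrightarrow> Ll k x \<le> 0)}"
definition Omega_R :: "(real^2) set" where
  "Omega_R = {x. x $ 1 \<ge> 0 \<and> (\<forall>k \<le> NR - 2. Rl k x \<le> 0)}"
definition Omega :: "(real^2) set" where "Omega = Omega_L \<union> Omega_R"
text \<open>Under (C2), \<open>Omega_L\<close> reaches on the switching line down to the preimage of
  \<open>U\<close>, but \<open>Omega_R\<close> only down to \<open>Y\<close>, so a point of
  \<open>Omega\<close> there may violate the inequalities of one side. Demanding both makes the
  lemmas for either side applicable.\<close>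

definition Omega' :: "(real^2) set" where
  "Omega' = {x. (x $ 1 \<le> 0 \<longrightarrow> x \<in> Omega_L) \<and> (x $ 1 \<ge> 0 \<longrightarrow> x \<in> Omega_R)}"

lemma fL_comp [simp]: "fL x $ 1 = \<tau>L * x $ 1 + x $ 2 + 1" "fL x $ 2 = - \<delta>L * x $ 1"
  by (simp_all add: fL_def)
lemma fR_comp [simp]: "fR x $ 1 = \<tau>R * x $ 1 + x $ 2 + 1" "fR x $ 2 = - \<delta>R * x $ 1"
  by (simp_all add: fR_def)

lemma f_left: "x $ 1 \<le> 0 \<Longrightarrow> f x = fL x"
  by (simp add: fL_def bcnf_left)
lemma f_right: "x $ 1 \<ge> 0 \<Longrightarrow> f x = fR x"
  by (simp add: fR_def bcnf_right)

lemma deltas: "\<delta>L > 0" "\<delta>R > 0"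
  using L.delta_pos R.delta_pos by auto
lemma muL: "- 1 / \<delta>L < 0" using deltas by simp

lemma Omega'_Omega: "Omega' \<subseteq> Omega" unfolding Omega'_def Omega_def by force

lemma Rl_fR: "Rl (Suc k) (fR x) = \<delta>R * Rl k x"
  using R.l_Suc[of k "x $ 1" "- x $ 2 / \<delta>R"] deltas by (simp add: Rl_def)

lemma Ll_fL: "Ll k (fL x) = \<delta>L * Ll (Suc k) x"
proof -
  have "\<tau>L / \<delta>L * (fL x $ 2 / \<delta>L) - 1 / \<delta>L * (- fL x $ 1) + - 1 / \<delta>L = x $ 2 / \<delta>L"
    using deltas by (simp add: field_simps)
  moreover have "fL x $ 2 / \<delta>L = - x $ 1" using deltas by simp
  ultimately show ?thesis using L.l_Suc[of k "fL x $ 2 / \<delta>L" "- fL x $ 1"] deltas by (simp add: Ll_def)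
qed

lemma Ll0_Rl0: "\<delta>L * Ll 0 x = \<delta>R * Rl 0 x"
proof -
  have s: "sR (Suc (Suc 0)) = \<beta> + 1" "sL (Suc (Suc 0)) = \<beta> / \<delta>L"
    using sR2 sL2 by (auto simp: numeral_2_eq_2)
  show ?thesis
    unfolding Ll_def Rl_def R.l_def L.l_def R.d_def L.d_def s sR0 sL0 R.s1 L.s1
    using deltas by (simp add: field_simps)
qed

lemma f_Rl: "x $ 1 \<ge> 0 \<Longrightarrow> Rl (Suc k) (f x) = \<delta>R * Rl k x"
  by (simp add: f_right Rl_fR)
lemma f_Ll: "x $ 1 \<le> 0 \<Longrightarrow> Ll k (f x) = \<delta>L * Ll (Suc k) x"
  by (simp add: f_left Ll_fL)

lemma NR_idx: "Suc (NR - 2) = NR - 1" "Suc (NR - 1) = NR" and NL_idx: "Suc (NL - 2) = NL - 1" "Suc (NL - 1) = NL"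
  using R.N3 L.N3 by auto

text \<open>An affine function on a polygon is bounded below by its values at the corners, here
  those of \<open>quadrilateral\<close>. It serves twice: for the edge functions, and for the first
  coordinate of an iterate of the left piece.\<close>

lemma hull_pos:
  fixes h :: "real^2 \<Rightarrow> real"
  assumes h: "\<And>x. h x = c0 + c1 * x $ 1 + c2 * x $ 2"
    and y: "y $ 1 \<le> 0" "y $ 2 \<le> 0" "Rl (NR - 2) y \<le> 0" "Rl (NR - 1) y \<le> 0"
    and pos: "h 0 > 0" "h ptY > 0" "h ptZ > 0" "f ptY $ 1 < 0 \<Longrightarrow> h (f ptY) > 0"
  shows "h y > 0"
proof -
  have y2: "- y $ 2 / \<delta>R \<ge> 0" using y deltas by (simp add: divide_nonpos_pos)
  obtain tZ tY tF where t: "tZ \<ge> 0" "tY \<ge> 0" "tF \<ge> 0" "tZ + tY + tF \<le> 1"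
    and y1: "y $ 1 = tZ * sR NR + tF * R.aF" and y2: "- y $ 2 / \<delta>R = tZ * sR (NR - 1) + tY * R.bY"
    and F: "tF = 0 \<or> R.aF < 0"
    using R.quadrilateral[OF y(1) y2] y(3,4) unfolding Rl_def by metis
  have y2': "y $ 2 = - \<delta>R * (tZ * sR (NR - 1) + tY * R.bY)" using y2 deltas by (simp add: field_simps)
  \<comment> \<open>This is \<open>E_Suc\<close> at the last edge with \<open>\<mu> = 1\<close>; it
    identifies the corner \<open>(aF, 0)\<close> with the image of \<open>Y\<close>.\<close>
  have aF: "R.aF = 1 - \<delta>R * R.bY"
    using R.E_Suc[of "NR - 2"] R.d_last NR_idx by (simp add: R.aF_def R.bY_def field_simps)
  have fY: "f ptY $ 1 = R.aF" "f ptY $ 2 = 0"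
    by (simp_all add: ptY_def f_left aF)
  have *: "h y = tZ * h ptZ + tY * h ptY + tF * h (f ptY) + (1 - tZ - tY - tF) * h 0"
    unfolding h fY y1 y2' by (simp add: ptZ_def ptY_def algebra_simps)
  have hF: "tF = 0 \<or> h (f ptY) > 0" using F pos(4) fY by auto
  have nn: "tZ * h ptZ \<ge> 0" "tY * h ptY \<ge> 0" "tF * h (f ptY) \<ge> 0" "(1 - tZ - tY - tF) * h 0 \<ge> 0"
    using t pos hF by auto
  have "tZ > 0 \<or> tY > 0 \<or> tF > 0 \<or> 1 - tZ - tY - tF > 0" using t by linarith
  then have "tZ * h ptZ > 0 \<or> tY * h ptY > 0 \<or> tF * h (f ptY) > 0 \<or> (1 - tZ - tY - tF) * h 0 > 0"
    using pos hF by (auto intro: mult_pos_pos)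
  with nn show ?thesis unfolding * by linarith
qed

lemma Ll_affine: "Ll k x = - L.E k + L.d (Suc k) * x $ 1 + L.d k / \<delta>L * x $ 2"
  by (simp add: Ll_def L.l_alt)
lemma Rl_affine: "Rl k x = - R.E k + R.d k * x $ 1 + R.d (Suc k) / \<delta>R * x $ 2"
  by (simp add: Rl_def R.l_alt)

lemma LE_pos: "k \<le> NL - 1 \<Longrightarrow> L.E k > 0"
  using L.E_pos muL by simp
lemma RE_pos: "k \<le> NR - 2 \<Longrightarrow> R.E k > 0"
  using R.E_pos by simp

lemma RbY_pos: "R.bY > 0"
  using R.d_last RE_pos[of "NR - 2"] by (simp add: R.bY_def divide_pos_neg)

lemma Ll_last:
  assumes "y $ 1 \<le> 0" "y $ 2 \<ge> 0" "Ll (NL - 2) y \<le> 0"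
  shows "Ll (NL - 1) y \<le> 0" and "y $ 2 > 0 \<or> Ll (NL - 2) y < 0 \<Longrightarrow> Ll (NL - 1) y < 0"
  using L.l_last[OF muL, of "y $ 2 / \<delta>L" "- y $ 1"] assms deltas by (auto simp: Ll_def)

lemma Rl_first:
  assumes "y $ 2 \<le> 0" "Rl 1 y \<le> 0"
  shows "Rl 0 y \<le> 0" and "y $ 2 < 0 \<or> Rl 1 y < 0 \<Longrightarrow> Rl 0 y < 0"
  using R.l0_if_l1[of "- y $ 2 / \<delta>R" "y $ 1"] assms deltas by (auto simp: Rl_def divide_nonpos_pos divide_neg_pos)

lemma Rl_triangle:
  assumes "y $ 1 \<ge> 0" "y $ 2 \<ge> 0" "Rl 0 y \<le> 0" "k \<le> NR - 2"
  shows "Rl k y \<le> 0" and "Rl 0 y < 0 \<Longrightarrow> Rl k y < 0"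
  using R.l_triangle[of "y $ 1" "- y $ 2 / \<delta>R" k] assms deltas by (auto simp: Rl_def)

text \<open>Edge \<open>k + 1\<close> at \<open>x\<close> becomes edge \<open>k\<close> at
  \<open>f x\<close>. The missing edge \<open>NL - 1\<close> follows from edge
  \<open>NL - 2\<close>, because the image lies on or above the horizontal axis.\<close>

lemma image_left_of_left:
  assumes "x \<in> Omega_L" "f x $ 1 \<le> 0"
  shows "f x \<in> Omega_L"
proof -
  have x: "x $ 1 \<le> 0" using assms by (simp add: Omega_L_def)
  have k: "Ll k (f x) \<le> 0" if "k \<le> NL - 2" for k
  proof -
    have "Ll (Suc k) x \<le> 0" using assms that L.N3 by (auto simp: Omega_L_def)
    then show ?thesis using f_Ll[OF x] deltas by (simp add: mult_nonneg_nonpos)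
  qed
  have "f x $ 2 \<ge> 0" using x f_left[OF x] deltas by (simp add: mult_nonneg_nonpos)
  then have "Ll (NL - 1) (f x) \<le> 0" using Ll_last assms k by simp
  then have "Ll j (f x) \<le> 0" if "j \<le> NL - 1" for j
    using k that NL_idx by (cases "j = NL - 1") auto
  then show ?thesis using assms by (simp add: Omega_L_def)
qed

text \<open>Edge 1 at \<open>x\<close> becomes edge 0 at \<open>f x\<close>, the line through
  \<open>X\<close> and \<open>f(X)\<close>. With the signs of the coordinates this puts the image
  into the triangle with corners 0, \<open>X\<close> and \<open>f(X)\<close>, where
  \<open>l_triangle\<close> gives all right edges.\<close>

lemma image_right_of_left:
  assumes "x \<in> Omega_L" "f x $ 1 \<ge> 0"
  shows "f x \<in> Omega_R" and "Ll 1 x < 0 \<Longrightarrow> k \<le> NR - 2 \<Longrightarrow> Rl k (f x) < 0"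
proof -
  have x: "x $ 1 \<le> 0" using assms by (simp add: Omega_L_def)
  have y2: "f x $ 2 \<ge> 0" using x f_left[OF x] deltas by (simp add: mult_nonneg_nonpos)
  have e: "\<delta>R * Rl 0 (f x) = \<delta>L * (\<delta>L * Ll 1 x)"
    using Ll0_Rl0[of "f x"] f_Ll[OF x, of 0] by simp
  have "Ll 1 x \<le> 0" using assms L.N3 by (simp add: Omega_L_def)
  then have "\<delta>R * Rl 0 (f x) \<le> 0" unfolding e using deltas by (simp add: mult_le_0_iff)
  then have r: "Rl 0 (f x) \<le> 0" using deltas by (simp add: mult_le_0_iff)
  show "f x \<in> Omega_R" using Rl_triangle(1)[OF assms(2) y2 r] assms by (simp add: Omega_R_def)
  assume "Ll 1 x < 0" "k \<le> NR - 2"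
  then have "\<delta>R * Rl 0 (f x) < 0" unfolding e using deltas by (simp add: mult_less_0_iff)
  then have "Rl 0 (f x) < 0" using deltas by (simp add: mult_less_0_iff)
  then show "Rl k (f x) < 0" using Rl_triangle(2)[OF assms(2) y2 r] \<open>k \<le> NR - 2\<close> by simp
qed

lemma image_right_of_right:
  assumes "x \<in> Omega_R" "f x $ 1 \<ge> 0"
  shows "f x \<in> Omega_R"
proof -
  have x: "x $ 1 \<ge> 0" using assms by (simp add: Omega_R_def)
  have k: "Rl (Suc k) (f x) \<le> 0" if "k \<le> NR - 2" for k
    using assms that deltas f_Rl[OF x] by (simp add: Omega_R_def mult_nonneg_nonpos)
  have "f x $ 2 \<le> 0" using x f_right[OF x] deltas by simp
  then have "Rl 0 (f x) \<le> 0" using Rl_first k[of 0] by simp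
  then have "Rl k (f x) \<le> 0" if "k \<le> NR - 2" for k
    using k that by (cases k) auto
  then show ?thesis using assms by (simp add: Omega_R_def)
qed

lemma image_of_right_lines:
  assumes "x \<in> Omega_R"
  shows "f x $ 2 \<le> 0" "Rl (NR - 2) (f x) \<le> 0" "Rl (NR - 1) (f x) \<le> 0"
proof -
  have x: "x $ 1 \<ge> 0" using assms by (simp add: Omega_R_def)
  have k: "Rl (Suc k) (f x) \<le> 0" if "k \<le> NR - 2" for k
    using assms that deltas f_Rl[OF x] by (simp add: Omega_R_def mult_nonneg_nonpos)
  show "f x $ 2 \<le> 0" using x f_right[OF x] deltas by simp
  show "Rl (NR - 1) (f x) \<le> 0" using k[of "NR - 2"] NR_idx by simp
  have "NR - 2 = Suc (NR - 3)" using R.N3 by simp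
  then show "Rl (NR - 2) (f x) \<le> 0" using k[of "NR - 3"] by simp
qed

end

text \<open>The three inequalities are those of (C2): \<open>Ll (NL - 1)\<close> vanishes on the line through \<open>f\<^bsup>-1\<^esup>(U)\<close>
  and \<open>V\<close>, and \<open>Ll (NL - 2)\<close> on the one through \<open>V\<close> and \<open>f(V)\<close>.\<close>

locale trapped_polygon = polygon +
  assumes Y_above: "Ll (NL - 1) ptY < 0" and Z_above: "Ll (NL - 1) ptZ < 0" and Z_right: "Ll (NL - 2) ptZ < 0"
begin

lemma Y_right: "Ll (NL - 2) ptY < 0"
  using L.l_last_axis[of "ptY $ 2 / \<delta>L"] Y_above RbY_pos deltas
  by (simp add: Ll_def ptY_def divide_nonpos_pos)

text \<open>Here (C2) enters: the corners of the quadrilateral containing the image satisfy the last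
  two edge inequalities strictly, and \<open>l_inner\<close> yields the earlier ones.\<close>

lemma image_left_of_right:
  assumes "x \<in> Omega_R" "f x $ 1 \<le> 0" "k \<le> NL - 1"
  shows "Ll k (f x) < 0"
proof -
  have hull: "Ll k (f x) < 0" if "L.E k > 0" "Ll k ptY < 0" "Ll k ptZ < 0" "f ptY $ 1 < 0 \<Longrightarrow> Ll k (f ptY) < 0" for k
  proof -
    have "- Ll k (f x) > 0"
    proof (rule hull_pos[where h = "\<lambda>x. - Ll k x"])
      show "- Ll k x = L.E k + (- L.d (Suc k)) * x $ 1 + (- L.d k / \<delta>L) * x $ 2" for x
        by (simp add: Ll_affine)
      show "0 < - Ll k 0" using that by (simp add: Ll_affine)
    qed (use that assms image_of_right_lines in auto)
    then show ?thesis by simp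
  qed
  have Y1: "ptY $ 1 = 0" by (simp add: ptY_def)
  have F2: "f ptY $ 2 = 0" by (simp add: f_left Y1)
  \<comment> \<open>The inequality for edge \<open>NL - 1\<close> at \<open>Y\<close> is carried by
    \<open>f\<close> to edge \<open>NL - 2\<close> at the fourth corner.\<close>
  have F: "Ll (NL - 2) (f ptY) < 0" using f_Ll[of ptY "NL - 2"] Y1 Y_above deltas NL_idx by (simp add: mult_pos_neg)
  have 2: "Ll (NL - 2) (f x) < 0" using hull[of "NL - 2"] LE_pos Y_right Z_right F by simp
  have 1: "Ll (NL - 1) (f x) < 0"
  proof (rule hull)
    assume "f ptY $ 1 < 0"
    then show "Ll (NL - 1) (f ptY) < 0" using Ll_last(2)[of "f ptY"] F F2 by simp
  qed (use LE_pos Y_above Z_above in auto)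
  show ?thesis
  proof (cases "k < NL - 2")
    case True
    then show ?thesis
      using L.l_inner[of "f x $ 2 / \<delta>L" "- f x $ 1" k] 2 assms image_of_right_lines(1)[OF assms(1)] deltas
      by (simp add: Ll_def divide_nonpos_pos)
  next
    case False
    then have "k = NL - 2 \<or> k = NL - 1" using assms by auto
    then show ?thesis using 1 2 by auto
  qed
qed

lemma f_Omega: "x \<in> Omega \<Longrightarrow> f x \<in> Omega'"
  using image_left_of_left image_right_of_left(1) image_right_of_right image_left_of_right
  unfolding Omega'_def Omega_def by (fastforce simp: Omega_L_def intro: less_imp_le)

end

section \<open>The trapping region\<close>

lemma linear_bound:
  fixes c :: real
  assumes "c > 0" "c * a \<le> e + g * b" "\<bar>b\<bar> \<le> B"
  shows "a \<le> (\<bar>e\<bar> + \<bar>g\<bar> * B) / c"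
proof -
  have "g * b \<le> \<bar>g\<bar> * \<bar>b\<bar>" by (metis abs_ge_self abs_mult)
  also have "\<dots> \<le> \<bar>g\<bar> * B" using assms by (simp add: mult_left_mono)
  finally show ?thesis using assms by (simp add: field_simps)
qed

context return_orbit
begin

text \<open>After \<open>b_bounded\<close>, edges 1 and \<open>N - 1\<close> bound \<open>a\<close>
  from the two sides, since \<open>d 1\<close> and \<open>d (N - 1)\<close> have opposite
  signs.\<close>

lemma region_bounded_left:
  obtains C where "\<And>a b. b \<ge> 0 \<Longrightarrow> (\<And>k. 1 \<le> k \<Longrightarrow> k \<le> N - 1 \<Longrightarrow> l k a b \<le> 0) \<Longrightarrow> \<bar>a\<bar> \<le> C \<and> \<bar>b\<bar> \<le> C"
proof -
  define C1 where "C1 = (\<bar>E 1\<bar> + \<bar>d 2\<bar> * s m) / d 1"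
  define C2 where "C2 = (\<bar>E (N - 1)\<bar> + \<bar>d N\<bar> * s m) / (- d (N - 1))"
  show ?thesis
  proof (rule that[of "\<bar>C1\<bar> + \<bar>C2\<bar> + \<bar>s m\<bar>"])
    fix a b assume b: "b \<ge> 0" and l: "\<And>k. 1 \<le> k \<Longrightarrow> k \<le> N - 1 \<Longrightarrow> l k a b \<le> 0"
    have bm: "b \<le> s m" using b_bounded[of a b] l[of m] l[of "m - 1"] m_ge m_le by auto
    have idx: "Suc (N - 1) = N" using N3 by simp
    have l1: "l 1 a b \<le> 0" and lN: "l (N - 1) a b \<le> 0" by (rule l; use N3 in auto)+
    have "a \<le> C1" unfolding C1_def
      by (rule linear_bound[where b = b]) (use d1 l1 N3 l_alt[of 1 a b] b bm in \<open>auto simp: numeral_2_eq_2\<close>)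
    moreover have "- a \<le> C2" unfolding C2_def
      by (rule linear_bound[where b = b]) (use d_last lN l_alt[of "N - 1" a b, unfolded idx] b bm in auto)
    ultimately show "\<bar>a\<bar> \<le> \<bar>C1\<bar> + \<bar>C2\<bar> + \<bar>s m\<bar> \<and> \<bar>b\<bar> \<le> \<bar>C1\<bar> + \<bar>C2\<bar> + \<bar>s m\<bar>" using b bm by linarith
  qed
qed

lemma region_bounded_right:
  obtains C where "\<And>a b. a \<ge> 0 \<Longrightarrow> (\<And>k. k \<le> N - 2 \<Longrightarrow> l k a b \<le> 0) \<Longrightarrow> \<bar>a\<bar> \<le> C \<and> \<bar>b\<bar> \<le> C"
proof -
  define C1 where "C1 = (\<bar>E 0\<bar> + \<bar>- d 0\<bar> * s m) / d 1"
  define C2 where "C2 = (\<bar>E (N - 2)\<bar> + \<bar>- d (N - 2)\<bar> * s m) / (- d (N - 1))"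
  show ?thesis
  proof (rule that[of "\<bar>C1\<bar> + \<bar>C2\<bar> + \<bar>s m\<bar>"])
    fix a b assume a: "a \<ge> 0" and l: "\<And>k. k \<le> N - 2 \<Longrightarrow> l k a b \<le> 0"
    have am: "a \<le> s m" using a_bounded[of a b] l[of "m - 2"] l[of "m - 1"] m_ge m_le by auto
    have idx: "Suc (N - 2) = N - 1" using N3 by simp
    have "- b \<le> C1" unfolding C1_def
      by (rule linear_bound[where b = a]) (use d1 l[of 0] l_alt[of 0 a b] a am in auto)
    moreover have "b \<le> C2" unfolding C2_def
      by (rule linear_bound[where b = a]) (use d_last l[of "N - 2"] l_alt[of "N - 2" a b, unfolded idx] a am in auto)
    ultimately show "\<bar>a\<bar> \<le> \<bar>C1\<bar> + \<bar>C2\<bar> + \<bar>s m\<bar> \<and> \<bar>b\<bar> \<le> \<bar>C1\<bar> + \<bar>C2\<bar> + \<bar>s m\<bar>" using a am by linarith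
  qed
qed

end

section \<open>From an iterate mapping into the interior to a trapping region\<close>

lemma compact_neighbourhood:
  fixes K :: "'a::euclidean_space set"
  assumes "compact K" "open U" "K \<subseteq> U"
  obtains C where "compact C" "K \<subseteq> interior C" "C \<subseteq> U"
proof (cases "K = {}")
  case False
  obtain e where e: "e > 0" "(\<Union>x\<in>K. cball x e) \<subseteq> U"
    using compact_subset_open_imp_cball_epsilon_subset assms by blast
  have "compact (\<Union>x\<in>K. cball x e)"
  proof -
    have "(\<Union>x\<in>K. cball x e) = {x + y |x y. x \<in> K \<and> y \<in> cball 0 e}"
    proof (intro set_eqI iffI)
      fix z assume "z \<in> (\<Union>x\<in>K. cball x e)"
      then obtain x where "x \<in> K" "dist x z \<le> e" by auto
      then show "z \<in> {x + y |x y. x \<in> K \<and> y \<in> cball 0 e}"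
        by (intro CollectI exI[of _ x] exI[of _ "z - x"]) (auto simp: dist_norm norm_minus_commute)
    next
      fix z assume "z \<in> {x + y |x y. x \<in> K \<and> y \<in> cball 0 e}"
      then obtain x y where "z = x + y" "x \<in> K" "norm y \<le> e" by auto
      then show "z \<in> (\<Union>x\<in>K. cball x e)" by (intro UN_I[of x]) (auto simp: dist_norm)
    qed
    then show ?thesis using compact_sums[OF assms(1) compact_cball[of 0 e]] by (simp only:)
  qed
  moreover have "K \<subseteq> interior (\<Union>x\<in>K. cball x e)"
  proof -
    have "(\<Union>x\<in>K. ball x e) \<subseteq> interior (\<Union>x\<in>K. cball x e)"
      by (rule interior_maximal) (auto intro: less_imp_le)
    then show ?thesis using e by force
  qed
  ultimately show ?thesis using that e by blast
qed (use that[of "{}"] in auto)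

text \<open>A set that only an iterate maps into its interior need not be a trapping region.
  Thickening the successive images to compact neighbourhoods makes each piece map into the interior
  of the next, and the last one into \<open>U\<close>.\<close>

lemma trapping_chain:
  fixes g :: "'a::euclidean_space \<Rightarrow> 'a"
  assumes "continuous_on UNIV g" "compact K" "open U" "(g ^^ Suc n) ` K \<subseteq> U"
  shows "\<exists>W. compact W \<and> K \<subseteq> W \<and> g ` W \<subseteq> interior W \<union> U \<and> (\<forall>x\<in>W. \<exists>i \<le> Suc n. (g ^^ i) x \<in> U)"
  using assms(2,4)
proof (induction n arbitrary: K)
  case 0
  then show ?case by (intro exI[of _ K]) (auto intro!: exI[of _ "Suc 0"])
next
  case (Suc n)
  have cont: "continuous_on UNIV (g ^^ k)" for k
    by (induction k) (auto simp: continuous_on_id intro: continuous_on_compose2[OF assms(1)])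
  have "compact (g ` K)" using Suc.prems(1) by (intro compact_continuous_image continuous_on_subset[OF assms(1)]) auto
  moreover have "open ((g ^^ Suc n) -` U)" using cont[of "Suc n"] assms(3) by (intro open_vimage)
  moreover have "g ` K \<subseteq> (g ^^ Suc n) -` U" using Suc.prems(2) by (auto simp: funpow_swap1)
  ultimately obtain C where C: "compact C" "g ` K \<subseteq> interior C" "C \<subseteq> (g ^^ Suc n) -` U"
    using compact_neighbourhood by metis
  then obtain W where W: "compact W" "C \<subseteq> W" "g ` W \<subseteq> interior W \<union> U" "\<forall>x\<in>W. \<exists>i \<le> Suc n. (g ^^ i) x \<in> U"
    using Suc.IH[of C] by blast
  show ?case
  proof (intro exI[of _ "K \<union> W"] conjI)
    have "interior W \<subseteq> interior (K \<union> W)" "interior C \<subseteq> interior W" using W by (auto intro!: interior_mono)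
    then show "g ` (K \<union> W) \<subseteq> interior (K \<union> W) \<union> U" using C W by auto
    show "\<forall>x\<in>K \<union> W. \<exists>i \<le> Suc (Suc n). (g ^^ i) x \<in> U" using W(4) Suc.prems(2) le_SucI by blast
  qed (use W Suc in auto)
qed

text \<open>All of \<open>W\<close> has entered \<open>K\<close> after \<open>n + 1\<close> steps,
  which confines the attracting set to the images of \<open>K\<close>. For \<open>Omega\<close>, the
  case \<open>k = 1\<close> places it in \<open>Omega'\<close>.\<close>

lemma trapping_region_exists:
  fixes g :: "'a::euclidean_space \<Rightarrow> 'a"
  assumes "continuous_on UNIV g" "compact K" "K \<noteq> {}" "g ` K \<subseteq> K" "(g ^^ Suc n) ` K \<subseteq> interior K"
  shows "\<exists>W. trapping_region g W \<and> (\<forall>k. attracting_set g W \<subseteq> (g ^^ k) ` K)"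
proof -
  obtain W where W: "compact W" "K \<subseteq> W" "g ` W \<subseteq> interior W \<union> interior K"
    "\<forall>x\<in>W. \<exists>i \<le> Suc n. (g ^^ i) x \<in> interior K"
    using trapping_chain[OF assms(1,2) open_interior assms(5)] by blast
  have inv: "(g ^^ k) x \<in> K" if "x \<in> K" for k x
    using that assms(4) by (induction k) auto
  have "(g ^^ Suc n) x \<in> K" if "x \<in> W" for x
  proof -
    obtain i where i: "i \<le> Suc n" "(g ^^ i) x \<in> interior K" using W(4) \<open>x \<in> W\<close> by blast
    then have "(g ^^ (Suc n - i)) ((g ^^ i) x) \<in> K" using inv interior_subset by blast
    moreover have "(g ^^ (Suc n - i)) ((g ^^ i) x) = (g ^^ (Suc n - i + i)) x" by (simp only: funpow_add comp_apply)
    ultimately show ?thesis using i by simp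
  qed
  then have "(g ^^ (k + Suc n)) ` W \<subseteq> (g ^^ k) ` K" for k
    unfolding funpow_add image_comp[symmetric] by (intro image_mono) (simp only: image_subset_iff Ball_def, blast)
  moreover have "attracting_set g W \<subseteq> (g ^^ (k + Suc n)) ` W" for k unfolding attracting_set_def by (rule INF_lower) simp
  moreover have "trapping_region g W"
    unfolding trapping_region_def using W(1-3) assms(3) interior_mono[OF W(2)] by (intro conjI) auto
  ultimately have "trapping_region g W \<and> (\<forall>k. attracting_set g W \<subseteq> (g ^^ k) ` K)" by (metis subset_trans)
  then show ?thesis by (rule exI)
qed

section \<open>Strict inequalities after sufficiently many steps\<close>

context trapped_polygon
begin

lemma iterate_in': "x \<in> Omega \<Longrightarrow> (f ^^ Suc n) x \<in> Omega'"
proof -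
  have *: "x \<in> Omega \<Longrightarrow> (f ^^ n) x \<in> Omega" for n using f_Omega Omega'_Omega by (induction n) auto
  show "x \<in> Omega \<Longrightarrow> (f ^^ Suc n) x \<in> Omega'" using f_Omega * by simp
qed

text \<open>\<open>i\<close> counts the edges, from \<open>NL - 1\<close> downward, that have become
  strict. A point arriving from the right is strict at all of them at once; a step from the open
  left half-plane makes edge \<open>NL - 1\<close> strict and hands strictness from edge
  \<open>k + 1\<close> to edge \<open>k\<close>.\<close>

lemma strict_left:
  assumes "x \<in> Omega" "(f ^^ n) x $ 1 \<le> 0" "2 + i \<le> n" "k \<le> NL - 1" "NL - 1 \<le> k + i"
  shows "Ll k ((f ^^ n) x) < 0"
proof -
  have idx: "1 \<le> NL - 2" "NL - 2 \<le> NL - 1" using L.N3 by auto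
  show ?thesis using assms(2-)
  proof (induction i arbitrary: n k)
    case 0
    obtain j where n: "n = Suc (Suc j)" using 0 by (metis add_2_eq_Suc add_0_right le_Suc_ex)
    define w where "w = (f ^^ Suc j) x"
    have w: "w \<in> Omega'" unfolding w_def using assms(1) by (rule iterate_in')
    have y: "(f ^^ n) x = f w" by (simp add: n w_def)
    have k: "k = NL - 1" using 0 by simp
    show ?case
    proof (cases "w $ 1 \<ge> 0")
      case True
      then show ?thesis using image_left_of_right[of w k] w 0 y by (simp add: Omega'_def)
    next
      case False
      then have w1: "w $ 1 < 0" "w \<in> Omega_L" using w by (auto simp: Omega'_def)
      then have "f w \<in> Omega_L" using image_left_of_left 0 y by simp
      moreover have "f w $ 2 > 0" using f_left[of w] w1 deltas by (simp add: mult_pos_neg)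
      ultimately show ?thesis using Ll_last(2)[of "f w"] y k idx by (simp add: Omega_L_def)
    qed
  next
    case (Suc i)
    obtain j where n: "n = Suc j" "2 + i \<le> j" using Suc.prems by (cases n) auto
    define w where "w = (f ^^ j) x"
    obtain i' where ji: "j = Suc i'" using n by (cases j) auto
    have w: "w \<in> Omega'" unfolding w_def ji using assms(1) by (rule iterate_in')
    have y: "(f ^^ n) x = f w" by (simp add: n w_def)
    show ?case
    proof (cases "w $ 1 \<ge> 0")
      case True
      then show ?thesis using image_left_of_right[of w k] w Suc.prems y by (simp add: Omega'_def)
    next
      case w1: False
      show ?thesis
      proof (cases "k = NL - 1")
        case True
        have "f w \<in> Omega_L" using image_left_of_left[of w] Suc.prems y w w1 by (simp add: Omega'_def)
        moreover have "f w $ 2 > 0" using f_left[of w] w1 deltas by (simp add: mult_pos_neg)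
        ultimately show ?thesis using Ll_last(2)[of "f w"] y True idx by (simp add: Omega_L_def)
      next
        case False
        then have "Ll (Suc k) w < 0" unfolding w_def
          using Suc.IH[of j "Suc k"] n w1 Suc.prems by (simp add: w_def)
        then show ?thesis using f_Ll[of w k] w1 deltas y by (simp add: mult_pos_neg)
      qed
    qed
  qed
qed

text \<open>The offset \<open>NL\<close> leaves a preceding left point enough time to be strict at
  edge 1, which makes its image strict at every right edge. Within the right half-plane strictness
  climbs from edge 0.\<close>

lemma strict_right:
  assumes "x \<in> Omega" "(f ^^ n) x $ 1 \<ge> 0" "NL + 2 + i \<le> n" "k \<le> NR - 2" "k \<le> i"
  shows "Rl k ((f ^^ n) x) < 0"
  using assms(2-)
proof (induction i arbitrary: n k)
  case (0 n k)
  obtain j where n: "n = Suc j" "NL + 1 \<le> j" using 0 by (cases n) auto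
  define w where "w = (f ^^ j) x"
  obtain i' where ji: "j = Suc i'" using n by (cases j) auto
  have w: "w \<in> Omega'" unfolding w_def ji using assms(1) by (rule iterate_in')
  have y: "(f ^^ n) x = f w" by (simp add: n w_def)
  show ?case
  proof (cases "w $ 1 \<le> 0")
    case True
    have "Ll 1 w < 0" unfolding w_def
      by (rule strict_left[where i = "NL - 2"]) (use assms(1) n True w_def L.N3 in auto)
    then show ?thesis using image_right_of_left(2)[of w k] w True 0 y by (simp add: Omega'_def)
  next
    case False
    then have wR: "w \<in> Omega_R" "w $ 1 > 0" using w by (auto simp: Omega'_def)
    have "Rl 1 (f w) \<le> 0" using f_Rl[of w 0] wR deltas by (simp add: Omega_R_def mult_nonneg_nonpos)
    moreover have "f w $ 2 < 0" using f_right[of w] wR deltas by simp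
    ultimately show ?thesis using Rl_first(2)[of "f w"] 0 y by simp
  qed
next
  case (Suc i n k)
  obtain j where n: "n = Suc j" "NL + 2 + i \<le> j" using Suc.prems by (cases n) auto
  define w where "w = (f ^^ j) x"
  obtain i' where ji: "j = Suc i'" using n by (cases j) auto
  have w: "w \<in> Omega'" unfolding w_def ji using assms(1) by (rule iterate_in')
  have y: "(f ^^ n) x = f w" by (simp add: n w_def)
  show ?case
  proof (cases "w $ 1 \<le> 0")
    case True
    have "Ll 1 w < 0" unfolding w_def
      by (rule strict_left[where i = "NL - 2"]) (use assms(1) n True w_def L.N3 in auto)
    then show ?thesis using image_right_of_left(2)[of w k] w True Suc.prems y by (simp add: Omega'_def)
  next
    case w1: False
    show ?thesis
    proof (cases k)
      case 0
      have wR: "w \<in> Omega_R" "w $ 1 > 0" using w w1 by (auto simp: Omega'_def)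
      have "Rl 1 (f w) \<le> 0" using f_Rl[of w 0] wR deltas by (simp add: Omega_R_def mult_nonneg_nonpos)
      moreover have "f w $ 2 < 0" using f_right[of w] wR deltas by simp
      ultimately show ?thesis using Rl_first(2)[of "f w"] 0 y by simp
    next
      case (Suc k')
      then have "Rl k' w < 0" unfolding w_def
        using Suc.IH[of j k'] n w1 Suc.prems by (simp add: w_def)
      then show ?thesis using f_Rl[of w k'] w1 deltas y Suc by (simp add: mult_pos_neg)
    qed
  qed
qed

lemma continuous_Ll: "continuous_on S (Ll k)" and continuous_Rl: "continuous_on S (Rl k)"
  unfolding Ll_affine[abs_def] Rl_affine[abs_def] by (intro continuous_intros)+

lemma closed_Omega: "closed Omega"
proof -
  have "Omega_L = {x. x $ 1 \<le> 0} \<inter> (\<Inter>k\<in>{1..NL - 1}. {x. Ll k x \<le> 0})"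
    by (auto simp: Omega_L_def)
  moreover have "Omega_R = {x. x $ 1 \<ge> 0} \<inter> (\<Inter>k\<in>{..NR - 2}. {x. Rl k x \<le> 0})"
    by (auto simp: Omega_R_def)
  moreover have "closed {x. Ll k x \<le> 0}" "closed {x. Rl k x \<le> 0}" for k
    by (intro closed_Collect_le continuous_Ll continuous_Rl continuous_intros)+
  ultimately have "closed Omega_L" "closed Omega_R" using closed_left closed_right by (auto simp del: One_nat_def intro!: closed_Int closed_INT)
  then show ?thesis unfolding Omega_def by (rule closed_Un)
qed

lemma Omega_L_bound: obtains C where "\<And>x. x \<in> Omega_L \<Longrightarrow> \<bar>x $ 1\<bar> \<le> C \<and> \<bar>x $ 2\<bar> \<le> C"
proof -
  obtain C where C: "\<And>a b. b \<ge> 0 \<Longrightarrow> (\<And>k. 1 \<le> k \<Longrightarrow> k \<le> NL - 1 \<Longrightarrow> L.l k a b \<le> 0) \<Longrightarrow> \<bar>a\<bar> \<le> C \<and> \<bar>b\<bar> \<le> C"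
    using L.region_bounded_left by blast
  show ?thesis
  proof (rule that[of "max C (C * \<delta>L)"])
    fix x assume "x \<in> Omega_L"
    then have "\<bar>x $ 2 / \<delta>L\<bar> \<le> C" "\<bar>- x $ 1\<bar> \<le> C" using C[of "- x $ 1" "x $ 2 / \<delta>L"] by (auto simp: Omega_L_def Ll_def)
    then show "\<bar>x $ 1\<bar> \<le> max C (C * \<delta>L) \<and> \<bar>x $ 2\<bar> \<le> max C (C * \<delta>L)"
      using deltas by (auto simp: abs_divide pos_divide_le_eq le_max_iff_disj)
  qed
qed

lemma Omega_R_bound: obtains C where "\<And>x. x \<in> Omega_R \<Longrightarrow> \<bar>x $ 1\<bar> \<le> C \<and> \<bar>x $ 2\<bar> \<le> C"
proof -
  obtain C where C: "\<And>a b. a \<ge> 0 \<Longrightarrow> (\<And>k. k \<le> NR - 2 \<Longrightarrow> R.l k a b \<le> 0) \<Longrightarrow> \<bar>a\<bar> \<le> C \<and> \<bar>b\<bar> \<le> C"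
    using R.region_bounded_right by blast
  show ?thesis
  proof (rule that[of "max C (C * \<delta>R)"])
    fix x assume "x \<in> Omega_R"
    then have "\<bar>- x $ 2 / \<delta>R\<bar> \<le> C" "\<bar>x $ 1\<bar> \<le> C" using C[of "x $ 1" "- x $ 2 / \<delta>R"] by (auto simp: Omega_R_def Rl_def)
    then show "\<bar>x $ 1\<bar> \<le> max C (C * \<delta>R) \<and> \<bar>x $ 2\<bar> \<le> max C (C * \<delta>R)"
      using deltas by (auto simp: abs_divide pos_divide_le_eq le_max_iff_disj)
  qed
qed

lemma compact_Omega: "compact Omega"
proof -
  obtain C1 where C1: "\<And>x. x \<in> Omega_L \<Longrightarrow> \<bar>x $ 1\<bar> \<le> C1 \<and> \<bar>x $ 2\<bar> \<le> C1" using Omega_L_bound by blast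
  obtain C2 where C2: "\<And>x. x \<in> Omega_R \<Longrightarrow> \<bar>x $ 1\<bar> \<le> C2 \<and> \<bar>x $ 2\<bar> \<le> C2" using Omega_R_bound by blast
  have "norm x \<le> 2 * \<bar>C1\<bar> + 2 * \<bar>C2\<bar>" if "x \<in> Omega" for x
  proof -
    have "norm x \<le> \<bar>x $ 1\<bar> + \<bar>x $ 2\<bar>" using norm_le_l1_cart[of x] by (simp add: sum_2)
    then show ?thesis using C1[of x] C2[of x] that by (auto simp: Omega_def)
  qed
  then have "bounded Omega" by (auto simp: bounded_iff)
  then show ?thesis using closed_Omega compact_eq_bounded_closed by blast
qed

lemma zero_in_Omega: "0 \<in> Omega"
  using LE_pos by (auto simp: Omega_def Omega_L_def Ll_affine less_imp_le)

lemma iterate_interior: "(f ^^ Suc (NL + NR + 1)) ` Omega \<subseteq> interior Omega"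
proof -
  define Op where "Op = {x :: real^2. x $ 1 > 0} \<union> (\<Inter>k\<in>{1..NL - 1}. {x. Ll k x < 0})"
  define Oq where "Oq = {x :: real^2. x $ 1 < 0} \<union> (\<Inter>k\<in>{..NR - 2}. {x. Rl k x < 0})"
  have "open {x. Ll k x < 0}" "open {x. Rl k x < 0}" "open {x :: real^2. x $ 1 > 0}" "open {x :: real^2. x $ 1 < 0}" for k
    by (intro open_Collect_less continuous_Ll continuous_Rl continuous_intros)+
  then have "open (Op \<inter> Oq)" unfolding Op_def Oq_def by (intro open_Int open_Un open_INT) auto
  moreover have "Op \<inter> Oq \<subseteq> Omega"
  proof
    fix x assume "x \<in> Op \<inter> Oq"
    then show "x \<in> Omega"
      by (cases "x $ 1 \<le> 0") (auto simp: Op_def Oq_def Omega_def Omega_L_def Omega_R_def less_imp_le)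
  qed
  ultimately have sub: "Op \<inter> Oq \<subseteq> interior Omega" by (simp add: interior_maximal)
  have "(f ^^ Suc (NL + NR + 1)) x \<in> Op \<inter> Oq" if "x \<in> Omega" for x
  proof -
    have "Ll k ((f ^^ Suc (NL + NR + 1)) x) < 0" if "(f ^^ Suc (NL + NR + 1)) x $ 1 \<le> 0" "k \<le> NL - 1" for k
      by (rule strict_left[where i = "NL - 1"]) (use that \<open>x \<in> Omega\<close> L.N3 R.N3 in \<open>auto simp del: funpow.simps\<close>)
    moreover have "Rl k ((f ^^ Suc (NL + NR + 1)) x) < 0" if "(f ^^ Suc (NL + NR + 1)) x $ 1 \<ge> 0" "k \<le> NR - 2" for k
      by (rule strict_right[where i = "NR - 2"]) (use that \<open>x \<in> Omega\<close> R.N3 in \<open>auto simp del: funpow.simps\<close>)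
    ultimately show ?thesis unfolding Op_def Oq_def
      by (auto simp del: funpow.simps simp: not_less)
  qed
  then show ?thesis using sub by blast
qed

lemma trapping:
  obtains W where "trapping_region f W" "\<And>x. x \<in> attracting_set f W \<Longrightarrow> x \<in> Omega'"
proof -
  have c: "continuous_on UNIV f" by (rule continuous_bcnf)
  have "f ` Omega \<subseteq> Omega" using f_Omega Omega'_Omega by auto
  then obtain W where W: "trapping_region f W" "\<And>k. attracting_set f W \<subseteq> (f ^^ k) ` Omega"
    using trapping_region_exists[OF c compact_Omega _ _ iterate_interior] zero_in_Omega by blast
  have "x \<in> Omega'" if "x \<in> attracting_set f W" for x
    using W(2)[of "Suc 0"] that f_Omega by auto
  then show ?thesis using that W by blast
qed

end

section \<open>Leaving the left half-plane\<close>

text \<open>A nonnegative supersolution \<open>a\<close> forces \<open>u\<close>, once it has become positive, to stay positive: the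
  Casoratian \<open>u (k + 1) * a k - u k * a (k + 1)\<close> cannot become negative.\<close>

lemma stays_positive:
  fixes u a :: "nat \<Rightarrow> real"
  assumes "\<delta> > 0"
    and u: "\<And>k. u (Suc (Suc k)) = \<tau> * u (Suc k) - \<delta> * u k + 1"
    and a: "\<And>k. a (Suc (Suc k)) = \<tau> * a (Suc k) - \<delta> * a k - 1"
    and nn: "\<And>k. k \<le> p \<Longrightarrow> a k \<ge> 0"
    and i: "u i \<le> 0" "u (Suc i) > 0"
    and j: "i < j" "j \<le> p"
  shows "u j > 0"
proof -
  define c where "c k = u (Suc k) * a k - u k * a (Suc k)" for k
  have c_Suc: "c (Suc k) = \<delta> * c k + a (Suc k) + u (Suc k)" for k
    unfolding c_def u a by (simp add: algebra_simps)
  have "u (Suc k) > 0 \<and> c k \<ge> 0" if "i \<le> k" "Suc k \<le> p" for k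
    using that
  proof (induction k rule: dec_induct)
    case base
    have "u (Suc i) * a i \<ge> 0" "u i * a (Suc i) \<le> 0"
      using i nn base by (auto simp: mult_nonpos_nonneg)
    then show ?case using i by (simp add: c_def)
  next
    case (step k)
    then have IH: "u (Suc k) > 0" "c k \<ge> 0" by auto
    have an: "a (Suc k) \<ge> 0" "a (Suc (Suc k)) \<ge> 0" using nn step by auto
    have "c (Suc k) > 0" unfolding c_Suc using IH an assms(1) by (simp add: add_nonneg_pos)
    moreover have "u (Suc k) * a (Suc (Suc k)) \<ge> 0" using IH an by simp
    ultimately have "u (Suc (Suc k)) * a (Suc k) > 0" by (simp add: c_def)
    then show ?case using an \<open>c (Suc k) > 0\<close> by (simp add: zero_less_mult_iff)
  qed
  moreover obtain k where "j = Suc k" "i \<le> k" using j by (cases j) auto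
  ultimately show ?thesis using j by simp
qed

lemma first_positive:
  fixes u :: "nat \<Rightarrow> real"
  assumes "u 0 \<le> 0" "u k > 0"
  obtains i where "i < k" "u i \<le> 0" "u (Suc i) > 0"
proof -
  have "\<exists>i<k. u i \<le> 0 \<and> u (Suc i) > 0" using assms(2)
  proof (induction k)
    case (Suc k)
    then show ?case by (cases "u k > 0") (auto simp: less_Suc_eq)
  qed (use assms in simp)
  then show ?thesis using that by blast
qed

lemma quadratic_root_gt_1:
  fixes \<tau> \<delta> :: real
  assumes "\<delta> > 0" "\<tau> > 1 + \<delta>"
  obtains \<kappa> where "\<kappa> > 1" "\<kappa>\<^sup>2 = \<tau> * \<kappa> - \<delta>"
proof -
  define \<kappa> where "\<kappa> = (\<tau> + sqrt (\<tau>\<^sup>2 - 4 * \<delta>)) / 2"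
  have "(1 - \<delta>)\<^sup>2 = (1 + \<delta>)\<^sup>2 - 4 * \<delta>" by (simp add: power2_eq_square algebra_simps)
  also have "(1 + \<delta>)\<^sup>2 \<le> \<tau>\<^sup>2" using assms by (intro power_mono) auto
  finally have 1: "(1 - \<delta>)\<^sup>2 \<le> \<tau>\<^sup>2 - 4 * \<delta>" by simp
  then have "\<bar>1 - \<delta>\<bar> \<le> sqrt (\<tau>\<^sup>2 - 4 * \<delta>)" by (metis real_sqrt_abs real_sqrt_le_iff)
  then have "\<kappa> > 1" using assms by (simp add: \<kappa>_def)
  moreover have "(sqrt (\<tau>\<^sup>2 - 4 * \<delta>))\<^sup>2 = \<tau>\<^sup>2 - 4 * \<delta>"
    using 1 zero_le_power2[of "1 - \<delta>"] by (intro real_sqrt_pow2) linarith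
  then have "\<kappa>\<^sup>2 = \<tau> * \<kappa> - \<delta>" by (simp add: \<kappa>_def power2_eq_square field_simps)
  ultimately show ?thesis using that by blast
qed

context trapped_polygon
begin

lemma fL_iter_rec: "(fL ^^ Suc (Suc k)) x $ 1 = \<tau>L * (fL ^^ Suc k) x $ 1 - \<delta>L * (fL ^^ k) x $ 1 + 1"
  by simp

lemma fL_iter_affine: "\<exists>c0 c1 c2. \<forall>x. (fL ^^ k) x $ i = c0 + c1 * x $ 1 + c2 * x $ 2"
proof (induction k arbitrary: i)
  case 0
  have "i = 1 \<or> i = 2" using exhaust_2 by blast
  then show ?case
  proof
    assume "i = 1" then show ?thesis by (intro exI[of _ 0] exI[of _ 1]) auto
  next
    assume "i = 2" then show ?thesis by (intro exI[of _ 0] exI[of _ 1]) auto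
  qed
next
  case (Suc k)
  obtain a0 a1 a2 b0 b1 b2 where ab: "\<forall>x. (fL ^^ k) x $ 1 = a0 + a1 * x $ 1 + a2 * x $ 2"
    "\<forall>x. (fL ^^ k) x $ 2 = b0 + b1 * x $ 1 + b2 * x $ 2" using Suc by metis
  have "i = 1 \<or> i = 2" using exhaust_2 by blast
  then show ?case
  proof
    assume "i = 1" then show ?thesis
      by (intro exI[of _ "\<tau>L * a0 + b0 + 1"] exI[of _ "\<tau>L * a1 + b1"] exI[of _ "\<tau>L * a2 + b2"])
        (simp add: ab algebra_simps)
  next
    assume "i = 2" then show ?thesis
      by (intro exI[of _ "- \<delta>L * a0"] exI[of _ "- \<delta>L * a1"] exI[of _ "- \<delta>L * a2"])
        (simp add: ab algebra_simps)
  qed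
qed

lemma left_run_bounded:
  assumes "x \<in> Omega_R" "p \<ge> 1"
    and Y: "1 \<le> kY" "kY \<le> p" "(fL ^^ kY) ptY $ 1 > 0"
    and Z: "1 \<le> kZ" "kZ \<le> p" "(fL ^^ kZ) ptZ $ 1 > 0"
  shows "\<exists>k\<le>p. (fL ^^ k) (f x) $ 1 > 0"
proof (rule ccontr)
  assume "\<not> ?thesis"
  then have y: "(fL ^^ k) (f x) $ 1 \<le> 0" if "k \<le> p" for k using that by force
  \<comment> \<open>The orbit of \<open>f x\<close>, assumed to stay on the left, serves with
    reversed sign as the supersolution in \<open>stays_positive\<close>.\<close>
  have exits: "(fL ^^ p) P $ 1 > 0" if P: "P $ 1 \<le> 0" "k \<le> p" "(fL ^^ k) P $ 1 > 0" for P k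
  proof -
    obtain i where i: "i < k" "(fL ^^ i) P $ 1 \<le> 0" "(fL ^^ Suc i) P $ 1 > 0"
      using first_positive[of "\<lambda>k. (fL ^^ k) P $ 1" k] P by (auto simp del: funpow.simps)
    show ?thesis
      by (rule stays_positive[where u = "\<lambda>k. (fL ^^ k) P $ 1" and a = "\<lambda>k. - (fL ^^ k) (f x) $ 1" and i = i
            and \<delta> = \<delta>L and \<tau> = \<tau>L and p = p])
        (use i P y deltas in \<open>auto simp del: funpow.simps simp: fL_iter_rec\<close>)
  qed
  obtain c0 c1 c2 where c: "\<forall>x. (fL ^^ p) x $ 1 = c0 + c1 * x $ 1 + c2 * x $ 2"
    using fL_iter_affine by blast
  have Y1: "ptY $ 1 = 0" by (simp add: ptY_def)
  have "(fL ^^ p) (f x) $ 1 > 0"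
  proof (rule hull_pos[where h = "\<lambda>x. (fL ^^ p) x $ 1" and ?c0.0 = c0 and ?c1.0 = c1 and ?c2.0 = c2])
    show "f x $ 1 \<le> 0" using y[of 0] by simp
    show "(fL ^^ p) 0 $ 1 > 0" by (rule exits[of _ 1]) (use assms in auto)
    show "(fL ^^ p) ptY $ 1 > 0" by (rule exits[of _ kY]) (use Y Y1 in auto)
    show "(fL ^^ p) ptZ $ 1 > 0" by (rule exits[of _ kZ]) (use Z R.s_N in \<open>auto simp: ptZ_def\<close>)
    assume F: "f ptY $ 1 < 0"
    have "(fL ^^ (kY - 1)) (f ptY) $ 1 > 0"
    proof -
      have "kY = Suc (kY - 1)" using Y by simp
      then have "(fL ^^ kY) ptY = (fL ^^ (kY - 1)) (fL ptY)"
        by (metis funpow_swap1 funpow.simps(2) o_apply)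
      then show ?thesis using Y by (simp add: f_left Y1)
    qed
    then show "(fL ^^ p) (f ptY) $ 1 > 0" by (rule exits[rotated 2]) (use F Y in auto)
  qed (use c image_of_right_lines[OF assms(1)] in auto)
  then show False using y[of p] by simp
qed

text \<open>For \<open>\<tau>L \<le> 1 + \<delta>L\<close>, no bounded orbit of the left piece stays in the left half-plane. Otherwise the
  left piece has a saddle with unstable eigenvalue \<open>\<kappa>\<close>, and \<open>G\<close> below, which vanishes on the stable
  line of the saddle and is multiplied by \<open>\<kappa>\<close> along orbits, is bounded below by its value at \<open>U\<close>.\<close>

lemma exit_left_of_left:
  assumes "y \<in> Omega_L"
  shows "\<exists>k\<ge>1. (fL ^^ k) y $ 1 > 0"
proof (rule ccontr)
  assume "\<not> ?thesis"
  then have neg: "(fL ^^ k) y $ 1 \<le> 0" for k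
    using assms by (cases "k = 0") (auto simp: Omega_L_def not_less)
  have inL: "(fL ^^ k) y \<in> Omega_L" for k
  proof (induction k)
    case (Suc k)
    then have "f ((fL ^^ k) y) = (fL ^^ Suc k) y" using neg[of k] by (simp add: f_left)
    then show ?case using image_left_of_left[OF Suc] neg[of "Suc k"] by simp
  qed (use assms in simp)
  obtain C where C: "\<And>x. x \<in> Omega_L \<Longrightarrow> \<bar>x $ 1\<bar> \<le> C \<and> \<bar>x $ 2\<bar> \<le> C" using Omega_L_bound by blast
  define a where "a k = - (fL ^^ k) y $ 1" for k
  have a: "0 \<le> a k" "a k \<le> C" for k using neg[of k] C[OF inL[of k]] by (auto simp: a_def)
  have a_rec: "a (Suc (Suc k)) = \<tau>L * a (Suc k) - \<delta>L * a k - 1" for k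
    unfolding a_def fL_iter_rec by (simp del: funpow.simps)
  show False
  proof (cases "\<tau>L \<le> 1 + \<delta>L")
    case True
    \<comment> \<open>\<open>g\<close> drops by at least 1 at every step, although the bounds on
      \<open>a\<close> bound it below.\<close>
    define g where "g k = a (Suc k) - \<delta>L * a k" for k
    have "g (Suc k) \<le> g k - 1" for k
    proof -
      have "(\<tau>L - 1 - \<delta>L) * a (Suc k) \<le> 0" using True a by (simp add: mult_nonpos_nonneg)
      then show ?thesis unfolding g_def a_rec by (simp add: algebra_simps)
    qed
    then have g: "g k \<le> g 0 - real k" for k
    proof (induction k)
      case (Suc k)
      then have "g (Suc k) \<le> g k - 1" "g k \<le> g 0 - real k" by auto
      then show ?case by simp
    qed simp
    obtain k where k: "real k > g 0 + \<delta>L * C" using reals_Archimedean2 by blast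
    have "\<delta>L * a k \<le> \<delta>L * C" using a deltas by (simp add: mult_left_mono)
    then have "g k \<ge> - (\<delta>L * C)" using a[of "Suc k"] by (simp add: g_def)
    with g[of k] k show False by simp
  next
    case False
    then obtain \<kappa> where kappa: "\<kappa> > 1" "\<kappa>\<^sup>2 = \<tau>L * \<kappa> - \<delta>L"
      using quadratic_root_gt_1 deltas by (metis not_le)
    \<comment> \<open>\<open>(1, 1 / \<kappa>)\<close> is a left eigenvector of the left matrix for
      \<open>\<kappa>\<close>, and the constant makes \<open>G\<close> vanish at the fixed point of
      the left piece.\<close>
    define G where "G p = p $ 1 + p $ 2 / \<kappa> + 1 / (\<kappa> - 1)" for p :: "real^2"
    have G_fL: "G (fL p) = \<kappa> * G p" for p
    proof -
      have "\<tau>L - \<delta>L / \<kappa> = \<kappa>" using kappa by (simp add: field_simps power2_eq_square)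
      then have "\<tau>L * p $ 1 - \<delta>L / \<kappa> * p $ 1 = \<kappa> * p $ 1" by (metis left_diff_distrib)
      moreover have "1 + 1 / (\<kappa> - 1) = \<kappa> * (1 / (\<kappa> - 1))" using kappa by (simp add: field_simps)
      moreover have "G (fL p) = (\<tau>L * p $ 1 - \<delta>L / \<kappa> * p $ 1) + p $ 2 + (1 + 1 / (\<kappa> - 1))"
        by (simp add: G_def)
      ultimately have "G (fL p) = \<kappa> * p $ 1 + p $ 2 + \<kappa> * (1 / (\<kappa> - 1))" by simp
      moreover have "\<kappa> * (p $ 2 / \<kappa>) = p $ 2" using kappa by simp
      ultimately show ?thesis unfolding G_def by (metis distrib_left)
    qed
    \<comment> \<open>The preimages of \<open>X\<close> under the left piece; \<open>G\<close> is
      positive at \<open>X = q 0\<close> and hence at all of them.\<close>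
    define q where "q k = (vector [- sL (Suc k), \<delta>L * sL (Suc (Suc k))] :: real^2)" for k
    have q_Suc: "fL (q (Suc k)) = q k" for k
    proof -
      have "\<delta>L * sL (Suc (Suc (Suc k))) = \<tau>L * sL (Suc (Suc k)) - sL (Suc k) - 1"
        unfolding L.rec[of "Suc k"] using deltas by (simp add: field_simps)
      then show ?thesis by (simp add: vec2_eq_iff q_def)
    qed
    have Gq: "G (q k) > 0" for k
    proof (induction k)
      case 0
      have "sL (Suc (Suc 0)) = \<beta> / \<delta>L" using sL2 by (simp add: numeral_2_eq_2)
      then show ?case using L.s1 kappa beta_pos deltas by (simp add: G_def q_def add_pos_pos)
    next
      case (Suc k)
      then show ?case using G_fL[of "q (Suc k)"] kappa by (simp add: q_Suc zero_less_mult_iff)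
    qed
    have idx: "Suc (NL - 2) = NL - 1" "Suc (NL - 1) = NL" "Suc (NL - 3) = NL - 2" using L.N3 by auto
    text \<open>The point \<open>U\<close> lies between \<open>V = q (NL - 2)\<close> and \<open>f(V) = q (NL - 3)\<close>.\<close>
    define V W where "V = q (NL - 2)" and "W = q (NL - 3)"
    have VW: "V $ 1 = - sL (NL - 1)" "V $ 2 = \<delta>L * sL NL" "W $ 1 = - sL (NL - 2)" "W $ 2 = \<delta>L * sL (NL - 1)"
      using idx by (auto simp: V_def W_def q_def)
    have "sL (NL - 1) > 0" using L.s_pos L.N3 by simp
    define t where "t = - sL NL / (sL (NL - 1) - sL NL)"
    have t: "0 \<le> t" "t \<le> 1" and t2: "(1 - t) * sL NL + t * sL (NL - 1) = 0"
      using L.s_N \<open>sL (NL - 1) > 0\<close> by (auto simp: t_def field_simps)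
    define u where "u = (1 - t) * V $ 1 + t * W $ 1"
    have "(1 - t) * V $ 2 + t * W $ 2 = \<delta>L * ((1 - t) * sL NL + t * sL (NL - 1))"
      unfolding VW by (simp add: algebra_simps)
    then have u2: "(1 - t) * V $ 2 + t * W $ 2 = 0" using t2 by simp
    have "(1 - t) * G V + t * G W = u + ((1 - t) * V $ 2 + t * W $ 2) / \<kappa> + 1 / (\<kappa> - 1)"
      unfolding G_def u_def by (simp add: algebra_simps add_divide_distrib diff_divide_distrib)
    then have Gu: "(1 - t) * G V + t * G W = u + 1 / (\<kappa> - 1)" using u2 by simp
    have "(1 - t) * G V + t * G W > 0"
    proof (cases "t = 0")
      case False
      then have "t * G W > 0" using t Gq by (simp add: W_def)
      moreover have "(1 - t) * G V \<ge> 0" using t Gq[of "NL - 2"] by (simp add: V_def)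
      ultimately show ?thesis by simp
    qed (use Gq in \<open>simp add: V_def\<close>)
    then have u_pos: "u + 1 / (\<kappa> - 1) > 0" using Gu by simp
    have lV: "Ll (NL - 2) V = 0" and lW: "Ll (NL - 2) W = 0"
      using deltas idx VW by (simp_all add: Ll_def L.l_def L.d_def)
    have "L.d (NL - 1) * u = L.E (NL - 2)"
    proof -
      have "(1 - t) * Ll (NL - 2) V + t * Ll (NL - 2) W
        = - L.E (NL - 2) + L.d (NL - 1) * u + L.d (NL - 2) / \<delta>L * ((1 - t) * V $ 2 + t * W $ 2)"
        unfolding Ll_affine idx u_def unfolding VW using deltas by (simp add: field_simps)
      then show ?thesis using lV lW u2 by simp
    qed
    \<comment> \<open>\<open>- e k / \<kappa>\<close> is the increment of \<open>G\<close> along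
      edge \<open>k\<close>, so \<open>e_Suc\<close> is again the eigenvector property. Positivity
      compares the slope of the edge through \<open>U\<close> with that of the stable line.\<close>
    define e where "e k = \<kappa> * L.d k - \<delta>L * L.d (Suc k)" for k
    have e_Suc: "\<kappa> * e (Suc k) = e k" for k
    proof -
      have "\<delta>L * L.d (Suc (Suc k)) = \<tau>L * L.d (Suc k) - L.d k"
        unfolding L.d_rec[of k] using deltas by (simp add: field_simps)
      then have "\<kappa> * e (Suc k) = \<kappa>\<^sup>2 * L.d (Suc k) - \<kappa> * (\<tau>L * L.d (Suc k) - L.d k)"
        by (simp add: e_def power2_eq_square right_diff_distrib)
      then show ?thesis unfolding kappa by (simp add: e_def algebra_simps)
    qed
    have e_pos: "e k > 0" for k
    proof (induction k)
      case 0
      have "L.d 0 = \<beta> + 1" "L.d (Suc 0) = \<beta> / \<delta>L"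
        using sL0 sL2 L.s1 by (auto simp: L.d_def numeral_2_eq_2)
      moreover have "\<kappa> * (\<beta> + 1) > 1 * \<beta>" using kappa beta_pos by (intro mult_strict_mono) auto
      ultimately show ?case using deltas by (simp add: e_def)
    next
      case (Suc k) then show ?case using e_Suc[of k] kappa by (metis less_trans zero_less_mult_pos zero_less_one)
    qed
    \<comment> \<open>Passing to the image makes the second coordinate nonnegative, as the
      comparison of \<open>G w\<close> with \<open>G\<close> at \<open>U\<close> requires.\<close>
    define w where "w = (fL ^^ 1) y"
    have w: "w $ 2 \<ge> 0" "Ll (NL - 2) w \<le> 0"
      using neg[of 0] deltas inL[of 1] idx L.N3 by (auto simp: w_def Omega_L_def mult_nonneg_nonpos)
    have dneg: "L.d (NL - 1) < 0" by (rule L.d_last)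
    have "L.d (NL - 1) * (w $ 1 - u) + L.d (NL - 2) / \<delta>L * w $ 2 \<le> 0"
      using w(2) \<open>L.d (NL - 1) * u = L.E (NL - 2)\<close> unfolding Ll_affine idx by (simp add: algebra_simps)
    moreover have "L.d (NL - 2) / \<delta>L * w $ 2 \<ge> L.d (NL - 1) / \<kappa> * w $ 2"
    proof (rule mult_right_mono)
      have "\<delta>L * L.d (NL - 1) \<le> \<kappa> * L.d (NL - 2)" using e_pos[of "NL - 2"] idx by (simp add: e_def)
      then show "L.d (NL - 1) / \<kappa> \<le> L.d (NL - 2) / \<delta>L" using kappa deltas by (simp add: field_simps)
    qed (use w in simp)
    ultimately have "L.d (NL - 1) * (w $ 1 - u + w $ 2 / \<kappa>) \<le> 0" by (simp add: algebra_simps)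
    then have "w $ 1 - u + w $ 2 / \<kappa> \<ge> 0" using dneg by (simp add: mult_le_0_iff)
    then have Gw: "G w > 0" using u_pos by (simp add: G_def)
    have Gk: "G ((fL ^^ k) w) = \<kappa> ^ k * G w" for k by (induction k) (auto simp: G_fL)
    have "G ((fL ^^ k) w) \<le> C + C / \<kappa> + 1 / (\<kappa> - 1)" for k
    proof -
      have "(fL ^^ k) w = (fL ^^ Suc k) y" by (simp add: w_def funpow_swap1)
      then have "\<bar>(fL ^^ k) w $ 1\<bar> \<le> C \<and> \<bar>(fL ^^ k) w $ 2\<bar> \<le> C" using C inL by metis
      moreover from this have "(fL ^^ k) w $ 2 / \<kappa> \<le> C / \<kappa>" using kappa by (intro divide_right_mono) auto
      ultimately show ?thesis by (auto simp: G_def)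
    qed
    moreover obtain k where "\<kappa> ^ k > (C + C / \<kappa> + 1 / (\<kappa> - 1)) / G w"
      using real_arch_pow kappa by blast
    ultimately show False unfolding Gk using Gw by (simp add: divide_less_eq) (metis not_le)
  qed
qed

text \<open>Membership gives, through \<open>exit_left_of_left\<close>, the finiteness of
  \<open>chi_L\<close> at both points.\<close>

lemma ptY_in: "ptY \<in> Omega_L" and ptZ_in: "ptZ \<in> Omega_L"
proof -
  have *: "P \<in> Omega_L" if "P $ 1 \<le> 0" "P $ 2 \<le> 0" "Ll (NL - 1) P < 0" "Ll (NL - 2) P < 0" for P
  proof -
    have "Ll k P \<le> 0" if "k \<le> NL - 1" for k
    proof (cases "k < NL - 2")
      case True
      then show ?thesis
        using L.l_inner[of "P $ 2 / \<delta>L" "- P $ 1" k] \<open>P $ 1 \<le> 0\<close> \<open>P $ 2 \<le> 0\<close> \<open>Ll (NL - 2) P < 0\<close> deltas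
        by (simp add: Ll_def divide_nonpos_pos)
    next
      case False
      then have "k = NL - 2 \<or> k = NL - 1" using that by auto
      then show ?thesis using \<open>Ll (NL - 2) P < 0\<close> \<open>Ll (NL - 1) P < 0\<close> by auto
    qed
    then show ?thesis using \<open>P $ 1 \<le> 0\<close> by (simp add: Omega_L_def)
  qed
  show "ptY \<in> Omega_L" using RbY_pos deltas Y_above Y_right by (intro *) (auto simp: ptY_def)
  have "sR (NR - 1) > 0" by (rule R.s_pos) (use R.N3 in auto)
  then show "ptZ \<in> Omega_L" using R.s_N deltas Z_above Z_right by (intro *) (auto simp: ptZ_def)
qed

end

section \<open>Invariant expanding cones\<close>

lemma eigenvalues:
  fixes T \<Delta> :: real
  assumes "0 < \<Delta>" "\<Delta> < 1 / 4 * T\<^sup>2"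
  obtains es eu where "es + eu = T" "es * eu = \<Delta>" "es \<noteq> 0" "eu \<noteq> 0" "0 < eu / es" "eu / es < 1"
proof -
  define q where "q = sqrt (T\<^sup>2 - 4 * \<Delta>)"
  have q: "q > 0" "q\<^sup>2 = T\<^sup>2 - 4 * \<Delta>" using assms by (auto simp: q_def)
  \<comment> \<open>The factor \<open>sgn T\<close> makes \<open>es\<close> the root of larger
    modulus, whatever the sign of the trace.\<close>
  define es eu where "es = (T + sgn T * q) / 2" and "eu = (T - sgn T * q) / 2"
  have "T \<noteq> 0" using assms by auto
  then have sg: "sgn T * sgn T = 1" "sgn T * T = \<bar>T\<bar>" by (auto simp: sgn_real_def)
  have prod: "es * eu = \<Delta>"
  proof -
    have "es * eu = (T\<^sup>2 - (sgn T * sgn T) * q\<^sup>2) / 4"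
      by (simp add: es_def eu_def power2_eq_square field_simps)
    then show ?thesis using sg q by simp
  qed
  have "es\<^sup>2 - es * eu = es * (sgn T * q)" by (simp add: es_def eu_def power2_eq_square field_simps)
  also have "\<dots> = (sgn T * T * q + (sgn T * sgn T) * q\<^sup>2) / 2" by (simp add: es_def power2_eq_square field_simps)
  also have "\<dots> > 0" using sg q(1) by (simp add: add_nonneg_pos)
  finally have gt: "es * eu < es\<^sup>2" by simp
  have nz: "es \<noteq> 0" "eu \<noteq> 0" using prod assms by auto
  then have "es\<^sup>2 > 0" by simp
  have e: "eu / es = es * eu / es\<^sup>2" using nz by (simp add: power2_eq_square)
  have "0 < eu / es" "eu / es < 1" unfolding e using gt prod assms \<open>es\<^sup>2 > 0\<close> by auto
  moreover have "es + eu = T" by (simp add: es_def eu_def field_simps)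
  ultimately show ?thesis using that[of es eu] nz prod by simp
qed

lemma deriv_G_map:
  assumes "M$1$1 + M$1$2 * m \<noteq> 0"
  shows "deriv (G_map M) m = det M / (M$1$1 + M$1$2 * m)\<^sup>2"
proof (rule DERIV_imp_deriv)
  have "((\<lambda>m. (M$2$1 + M$2$2 * m) / (M$1$1 + M$1$2 * m)) has_field_derivative
      (M$2$2 * (M$1$1 + M$1$2 * m) - (M$2$1 + M$2$2 * m) * M$1$2) / ((M$1$1 + M$1$2 * m) * (M$1$1 + M$1$2 * m))) (at m)"
    by (rule derivative_eq_intros refl assms | simp)+
  then show "(G_map M has_field_derivative det M / (M$1$1 + M$1$2 * m)\<^sup>2) (at m)"
    unfolding G_map_def[abs_def] det_2 by (simp add: power2_eq_square algebra_simps)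
qed

text \<open>A fixed slope \<open>m\<close> is that of an eigenvector \<open>(1, m)\<close> with
  eigenvalue \<open>M$1$1 + M$1$2 * m\<close>, and the derivative there is the other eigenvalue
  divided by this one. So \<open>m_stab\<close> belongs to the eigenvalue of larger modulus.\<close>

lemma G_fixpoints:
  fixes M :: "real^2^2"
  assumes "0 < det M" "det M < 1 / 4 * (trace M)\<^sup>2" "M$1$2 \<noteq> 0"
  obtains es eu where "es + eu = trace M" "es * eu = det M" "es \<noteq> 0" "eu \<noteq> 0" "0 < eu / es" "eu / es < 1"
    "M$1$1 + M$1$2 * m_stab M = es" "M$1$1 + M$1$2 * m_unstab M = eu"
proof -
  obtain es eu where l: "es + eu = trace M" "es * eu = det M" "es \<noteq> 0" "eu \<noteq> 0" "0 < eu / es" "eu / es < 1"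
    using eigenvalues[OF assms(1,2)] by blast
  have tr: "trace M = M$1$1 + M$2$2" by (simp add: trace_def sum_2)
  have fp: "G_fixpoint M m \<longleftrightarrow> M$1$1 + M$1$2 * m = es \<or> M$1$1 + M$1$2 * m = eu" for m
  proof -
    define ev where "ev = M$1$1 + M$1$2 * m"
    have "(ev - es) * (ev - eu) = ev * ev - (es + eu) * ev + es * eu" by (simp add: algebra_simps)
    also have "\<dots> = M$1$2 * (m * ev - (M$2$1 + M$2$2 * m))"
      unfolding l tr det_2 by (simp add: ev_def algebra_simps)
    finally have e: "(ev - es) * (ev - eu) = M$1$2 * (m * ev - (M$2$1 + M$2$2 * m))" .
    have "G_fixpoint M m \<longleftrightarrow> ev \<noteq> 0 \<and> m * ev - (M$2$1 + M$2$2 * m) = 0"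
      unfolding G_fixpoint_def G_map_def ev_def by (auto simp: divide_eq_eq)
    also have "\<dots> \<longleftrightarrow> ev \<noteq> 0 \<and> (ev - es) * (ev - eu) = 0" unfolding e using assms by simp
    finally show ?thesis using l by (auto simp: ev_def)
  qed
  have dv: "deriv (G_map M) m = es * eu / (M$1$1 + M$1$2 * m)\<^sup>2" if "M$1$1 + M$1$2 * m \<noteq> 0" for m
    using deriv_G_map[OF that] l by simp
  have ds: "deriv (G_map M) m = eu / es" if "M$1$1 + M$1$2 * m = es" for m
    using dv[of m] that l(3,4) by (simp add: power2_eq_square)
  have du: "deriv (G_map M) m = es / eu" if "M$1$1 + M$1$2 * m = eu" for m
    using dv[of m] that l(3,4) by (simp add: power2_eq_square)
  have gt: "es / eu > 1"
  proof -
    have "es / eu = inverse (eu / es)" by simp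
    then show ?thesis using l by (metis one_less_inverse)
  qed
  have s: "M$1$1 + M$1$2 * ((es - M$1$1) / M$1$2) = es" and u: "M$1$1 + M$1$2 * ((eu - M$1$1) / M$1$2) = eu"
    using assms by auto
  have "m_stab M = (es - M$1$1) / M$1$2" unfolding m_stab_def
  proof (rule the_equality)
    show "G_fixpoint M ((es - M$1$1) / M$1$2) \<and> 0 < deriv (G_map M) ((es - M$1$1) / M$1$2)
      \<and> deriv (G_map M) ((es - M$1$1) / M$1$2) < 1"
      using fp s ds[OF s] l by simp
    fix m assume m: "G_fixpoint M m \<and> 0 < deriv (G_map M) m \<and> deriv (G_map M) m < 1"
    then have "M$1$1 + M$1$2 * m = es" using fp[of m] du[of m] gt by auto
    then show "m = (es - M$1$1) / M$1$2" using assms by (auto simp: field_simps)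
  qed
  moreover have "m_unstab M = (eu - M$1$1) / M$1$2" unfolding m_unstab_def
  proof (rule the_equality)
    show "G_fixpoint M ((eu - M$1$1) / M$1$2) \<and> 1 < deriv (G_map M) ((eu - M$1$1) / M$1$2)"
      using fp u du[OF u] gt by simp
    fix m assume m: "G_fixpoint M m \<and> 1 < deriv (G_map M) m"
    then have "M$1$1 + M$1$2 * m = eu" using fp[of m] ds[of m] l by auto
    then show "m = (eu - M$1$1) / M$1$2" using assms by (auto simp: field_simps)
  qed
  ultimately show ?thesis using that[of es eu] l s u by simp
qed

text \<open>In the basis of eigenvectors, a slope on the same side of \<open>m_unstab M\<close> as \<open>m_stab M\<close> is moved
  towards \<open>m_stab M\<close>.\<close>

lemma cone_invariant:
  fixes M :: "real^2^2"
  assumes "0 < det M" "det M < 1 / 4 * (trace M)\<^sup>2" "M$1$2 \<noteq> 0"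
    and I: "m_stab M \<in> {lo..hi}" "m_unstab M \<notin> {lo..hi}" "m \<in> {lo..hi}"
  shows "M$1$1 + M$1$2 * m \<noteq> 0" "G_map M m \<in> {lo..hi}"
proof -
  obtain es eu where l: "es + eu = trace M" "es * eu = det M" "es \<noteq> 0" "eu \<noteq> 0" "0 < eu / es" "eu / es < 1"
    and s: "M$1$1 + M$1$2 * m_stab M = es" and u: "M$1$1 + M$1$2 * m_unstab M = eu"
    using G_fixpoints[OF assms(1-3)] by blast
  have tr: "trace M = M$1$1 + M$2$2" by (simp add: trace_def sum_2)
  define ev where "ev = M$1$1 + M$1$2 * m"
  \<comment> \<open>The multiplier \<open>ev\<close> is affine in \<open>m\<close>, equal to
    \<open>eu\<close> at the unstable slope and to \<open>es\<close> at the stable one. Since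
    \<open>\<alpha> > 0\<close> puts \<open>m\<close> on the stable side,
    \<open>ev / eu > 1\<close>.\<close>
  define \<alpha> where "\<alpha> = (m - m_unstab M) / (m_stab M - m_unstab M)"
  define r where "r = 1 + \<alpha> * (es / eu - 1)"
  have a: "\<alpha> > 0" using I by (auto simp: \<alpha>_def zero_less_divide_iff)
  have ne: "m_stab M \<noteq> m_unstab M" using I by auto
  have "ev - eu = M$1$2 * (m - m_unstab M)" unfolding ev_def u[symmetric] by (simp add: algebra_simps)
  also have "\<dots> = \<alpha> * (M$1$2 * (m_stab M - m_unstab M))" using ne by (simp add: \<alpha>_def)
  also have "M$1$2 * (m_stab M - m_unstab M) = es - eu" unfolding s[symmetric] u[symmetric] by (simp add: algebra_simps)
  finally have "ev = eu + \<alpha> * (eu * (es / eu) - eu)" using l(4) by simp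
  then have "ev = eu * (1 + \<alpha> * (es / eu - 1))" by (simp only: algebra_simps mult_1_right)
  then have ev: "ev = eu * r" by (simp only: r_def)
  have "es / eu = inverse (eu / es)" by simp
  then have "es / eu > 1" using l(5,6) by (metis one_less_inverse)
  then have "r > 1" using a by (simp add: r_def)
  then have k: "ev \<noteq> 0" "0 < eu / ev" "eu / ev < 1" using l(4) by (auto simp: ev)
  show "M$1$1 + M$1$2 * m \<noteq> 0" using k by (simp add: ev_def)
  have d: "M$2$2 - M$1$2 * m_stab M = eu" using l(1) s tr by simp
  have "M$1$2 * (M$2$1 + M$2$2 * m_stab M - m_stab M * es) = 0"
  proof -
    have "M$1$2 * M$2$1 = M$1$1 * M$2$2 - es * eu" using l(2) by (simp add: det_2)
    moreover have "M$1$2 * m_stab M = es - M$1$1" using s by simp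
    then have "M$1$2 * (m_stab M * (M$2$2 - es)) = (es - M$1$1) * (M$2$2 - es)" by (simp only: mult.assoc[symmetric])
    moreover have "M$1$2 * (M$2$1 + M$2$2 * m_stab M - m_stab M * es)
      = M$1$2 * M$2$1 + M$1$2 * (m_stab M * (M$2$2 - es))" by (simp add: algebra_simps)
    ultimately have "M$1$2 * (M$2$1 + M$2$2 * m_stab M - m_stab M * es)
      = M$1$1 * M$2$2 - es * eu + (es - M$1$1) * (M$2$2 - es)" by simp
    also have "\<dots> = 0"
    proof -
      have e: "M$2$2 = es + eu - M$1$1" using l(1) tr by simp
      show ?thesis unfolding e by (simp add: algebra_simps)
    qed
    finally show ?thesis .
  qed
  then have "M$2$1 + M$2$2 * m_stab M - m_stab M * es = 0" using assms(3) by (simp only: mult_eq_0_iff) simp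
  then have c: "M$2$1 = m_stab M * (es - M$2$2)" by (simp add: algebra_simps)
  have "(M$2$1 + M$2$2 * m) - m_stab M * ev = (m - m_stab M) * eu"
    unfolding ev_def d[symmetric] c s[symmetric] by (simp add: algebra_simps)
  then have G: "G_map M m = m_stab M + (eu / ev) * (m - m_stab M)"
    using k unfolding G_map_def ev_def[symmetric] by (simp add: field_simps)
  define t where "t = eu / ev"
  have t: "0 < t" "t < 1" using k by (simp_all add: t_def)
  have "G_map M m = (1 - t) * m_stab M + t * m" unfolding G t_def by (simp add: algebra_simps)
  moreover have "(1 - t) * lo + t * lo \<le> (1 - t) * m_stab M + t * m" "(1 - t) * m_stab M + t * m \<le> (1 - t) * hi + t * hi"
    using t I by (auto intro!: add_mono mult_left_mono)
  ultimately show "G_map M m \<in> {lo..hi}" by (simp add: algebra_simps)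
qed

section \<open>Expansion of the cone\<close>

lemma deriv_H_map:
  "deriv (H_map M) m = 2 * ((M$1$2)\<^sup>2 + (M$2$2)\<^sup>2 - 1) * m + 2 * (M$1$1 * M$1$2 + M$2$1 * M$2$2)"
proof (rule DERIV_imp_deriv)
  show "(H_map M has_field_derivative
      2 * ((M$1$2)\<^sup>2 + (M$2$2)\<^sup>2 - 1) * m + 2 * (M$1$1 * M$1$2 + M$2$1 * M$2$2)) (at m)"
    unfolding H_map_def[abs_def] by (rule derivative_eq_intros refl | simp)+
qed

text \<open>\<open>H_map M m\<close> is the squared norm of the image of \<open>(1, m)\<close> minus
  that of \<open>(1, m)\<close>. If the parabola is convex, \<open>m_decr M\<close> is the smaller
  root and one of the outer inequalities puts the interval beside both roots; if it is concave, the
  middle inequality fails and the outer two put it between them.\<close>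

lemma H_map_pos:
  fixes M :: "real^2^2"
  assumes C5: "cond_C5_at lo hi M" and m: "m \<in> {lo..hi}"
  shows "H_map M m > 0"
proof -
  define A where "A = (M$1$2)\<^sup>2 + (M$2$2)\<^sup>2 - 1"
  define B where "B = M$1$1 * M$1$2 + M$2$1 * M$2$2"
  define C where "C = (M$1$1)\<^sup>2 + (M$2$1)\<^sup>2 - 1"
  have H: "H_map M z = A * z\<^sup>2 + 2 * B * z + C" for z by (simp add: H_map_def A_def B_def C_def)
  have dH: "deriv (H_map M) z = 2 * A * z + 2 * B" for z by (simp add: deriv_H_map A_def B_def)
  show ?thesis
  proof (cases "A = 0")
    case True
    then have "B \<noteq> 0" "B < 0 \<Longrightarrow> - C / (2 * B) > hi" "B > 0 \<Longrightarrow> - C / (2 * B) < lo"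
      using C5 by (auto simp: cond_C5_at_def m_root_def A_def B_def C_def)
    then have "B < 0 \<and> - C / (2 * B) > m \<or> B > 0 \<and> - C / (2 * B) < m" using m by force
    then have "2 * B * m + C > 0" by (auto simp: field_simps)
    then show ?thesis using H True by simp
  next
    case False
    then have card: "card {z. H_map M z = 0} = 2" and
      ineq: "hi < m_decr M \<and> m_decr M < m_incr M \<or> hi < m_decr M \<and> m_incr M < lo \<or> m_decr M < m_incr M \<and> m_incr M < lo"
      using C5 by (auto simp: cond_C5_at_def A_def)
    obtain x0 y0 where "{z. H_map M z = 0} = {x0, y0}" "x0 \<noteq> y0" using card card_2_iff by metis
    then obtain x y where xy: "{z. H_map M z = 0} = {x, y}" "x < y"
      by (metis insert_commute linorder_neqE_linordered_idom)
    have Hx: "A * x\<^sup>2 + 2 * B * x + C = 0" and "A * y\<^sup>2 + 2 * B * y + C = 0" using xy H by auto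
    then have "(y - x) * (A * (x + y) + 2 * B) = 0" by (simp add: power2_eq_square algebra_simps)
    then have B: "2 * B = - A * (x + y)" using xy by simp
    have "C = - A * x\<^sup>2 - (2 * B) * x" using Hx by simp
    then have C: "C = A * x * y" unfolding B by (simp add: power2_eq_square algebra_simps)
    have Hz: "H_map M z = A * ((z - x) * (z - y))" for z
      unfolding H B C by (simp add: power2_eq_square algebra_simps)
    have dx: "deriv (H_map M) x = A * (x - y)" and dy: "deriv (H_map M) y = A * (y - x)"
      unfolding dH B by (auto simp: algebra_simps)
    have roots: "H_map M z = 0 \<longleftrightarrow> z = x \<or> z = y" for z using xy(1) by blast
    show ?thesis
    proof (cases "A > 0")
      case True
      then have dx': "deriv (H_map M) x < 0" and dy': "deriv (H_map M) y > 0"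
        unfolding dx dy using xy by (auto simp: mult_pos_neg)
      have "m_incr M = y" unfolding m_incr_def
        by (rule the_equality) (use roots dx' dy' in auto)
      moreover have "m_decr M = x" unfolding m_decr_def
        by (rule the_equality) (use roots dx' dy' in auto)
      ultimately have "m < x \<or> y < m" using ineq m xy by auto
      then have "(m - x) * (m - y) > 0" using xy by (auto simp: zero_less_mult_iff)
      then show ?thesis unfolding Hz using True by simp
    next
      case F: False
      then have "A < 0" using False by simp
      then have dx': "deriv (H_map M) x > 0" and dy': "deriv (H_map M) y < 0"
        unfolding dx dy using xy by (auto simp: mult_neg_pos mult_neg_neg)
      have "m_incr M = x" unfolding m_incr_def
        by (rule the_equality) (use roots dx' dy' in auto)
      moreover have "m_decr M = y" unfolding m_decr_def
        by (rule the_equality) (use roots dx' dy' in auto)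
      ultimately have "x < m \<and> m < y" using ineq m xy by auto
      then have "(m - x) * (m - y) < 0" by (simp add: mult_pos_neg)
      then show ?thesis unfolding Hz using \<open>A < 0\<close> by (rule mult_neg_neg[rotated])
    qed
  qed
qed

lemma norm_vec2_sq: "(norm (v :: real^2))\<^sup>2 = (v$1)\<^sup>2 + (v$2)\<^sup>2"
  unfolding power2_norm_eq_inner by (simp add: inner_vec_def sum_2 power2_eq_square)

lemma matrix_vec2 [simp]:
  "((M :: real^2^2) *v v) $ 1 = M$1$1 * v$1 + M$1$2 * v$2"
  "((M :: real^2^2) *v v) $ 2 = M$2$1 * v$1 + M$2$2 * v$2"
  by (simp_all add: matrix_vector_mult_def sum_2)

definition slope_cone :: "real \<Rightarrow> real \<Rightarrow> (real^2) set" where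
  "slope_cone lo hi = {v. \<exists>m\<in>{lo..hi}. v $ 2 = m * v $ 1}"

lemma expansion_at:
  fixes M :: "real^2^2"
  assumes "lo \<le> hi" "\<And>m. m \<in> {lo..hi} \<Longrightarrow> H_map M m > 0"
  obtains c where "c > 1" "\<And>v. v \<in> slope_cone lo hi \<Longrightarrow> norm (M *v v) \<ge> c * norm v"
proof -
  \<comment> \<open>\<open>1 + h m\<close> is the factor by which the squared norm of a vector of
    slope \<open>m\<close> grows; its minimum over the compact interval gives a uniform
    constant.\<close>
  define h where "h m = H_map M m / (1 + m\<^sup>2)" for m
  have nz: "1 + m\<^sup>2 > 0" for m :: real by (simp add: add_pos_nonneg)
  have "continuous_on {lo..hi} h"
    unfolding h_def H_map_def using nz by (intro continuous_intros) (auto simp: less_le)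
  then obtain m0 where m0: "m0 \<in> {lo..hi}" "\<And>m. m \<in> {lo..hi} \<Longrightarrow> h m0 \<le> h m"
    using continuous_attains_inf[of "{lo..hi}" h] assms by auto
  have h0: "h m0 > 0" using assms(2)[OF m0(1)] nz by (simp add: h_def)
  show ?thesis
  proof (rule that[of "sqrt (1 + h m0)"])
    show "1 < sqrt (1 + h m0)" using h0 by simp
    fix v assume "v \<in> slope_cone lo hi"
    then obtain m where m: "m \<in> {lo..hi}" "v $ 2 = m * v $ 1" by (auto simp: slope_cone_def)
    have nv: "(norm v)\<^sup>2 = (1 + m\<^sup>2) * (v$1)\<^sup>2" by (simp add: norm_vec2_sq m power_mult_distrib algebra_simps)
    have nMv: "(norm (M *v v))\<^sup>2 = (H_map M m + (1 + m\<^sup>2)) * (v$1)\<^sup>2"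
      unfolding norm_vec2_sq H_map_def by (simp add: m power2_eq_square algebra_simps)
    have "h m0 * (1 + m\<^sup>2) \<le> H_map M m" using m0(2)[OF m(1)] nz[of m] by (simp add: h_def pos_le_divide_eq)
    then have "(1 + h m0) * (1 + m\<^sup>2) * (v$1)\<^sup>2 \<le> (H_map M m + (1 + m\<^sup>2)) * (v$1)\<^sup>2"
      by (intro mult_right_mono) (auto simp: algebra_simps)
    then have "(sqrt (1 + h m0) * norm v)\<^sup>2 \<le> (norm (M *v v))\<^sup>2"
      using h0 by (simp add: power_mult_distrib nv nMv algebra_simps)
    then show "sqrt (1 + h m0) * norm v \<le> norm (M *v v)" by (rule power2_le_imp_le) simp
  qed
qed

lemma cone_expansion:
  assumes J: "finite J" "J \<noteq> {}" and C: "cond_C3 M J" "cond_C4 M J" "cond_C5 M J"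
  obtains lo hi c where "lo \<le> hi" "c > 1"
    "\<And>j v. j \<in> J \<Longrightarrow> v \<in> slope_cone lo hi \<Longrightarrow> M j *v v \<in> slope_cone lo hi \<and> norm (M j *v v) \<ge> c * norm v"
proof -
  define lo hi where "lo = m_stab_min M J" and "hi = m_stab_max M J"
  have st: "m_stab (M j) \<in> {lo..hi}" if "j \<in> J" for j
    using J that by (auto simp: lo_def hi_def m_stab_min_def m_stab_max_def)
  then have lohi: "lo \<le> hi" using J by fastforce
  have H: "H_map (M j) m > 0" if "j \<in> J" "m \<in> {lo..hi}" for j m
    using H_map_pos[of lo hi "M j" m] C(3) that by (auto simp: cond_C5_def lo_def hi_def)
  have "\<exists>c>1. \<forall>v\<in>slope_cone lo hi. norm (M j *v v) \<ge> c * norm v" if "j \<in> J" for j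
    using expansion_at[OF lohi H[OF that]] by metis
  then obtain c where c: "\<And>j. j \<in> J \<Longrightarrow> c j > 1" "\<And>j v. j \<in> J \<Longrightarrow> v \<in> slope_cone lo hi \<Longrightarrow> norm (M j *v v) \<ge> c j * norm v"
    by metis
  show ?thesis
  proof (rule that[of lo hi "Min (c ` J)"])
    show "Min (c ` J) > 1" using J c by simp
    fix j v assume jv: "j \<in> J" "v \<in> slope_cone lo hi"
    have "Min (c ` J) * norm v \<le> c j * norm v" using J jv by (intro mult_right_mono) auto
    also have "\<dots> \<le> norm (M j *v v)" using c jv by simp
    finally have "Min (c ` J) * norm v \<le> norm (M j *v v)" .
    moreover obtain m where m: "m \<in> {lo..hi}" "v $ 2 = m * v $ 1" using jv by (auto simp: slope_cone_def)
    have "M j $1$1 + M j $1$2 * m \<noteq> 0" "G_map (M j) m \<in> {lo..hi}"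
      using cone_invariant[of "M j" lo hi m] C st[OF jv(1)] m jv(1)
      by (auto simp: cond_C3_def cond_C4_def lo_def hi_def)
    then have "M j *v v \<in> slope_cone lo hi" unfolding slope_cone_def
      by (intro CollectI bexI[of _ "G_map (M j) m"]) (auto simp: G_map_def m field_simps)
    ultimately show "M j *v v \<in> slope_cone lo hi \<and> Min (c ` J) * norm v \<le> norm (M j *v v)" by simp
  qed (rule lohi)
qed

section \<open>Directional derivatives and growth\<close>

context polygon
begin

abbreviation AL :: "real^2^2" where "AL \<equiv> bc_matrix \<tau>L \<delta>L"
abbreviation AR :: "real^2^2" where "AR \<equiv> bc_matrix \<tau>R \<delta>R"

text \<open>On the switching line, the direction decides on which side the perturbed point lies.\<close>

definition left_side :: "real^2 \<Rightarrow> real^2 \<Rightarrow> bool" where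
  "left_side x v \<longleftrightarrow> x $ 1 < 0 \<or> x $ 1 = 0 \<and> v $ 1 < 0"

definition Df :: "real^2 \<Rightarrow> real^2 \<Rightarrow> real^2" where
  "Df x v = (if left_side x v then AL *v v else AR *v v)"

primrec Dfn :: "nat \<Rightarrow> real^2 \<Rightarrow> real^2 \<Rightarrow> real^2" where
  "Dfn 0 x v = v"
| "Dfn (Suc n) x v = Df ((f ^^ n) x) (Dfn n x v)"

lemma bc_matrix_entries [simp]:
  "bc_matrix \<tau> \<delta> $ 1 $ 1 = \<tau>" "bc_matrix \<tau> \<delta> $ 1 $ 2 = 1"
  "bc_matrix \<tau> \<delta> $ 2 $ 1 = - \<delta>" "bc_matrix \<tau> \<delta> $ 2 $ 2 = 0"
  by (simp_all add: bc_matrix_def)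

text \<open>Since \<open>f\<close> is piecewise affine, the first-order formula is exact for small
  \<open>h\<close> and passes to iterates without an error term.\<close>

lemma f_directional: "\<forall>\<^sub>F h in at_right 0. f (x + h *\<^sub>R v) = f x + h *\<^sub>R Df x v"
proof -
  have pos: "\<forall>\<^sub>F h :: real in at_right 0. h > 0" by (simp add: eventually_at_right_less)
  have lim: "((\<lambda>h. x $ 1 + h * v $ 1) \<longlongrightarrow> x $ 1 + 0 * v $ 1) (at_right 0)" by (intro tendsto_intros)
  have fL: "fL (x + h *\<^sub>R v) = fL x + h *\<^sub>R (AL *v v)" and fR: "fR (x + h *\<^sub>R v) = fR x + h *\<^sub>R (AR *v v)" for h
    by (simp_all add: vec2_eq_iff algebra_simps)
  consider "x $ 1 < 0" | "x $ 1 > 0" | "x $ 1 = 0" by linarith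
  then show ?thesis
  proof cases
    case 1
    then have "\<forall>\<^sub>F h in at_right 0. x $ 1 + h * v $ 1 < 0" using order_tendstoD(2)[OF lim] by simp
    then show ?thesis
      by eventually_elim (use 1 in \<open>simp add: f_left Df_def left_side_def fL\<close>)
  next
    case 2
    then have "\<forall>\<^sub>F h in at_right 0. x $ 1 + h * v $ 1 > 0" using order_tendstoD(1)[OF lim] by simp
    then show ?thesis
      by eventually_elim (use 2 in \<open>simp add: f_right Df_def left_side_def fR\<close>)
  next
    case 3
    show ?thesis
    proof (cases "v $ 1 < 0")
      case True
      show ?thesis using pos
        by eventually_elim (use 3 True in \<open>simp add: f_left Df_def left_side_def fL mult_pos_neg less_imp_le\<close>)
    next
      case False
      show ?thesis using pos
        by eventually_elim (use 3 False in \<open>simp add: f_right Df_def left_side_def fR\<close>)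
    qed
  qed
qed

lemma funpow_directional: "\<forall>\<^sub>F h in at_right 0. (f ^^ n) (x + h *\<^sub>R v) = (f ^^ n) x + h *\<^sub>R Dfn n x v"
proof (induction n)
  case (Suc n)
  show ?case using Suc f_directional[of "(f ^^ n) x" "Dfn n x v"] by eventually_elim simp
qed simp

lemma one_sided_deriv_funpow: "one_sided_deriv (f ^^ n) v x = Dfn n x v"
  unfolding one_sided_deriv_def
proof (rule tendsto_Lim)
  have pos: "\<forall>\<^sub>F h :: real in at_right 0. h > 0" by (simp add: eventually_at_right_less)
  have "\<forall>\<^sub>F h in at_right 0. ((f ^^ n) (x + h *\<^sub>R v) - (f ^^ n) x) /\<^sub>R h = Dfn n x v"
    using funpow_directional[of n x v] pos by eventually_elim simp
  then show "((\<lambda>h. ((f ^^ n) (x + h *\<^sub>R v) - (f ^^ n) x) /\<^sub>R h) \<longlongrightarrow> Dfn n x v) (at_right 0)"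
    by (rule tendsto_eventually)
qed simp

text \<open>The two candidate preimages have first coordinates of equal sign, so one of them lies on
  the side it was computed for. This lets a cone direction, prescribed when the orbit reaches the
  right half-plane, be pulled back to the starting point.\<close>

lemma Df_surj: "\<exists>v. Df x v = w"
proof -
  define vL vR :: "real^2" where "vL = vector [- w $ 2 / \<delta>L, w $ 1 + \<tau>L * w $ 2 / \<delta>L]"
    and "vR = vector [- w $ 2 / \<delta>R, w $ 1 + \<tau>R * w $ 2 / \<delta>R]"
  have v: "AL *v vL = w" "AR *v vR = w"
    using deltas by (auto simp: vec2_eq_iff vL_def vR_def)
  have "left_side x vL \<or> \<not> left_side x vR"
    using deltas by (auto simp: left_side_def vL_def vR_def divide_less_0_iff zero_less_divide_iff)
  then show ?thesis using v by (auto simp: Df_def)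
qed

lemma Dfn_surj: "\<exists>v. Dfn n x v = w"
proof (induction n arbitrary: w)
  case (Suc n)
  obtain v' where "Df ((f ^^ n) x) v' = w" using Df_surj by blast
  moreover obtain v where "Dfn n x v = v'" using Suc by blast
  ultimately show ?case by auto
qed simp

lemma Dfn_add: "Dfn (n + k) x v = Dfn k ((f ^^ n) x) (Dfn n x v)"
proof (induction k)
  case (Suc k)
  have "(f ^^ (n + k)) x = (f ^^ k) ((f ^^ n) x)" by (simp add: funpow_add add.commute[of n])
  then show ?case using Suc by simp
qed simp

end

context trapped_polygon
begin

lemma iterate_Omega': "x \<in> Omega' \<Longrightarrow> (f ^^ n) x \<in> Omega'"
  using f_Omega Omega'_Omega by (induction n) auto

lemma reaches_right:
  assumes "x \<in> Omega'"
  shows "\<exists>n. (f ^^ n) x $ 1 > 0"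
proof (rule ccontr)
  assume "\<not> ?thesis"
  then have neg: "(f ^^ n) x $ 1 \<le> 0" for n by (auto simp: not_less)
  have "(fL ^^ n) x = (f ^^ n) x" for n
    using neg by (induction n) (auto simp: f_left)
  moreover have "x \<in> Omega_L" using neg[of 0] assms by (simp add: Omega'_def)
  ultimately show False using exit_left_of_left neg by (metis not_le)
qed

text \<open>A block is one right step and \<open>q\<close> left steps. On the switching line the
  transported direction decides the side, so a block may end there before the orbit is strictly to
  the right; the time from \<open>run\<close> is only an upper bound for \<open>q\<close>.\<close>

lemma block:
  assumes y: "y \<in> Omega'" "\<not> left_side y w"
    and run: "\<And>x. x \<in> Omega_R \<Longrightarrow> \<exists>k\<le>p. (fL ^^ k) (f x) $ 1 > 0"
  obtains q where "q \<le> p" "Dfn (Suc q) y w = word_matrix AL AR (Suc q) *v w"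
    "\<not> left_side ((f ^^ Suc q) y) (Dfn (Suc q) y w)"
proof -
  let ?S = "\<lambda>q. left_side ((f ^^ Suc q) y) (Dfn (Suc q) y w)"
  have follow: "(fL ^^ k) (f y) = (f ^^ Suc k) y \<and> Dfn (Suc k) y w = word_matrix AL AR (Suc k) *v w"
    if "\<forall>i<k. ?S i" for k
    using that
  proof (induction k)
    case 0 then show ?case using y by (simp add: Df_def word_matrix_def)
  next
    case (Suc k)
    then have IH: "(fL ^^ k) (f y) = (f ^^ Suc k) y" "Dfn (Suc k) y w = word_matrix AL AR (Suc k) *v w" and k: "?S k" by auto
    have "(f ^^ Suc k) y $ 1 \<le> 0" using k unfolding left_side_def by linarith
    then have 1: "(fL ^^ Suc k) (f y) = (f ^^ Suc (Suc k)) y" using IH(1) f_left[of "(f ^^ Suc k) y"] by simp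
    have "Dfn (Suc (Suc k)) y w = AL *v (Dfn (Suc k) y w)" using k by (simp add: Df_def)
    then have "Dfn (Suc (Suc k)) y w = word_matrix AL AR (Suc (Suc k)) *v w"
      unfolding IH(2) by (simp add: word_matrix_def matrix_vector_mul_assoc)
    with 1 show ?case by blast
  qed
  have "y \<in> Omega_R" using y by (auto simp: Omega'_def left_side_def)
  then obtain k where k: "k \<le> p" "(fL ^^ k) (f y) $ 1 > 0" using run by blast
  have ex: "\<not> (\<forall>i<Suc k. ?S i)"
  proof
    assume a: "\<forall>i<Suc k. ?S i"
    then have "(f ^^ Suc k) y $ 1 > 0" using follow[of k] k by simp
    moreover have "?S k" using a by blast
    ultimately show False unfolding left_side_def by linarith
  qed
  define q where "q = (LEAST q. \<not> ?S q)"
  have q: "\<not> ?S q" unfolding q_def by (rule LeastI_ex) (use ex in blast)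
  have less: "\<forall>i<q. ?S i" unfolding q_def using not_less_Least by blast
  have "q \<le> k"
  proof (rule ccontr)
    assume "\<not> q \<le> k"
    then have "i < Suc k \<Longrightarrow> i < q" for i by simp
    then have "\<forall>i<Suc k. ?S i" using less by blast
    then show False using ex by blast
  qed
  then show ?thesis using that[of q] k follow[OF less] q by simp
qed

lemma growth:
  assumes y: "y \<in> Omega'" "\<not> left_side y w" and w: "w \<in> C"
    and run: "\<And>x. x \<in> Omega_R \<Longrightarrow> \<exists>k\<le>p. (fL ^^ k) (f x) $ 1 > 0"
    and c: "c > 1" "\<And>q v. q \<le> p \<Longrightarrow> v \<in> C \<Longrightarrow> word_matrix AL AR (Suc q) *v v \<in> C \<and> norm (word_matrix AL AR (Suc q) *v v) \<ge> c * norm v"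
  shows "\<exists>n. k \<le> n \<and> n \<le> k * Suc p \<and> Dfn n y w \<in> C \<and> \<not> left_side ((f ^^ n) y) (Dfn n y w) \<and> norm (Dfn n y w) \<ge> c ^ k * norm w"
proof (induction k)
  case 0 then show ?case using y w by (intro exI[of _ 0]) simp
next
  case (Suc k)
  then obtain n where n: "k \<le> n" "n \<le> k * Suc p" "Dfn n y w \<in> C" "\<not> left_side ((f ^^ n) y) (Dfn n y w)"
    "norm (Dfn n y w) \<ge> c ^ k * norm w" by blast
  obtain q where q: "q \<le> p" "Dfn (Suc q) ((f ^^ n) y) (Dfn n y w) = word_matrix AL AR (Suc q) *v Dfn n y w"
    "\<not> left_side ((f ^^ Suc q) ((f ^^ n) y)) (Dfn (Suc q) ((f ^^ n) y) (Dfn n y w))"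
    using block[OF iterate_Omega'[OF y(1)] n(4) run] by metis
  have D: "Dfn (n + Suc q) y w = word_matrix AL AR (Suc q) *v Dfn n y w"
    unfolding Dfn_add by (rule q(2))
  have F: "(f ^^ (n + Suc q)) y = (f ^^ Suc q) ((f ^^ n) y)"
    by (metis add.commute comp_apply funpow_add)
  have "c ^ Suc k * norm w = c * (c ^ k * norm w)" by simp
  also have "\<dots> \<le> c * norm (Dfn n y w)" using n c by (intro mult_left_mono) auto
  also have "\<dots> \<le> norm (Dfn (n + Suc q) y w)" using c(2)[OF q(1) n(3)] D by simp
  finally have "c ^ Suc k * norm w \<le> norm (Dfn (n + Suc q) y w)" .
  moreover have "Suc k \<le> n + Suc q" "n + Suc q \<le> Suc k * Suc p" using n q by auto
  ultimately show ?case using c(2)[OF q(1) n(3)] q(3) D F Dfn_add[of n "Suc q" y w]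
    by (intro exI[of _ "n + Suc q"]) metis
qed

lemma lyapunov_positive:
  assumes x: "x \<in> Omega'" and lohi: "lo \<le> hi"
    and run: "\<And>x. x \<in> Omega_R \<Longrightarrow> \<exists>k\<le>p. (fL ^^ k) (f x) $ 1 > 0"
    and c: "c > 1" "\<And>q v. q \<le> p \<Longrightarrow> v \<in> slope_cone lo hi \<Longrightarrow>
      word_matrix AL AR (Suc q) *v v \<in> slope_cone lo hi \<and> norm (word_matrix AL AR (Suc q) *v v) \<ge> c * norm v"
  shows "\<exists>v. lyapunov_exponent f x v > 0"
proof -
  obtain n0 where n0: "(f ^^ n0) x $ 1 > 0" using reaches_right[OF x] by blast
  define y where "y = (f ^^ n0) x"
  define w0 w :: "real^2" where "w0 = vector [1, lo]" and "w = w0 /\<^sub>R norm w0"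
  have "w0 $ 1 = 1" by (simp add: w0_def)
  then have "w0 \<noteq> 0" by (metis zero_index zero_neq_one)
  then have nw: "norm w = 1" by (simp add: w_def)
  have w: "w \<in> slope_cone lo hi" using lohi by (auto simp: slope_cone_def w_def w0_def intro!: bexI[of _ lo])
  have y: "y \<in> Omega'" "\<not> left_side y w" using iterate_Omega'[OF x] n0 by (auto simp: y_def left_side_def)
  obtain v where v: "Dfn n0 x v = w" using Dfn_surj by blast
  \<comment> \<open>\<open>Suc N\<close> blocks end by time \<open>n0 + Suc N * Suc p\<close>, which
    is at most \<open>Suc N * (n0 + Suc p)\<close>, and multiply the norm by at least
    \<open>c ^ Suc N\<close>. For the limsup this rate is needed only at infinitely many
    times.\<close>
  define L where "L = ln c / (real n0 + real (Suc p))"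
  have L: "L > 0" using c by (simp add: L_def)
  have often: "\<exists>n\<ge>N. ereal L \<le> ereal (1 / real n) * ext_ln (norm (one_sided_deriv (f ^^ n) v x))" for N
  proof -
    obtain n where n: "Suc N \<le> n" "n \<le> Suc N * Suc p" "norm (Dfn n y w) \<ge> c ^ Suc N * norm w"
      using growth[OF y w run c] by blast
    have g: "norm (Dfn (n0 + n) x v) \<ge> c ^ Suc N" using n nw by (simp add: Dfn_add y_def v)
    moreover have "c ^ Suc N > 0" using c by simp
    ultimately have p: "norm (Dfn (n0 + n) x v) > 0" by linarith
    have "L * real (n0 + n) \<le> real (Suc N) * ln c"
    proof -
      have "n0 + n \<le> Suc N * (n0 + Suc p)" using n(2) by (simp add: algebra_simps)
      then have "real (n0 + n) \<le> real (Suc N) * (real n0 + real (Suc p))" by (metis of_nat_add of_nat_le_iff of_nat_mult)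
      then have "L * real (n0 + n) \<le> L * (real (Suc N) * (real n0 + real (Suc p)))" using L by (intro mult_left_mono) auto
      also have "\<dots> = real (Suc N) * ln c" by (simp add: L_def)
      finally show ?thesis .
    qed
    also have "real (Suc N) * ln c = ln (c ^ Suc N)" using c by (simp add: ln_realpow del: power_Suc)
    also have "\<dots> \<le> ln (norm (Dfn (n0 + n) x v))" using g \<open>c ^ Suc N > 0\<close> p by (subst ln_le_cancel_iff) auto
    finally have "L \<le> 1 / real (n0 + n) * ln (norm (Dfn (n0 + n) x v))" using n by (simp add: field_simps)
    then show ?thesis using p n
      by (intro exI[of _ "n0 + n"]) (auto simp: one_sided_deriv_funpow ext_ln_def)
  qed
  have "ereal L \<le> lyapunov_exponent f x v"
  proof (rule ccontr)
    assume "\<not> ?thesis"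
    then have "limsup (\<lambda>n. ereal (1 / real n) * ext_ln (norm (one_sided_deriv (f ^^ n) v x))) < ereal L"
      by (simp add: lyapunov_exponent_def)
    then have "\<forall>\<^sub>F n in sequentially. ereal (1 / real n) * ext_ln (norm (one_sided_deriv (f ^^ n) v x)) < ereal L"
      by (rule Limsup_lessD)
    then obtain N where "\<forall>n\<ge>N. ereal (1 / real n) * ext_ln (norm (one_sided_deriv (f ^^ n) v x)) < ereal L"
      by (auto simp: eventually_sequentially)
    then show False using often[of N] by (meson not_le)
  qed
  moreover have "ereal L > 0" using L by simp
  ultimately show ?thesis by (metis less_le_trans)
qed

end

section \<open>The region given by (C1) and (C2)\<close>

fun affine_orbit :: "real \<Rightarrow> real \<Rightarrow> real \<Rightarrow> real \<Rightarrow> nat \<Rightarrow> real" where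
  "affine_orbit \<tau> \<delta> \<mu> a 0 = a"
| "affine_orbit \<tau> \<delta> \<mu> a (Suc 0) = 0"
| "affine_orbit \<tau> \<delta> \<mu> a (Suc (Suc k)) = \<tau> * affine_orbit \<tau> \<delta> \<mu> a (Suc k) - \<delta> * affine_orbit \<tau> \<delta> \<mu> a k + \<mu>"

lemma affine_hull_crossing:
  fixes p q :: "real^2"
  assumes "p $ i \<le> 0" "q $ i > 0"
  obtains u where "u \<in> affine hull {p, q}" "u $ i = 0"
proof
  define t where "t = - (p $ i) / (q $ i - p $ i)"
  show "(1 - t) *\<^sub>R p + t *\<^sub>R q \<in> affine hull {p, q}"
    unfolding affine_hull_2 by (intro CollectI exI[of _ "1 - t"] exI[of _ t]) simp
  have "t * (q $ i - p $ i) = - (p $ i)" using assms by (simp add: t_def)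
  then show "((1 - t) *\<^sub>R p + t *\<^sub>R q) $ i = 0" by (simp add: algebra_simps)
qed

lemma affine_on_hull:
  fixes h :: "real^2 \<Rightarrow> real"
  assumes h: "\<And>x. h x = c0 + c1 * x $ 1 + c2 * x $ 2" and "h p = 0" "h q = 0" "u \<in> affine hull {p, q}"
  shows "h u = 0"
proof -
  obtain s t where st: "u = s *\<^sub>R p + t *\<^sub>R q" "s + t = 1" using assms(4) unfolding affine_hull_2 by blast
  have "h u = s * h p + t * h q + (1 - (s + t)) * c0" unfolding h st(1) by (simp add: algebra_simps)
  then show ?thesis using assms st by simp
qed

locale detected =
  fixes \<tau>L \<delta>L \<tau>R \<delta>R \<beta> :: real
  assumes dL: "\<delta>L > 0" and dR: "\<delta>R > 0" and beta: "\<beta> > 0"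
    and C1: "cond_C1 (bcnf \<tau>L \<delta>L \<tau>R \<delta>R) \<beta>" and C2: "cond_C2 (bcnf \<tau>L \<delta>L \<tau>R \<delta>R) \<beta>"
begin

abbreviation F where "F \<equiv> bcnf \<tau>L \<delta>L \<tau>R \<delta>R"
abbreviation "X \<equiv> pt_X \<beta>"
abbreviation "r \<equiv> idx_r F \<beta>"
abbreviation "ell \<equiv> idx_l F \<beta>"

text \<open>The initial values encode points: \<open>- \<delta>R * sR 0\<close> is the second
  coordinate of \<open>X\<close>, and \<open>- sL 0\<close> is the first coordinate of
  \<open>f(X)\<close>. The value 0 at index 1 reflects that \<open>X\<close> lies on the switching
  line.\<close>

definition "sR = affine_orbit \<tau>R \<delta>R 1 (- \<beta> / \<delta>R)"
definition "sL = affine_orbit (\<tau>L / \<delta>L) (1 / \<delta>L) (- 1 / \<delta>L) (- (\<beta> + 1))"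

lemma sR_simps: "sR 0 = - \<beta> / \<delta>R" "sR (Suc 0) = 0" "sR (Suc (Suc k)) = \<tau>R * sR (Suc k) - \<delta>R * sR k + 1"
  by (simp_all add: sR_def)
lemma sL_simps: "sL 0 = - (\<beta> + 1)" "sL (Suc 0) = 0"
  "sL (Suc (Suc k)) = \<tau>L / \<delta>L * sL (Suc k) - 1 / \<delta>L * sL k + - 1 / \<delta>L"
  by (simp_all add: sL_def)
lemma sR2: "sR 2 = \<beta> + 1" and sL2: "sL 2 = \<beta> / \<delta>L"
  using dL dR by (simp_all add: numeral_2_eq_2 sR_simps sL_simps field_simps)

lemma f_comp_left: "x $ 1 \<le> 0 \<Longrightarrow> F x $ 1 = \<tau>L * x $ 1 + x $ 2 + 1 \<and> F x $ 2 = - \<delta>L * x $ 1"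
  by (simp add: bcnf_left)
lemma f_comp_right: "x $ 1 \<ge> 0 \<Longrightarrow> F x $ 1 = \<tau>R * x $ 1 + x $ 2 + 1 \<and> F x $ 2 = - \<delta>R * x $ 1"
  by (simp add: bcnf_right)

lemma f_sign: "x $ 1 < 0 \<Longrightarrow> F x $ 2 > 0" "x $ 1 > 0 \<Longrightarrow> F x $ 2 < 0" "x $ 1 = 0 \<Longrightarrow> F x $ 2 = 0"
  using f_comp_left[of x] f_comp_right[of x] dL dR by (auto simp: mult_pos_neg)

lemma inj_f: "inj F"
proof (rule injI)
  fix x y assume e: "F x = F y"
  consider "x $ 1 \<le> 0" "y $ 1 \<le> 0" | "x $ 1 \<ge> 0" "y $ 1 \<ge> 0"
    using f_sign[of x] f_sign[of y] e by (metis less_asym linorder_not_less nle_le)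
  then show "x = y"
  proof cases
    case 1 then show ?thesis using f_comp_left[of x] f_comp_left[of y] e dL by (auto simp: vec2_eq_iff)
  next
    case 2 then show ?thesis using f_comp_right[of x] f_comp_right[of y] e dR by (auto simp: vec2_eq_iff)
  qed
qed

lemma surj_f: "surj F"
proof (rule surjI)
  fix y :: "real^2"
  show "F (if y $ 2 \<ge> 0 then vector [- y $ 2 / \<delta>L, y $ 1 + \<tau>L * y $ 2 / \<delta>L - 1]
      else vector [- y $ 2 / \<delta>R, y $ 1 + \<tau>R * y $ 2 / \<delta>R - 1]) = y"
  proof (cases "y $ 2 \<ge> 0")
    case True
    then show ?thesis using dL by (simp add: vec2_eq_iff bcnf_left)
  next
    case False
    then show ?thesis using dR by (simp add: vec2_eq_iff bcnf_right divide_nonpos_pos)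
  qed
qed

lemma inv_f [simp]: "inv F (F x) = x" "F (inv F x) = x"
  using inj_f surj_f by (auto simp: inv_f_f surj_f_inv_f)

lemma X_comp [simp]: "X $ 1 = 0" "X $ 2 = \<beta>" by (simp_all add: pt_X_def)

lemma r_props: "r \<ge> 1" "(F ^^ r) X $ 1 \<le> 0" "1 \<le> i \<Longrightarrow> i < r \<Longrightarrow> (F ^^ i) X $ 1 > 0"
proof -
  have "\<exists>i. i \<ge> 1 \<and> (F ^^ i) X \<in> Pi_L" using C1 by (auto simp: cond_C1_def)
  from LeastI_ex[OF this] show "r \<ge> 1" "(F ^^ r) X $ 1 \<le> 0" by (auto simp: idx_r_def Pi_L_def)
  assume "1 \<le> i" "i < r"
  then show "(F ^^ i) X $ 1 > 0" using not_less_Least[of i] by (fastforce simp: idx_r_def Pi_L_def)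
qed

lemma ell_props: "ell \<ge> 1" "(inv F ^^ ell) X $ 1 \<ge> 0" "1 \<le> i \<Longrightarrow> i < ell \<Longrightarrow> (inv F ^^ i) X $ 1 < 0"
proof -
  have "\<exists>i. i \<ge> 1 \<and> (inv F ^^ i) X \<in> Pi_R" using C1 by (auto simp: cond_C1_def)
  from LeastI_ex[OF this] show "ell \<ge> 1" "(inv F ^^ ell) X $ 1 \<ge> 0" by (auto simp: idx_l_def Pi_R_def)
  assume "1 \<le> i" "i < ell"
  then show "(inv F ^^ i) X $ 1 < 0" using not_less_Least[of i] by (fastforce simp: idx_l_def Pi_R_def)
qed

lemma r_ge: "r \<ge> 2"
proof -
  have "F X $ 1 = \<beta> + 1" using f_comp_right[of X] by simp
  then have "r \<noteq> 1" using r_props(2) beta by auto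
  then show ?thesis using r_props(1) by simp
qed

lemma ell_ge: "ell \<ge> 2"
proof -
  have "inv F X $ 1 < 0"
    using f_sign[of "inv F X"] beta by (metis X_comp(2) inv_f(2) less_asym linorder_neqE_linordered_idom)
  then have "ell \<noteq> 1" using ell_props(2) by auto
  then show ?thesis using ell_props(1) by simp
qed

lemma forward: "k \<le> r \<Longrightarrow> (F ^^ k) X = vector [sR (Suc k), - \<delta>R * sR k]"
proof (induction k)
  case 0 show ?case using dR by (simp add: vec2_eq_iff sR_simps)
next
  case (Suc k)
  then have IH: "(F ^^ k) X = vector [sR (Suc k), - \<delta>R * sR k]" by simp
  have "(F ^^ k) X $ 1 \<ge> 0" using r_props(3)[of k] Suc.prems by (cases "k = 0") auto
  then show ?case using f_comp_right[of "(F ^^ k) X"] unfolding IH by (simp add: vec2_eq_iff IH sR_simps)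
qed

lemma backward: "k < ell \<Longrightarrow> (inv F ^^ k) X = vector [- sL (Suc k), \<delta>L * sL (Suc (Suc k))]"
proof (induction k)
  case 0 show ?case using dL sL2 by (simp add: vec2_eq_iff sL_simps(2) numeral_2_eq_2)
next
  case (Suc k)
  then have IH: "(inv F ^^ k) X = vector [- sL (Suc k), \<delta>L * sL (Suc (Suc k))]" by simp
  define p where "p = (inv F ^^ Suc k) X"
  have "p $ 1 < 0" using ell_props(3)[of "Suc k"] Suc.prems by (simp add: p_def)
  moreover have "F p = vector [- sL (Suc k), \<delta>L * sL (Suc (Suc k))]" by (simp add: p_def IH)
  ultimately have p: "\<tau>L * p $ 1 + p $ 2 + 1 = - sL (Suc k)" "- \<delta>L * p $ 1 = \<delta>L * sL (Suc (Suc k))"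
    using f_comp_left[of p] by auto
  have p1: "p $ 1 = - sL (Suc (Suc k))" using p(2) dL by (metis minus_mult_minus mult_left_cancel less_irrefl minus_minus)
  have "\<delta>L * sL (Suc (Suc (Suc k))) = \<tau>L * sL (Suc (Suc k)) - sL (Suc k) - 1"
    unfolding sL_simps(3)[of "Suc k"] using dL by (simp add: right_diff_distrib)
  then have "p $ 2 = \<delta>L * sL (Suc (Suc (Suc k)))" using p(1) unfolding p1 by simp
  then show ?case using p1 unfolding p_def by (simp add: vec2_eq_iff)
qed

lemma polygon: "polygon \<tau>L \<delta>L \<tau>R \<delta>R sR sL (Suc r) (Suc ell) \<beta>"
proof -
  have R: "return_orbit \<tau>R \<delta>R 1 sR (Suc r)"
  proof
    show "sR 0 < 0" using beta dR by (simp add: sR_simps)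
    show "sR 2 > 0" using beta sR2 by simp
    show "Suc r \<ge> 3" using r_ge by simp
    show "sR (Suc r) \<le> 0" using forward[of r] r_props(2) by simp
    fix k :: nat assume "2 \<le> k" "k < Suc r"
    then obtain j where "k = Suc j" "1 \<le> j" "j < r" by (cases k) auto
    then show "sR k > 0" using r_props(3)[of j] forward[of j] by simp
  qed (use dR sR_simps in auto)
  have L: "return_orbit (\<tau>L / \<delta>L) (1 / \<delta>L) (- 1 / \<delta>L) sL (Suc ell)"
  proof
    show "sL 0 < 0" using beta by (simp add: sL_simps)
    show "sL 2 > 0" using beta dL sL2 by simp
    show "Suc ell \<ge> 3" using ell_ge by simp
    \<comment> \<open>The point at backward time \<open>ell\<close> lies in the right half-plane, so
      its image \<open>V\<close> has nonpositive second coordinate, and this is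
      \<open>\<delta>L * sL (Suc ell)\<close>.\<close>
    show "sL (Suc ell) \<le> 0"
    proof -
      obtain j where j: "ell = Suc j" using ell_ge by (cases ell) auto
      have "F ((inv F ^^ ell) X) $ 2 \<le> 0" using ell_props(2) f_comp_right dR by simp
      moreover have "F ((inv F ^^ ell) X) = (inv F ^^ j) X" by (simp add: j)
      ultimately have "\<delta>L * sL (Suc (Suc j)) \<le> 0" using backward[of j] j by simp
      then show ?thesis using dL j by (simp add: mult_le_0_iff)
    qed
    fix k :: nat assume "2 \<le> k" "k < Suc ell"
    then obtain j where "k = Suc j" "1 \<le> j" "j < ell" by (cases k) auto
    then show "sL k > 0" using ell_props(3)[of j] backward[of j] by simp
  qed (use dL sL_simps in auto)
  show ?thesis using R L beta sR2 sL2 sR_simps(1) sL_simps(1)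
    by (simp add: polygon_def polygon_axioms_def)
qed

sublocale polygon \<tau>L \<delta>L \<tau>R \<delta>R sR sL "Suc r" "Suc ell" \<beta>
  by (rule polygon)

section \<open>The constructed points in the coordinates of the polygon\<close>

lemma V_comp: "pt_V f \<beta> $ 1 = - sL ell" "pt_V f \<beta> $ 2 = \<delta>L * sL (Suc ell)"
proof -
  obtain j where j: "ell = Suc j" using ell_ge by (cases ell) auto
  show "pt_V f \<beta> $ 1 = - sL ell" "pt_V f \<beta> $ 2 = \<delta>L * sL (Suc ell)"
    using backward[of j] j by (simp_all add: pt_V_def)
qed

lemma fV_comp: "f (pt_V f \<beta>) $ 1 = - sL (ell - 1)" "f (pt_V f \<beta>) $ 2 = \<delta>L * sL ell"
proof -
  obtain j where j: "ell = Suc (Suc j)" using ell_ge by (metis add_2_eq_Suc le_Suc_ex)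
  have "f (pt_V f \<beta>) = (inv f ^^ j) X" by (simp add: pt_V_def j)
  then show "f (pt_V f \<beta>) $ 1 = - sL (ell - 1)" "f (pt_V f \<beta>) $ 2 = \<delta>L * sL ell"
    using backward[of j] j by simp_all
qed

lemma sL_ell: "sL ell > 0" and sR_r: "sR r > 0"
  using L.s_pos[of ell] ell_ge R.s_pos[of r] r_ge by auto

lemma ell_idx: "Suc ell - 1 = ell" "Suc ell - 2 = ell - 1" "Suc (ell - 1) = ell"
  and r_idx: "Suc r - 1 = r" "Suc r - 2 = r - 1" "Suc (r - 1) = r"
  using ell_ge r_ge by auto

lemma line_V: "Ll (ell - 1) (pt_V f \<beta>) = 0" "Ll (ell - 1) (f (pt_V f \<beta>)) = 0" "Ll ell (pt_V f \<beta>) = 0"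
  using dL by (simp_all only: Ll_def V_comp fV_comp L.l_def L.d_def ell_idx) (simp_all add: ell_idx)

lemma pt_U: "pt_U f \<beta> = ptU"
proof -
  have img: "f ` Sigma_line = {y. y $ 2 = 0}"
  proof (intro set_eqI iffI)
    fix y :: "real^2" assume "y \<in> {y. y $ 2 = 0}"
    then have "inv f y \<in> Sigma_line" using f_sign[of "inv f y"] by (force simp: Sigma_line_def)
    then show "y \<in> f ` Sigma_line" by (metis imageI inv_f(2))
  qed (auto simp: Sigma_line_def f_sign)
  have only: "u = ptU" if "u \<in> affine hull {pt_V f \<beta>, f (pt_V f \<beta>)} \<inter> f ` Sigma_line" for u
  proof -
    have "Ll (ell - 1) u = 0"
      by (rule affine_on_hull[OF Ll_affine line_V(1,2)]) (use that in auto)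
    moreover have "u $ 2 = 0" using that img by auto
    ultimately have "L.d ell * u $ 1 = L.E (ell - 1)" using Ll_affine[of "ell - 1" u] ell_idx by simp
    then have "u $ 1 = - L.bY" using L.d_last by (simp add: L.bY_def ell_idx field_simps)
    then show ?thesis using \<open>u $ 2 = 0\<close> by (simp add: vec2_eq_iff ptU_def)
  qed
  have "pt_V f \<beta> $ 2 \<le> 0" "f (pt_V f \<beta>) $ 2 > 0"
    using V_comp fV_comp L.s_N dL sL_ell by (auto simp: mult_nonneg_nonpos)
  then obtain u where "u \<in> affine hull {pt_V f \<beta>, f (pt_V f \<beta>)}" "u $ 2 = 0"
    by (rule affine_hull_crossing)
  then have "u \<in> affine hull {pt_V f \<beta>, f (pt_V f \<beta>)} \<inter> f ` Sigma_line" using img by simp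
  then show ?thesis unfolding pt_U_def using only by (metis (no_types, lifting) the_equality)
qed

lemma pt_Z: "pt_Z f \<beta> = ptZ"
  using forward[of r] by (simp add: pt_Z_def ptZ_def)

lemma pt_Y: "pt_Y f \<beta> = ptY"
proof -
  obtain j where j: "r = Suc j" using r_ge by (cases r) auto
  have "inv f (pt_Z f \<beta>) = (f ^^ j) X" by (simp add: pt_Z_def j)
  then have Z': "inv f (pt_Z f \<beta>) = vector [sR r, - \<delta>R * sR (r - 1)]" using forward[of j] j by simp
  have line: "Rl (r - 1) (pt_Z f \<beta>) = 0" "Rl (r - 1) (inv f (pt_Z f \<beta>)) = 0"
    unfolding Z' unfolding pt_Z ptZ_def using dR by (simp_all add: Rl_def R.l_def R.d_def j)
  have only: "u = ptY" if "u \<in> affine hull {pt_Z f \<beta>, inv f (pt_Z f \<beta>)} \<inter> Sigma_line" for u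
  proof -
    have "Rl (r - 1) u = 0"
      by (rule affine_on_hull[OF Rl_affine line]) (use that in auto)
    moreover have "u $ 1 = 0" using that by (auto simp: Sigma_line_def)
    ultimately have "R.d r * u $ 2 / \<delta>R = R.E (r - 1)" using Rl_affine[of "r - 1" u] r_idx by simp
    then have "u $ 2 = - \<delta>R * R.bY" using R.d_last dR by (simp add: R.bY_def r_idx field_simps)
    then show ?thesis using \<open>u $ 1 = 0\<close> by (simp add: vec2_eq_iff ptY_def)
  qed
  have "pt_Z f \<beta> $ 1 \<le> 0" "inv f (pt_Z f \<beta>) $ 1 > 0"
    unfolding Z' unfolding pt_Z using R.s_N sR_r by (auto simp: ptZ_def)
  then obtain u where "u \<in> affine hull {pt_Z f \<beta>, inv f (pt_Z f \<beta>)}" "u $ 1 = 0"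
    by (rule affine_hull_crossing)
  then have "u \<in> affine hull {pt_Z f \<beta>, inv f (pt_Z f \<beta>)} \<inter> Sigma_line" by (simp add: Sigma_line_def)
  then show ?thesis unfolding pt_Y_def using only by (metis (no_types, lifting) the_equality)
qed

lemma d_ell: "L.d ell < 0" using L.d_last by (simp add: ell_idx)

text \<open>As \<open>L.d ell < 0\<close>, the function of edge \<open>ell\<close> decreases upward
  and that of edge \<open>ell - 1\<close> decreases to the right; each strict position in (C2) thus
  becomes a negative value.\<close>

lemma trapped: "trapped_polygon \<tau>L \<delta>L \<tau>R \<delta>R sR sL (Suc r) (Suc ell) \<beta>"
proof
  define w where "w = inv f ptU"
  have fw: "f w = ptU" by (simp add: w_def)
  then have w1: "w $ 1 = 0" using f_sign[of w] by (force simp: ptU_def)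
  have "Ll (ell - 1) ptU = 0"
    using d_ell unfolding Ll_affine ptU_def L.bY_def ell_idx by simp
  then have lw: "Ll ell w = 0" using f_Ll[of w "ell - 1"] w1 fw dL ell_idx by simp
  have C: "ptY $ 2 > w $ 2" "above_line ptZ w (pt_V f \<beta>)" "right_of_line ptZ (pt_V f \<beta>) (f (pt_V f \<beta>))"
    using C2 unfolding cond_C2_def pt_U pt_Y pt_Z w_def by auto
  have "Ll ell ptY - Ll ell w = L.d ell / \<delta>L * (ptY $ 2 - w $ 2)"
    unfolding Ll_affine w1 by (simp add: ptY_def algebra_simps)
  also have "\<dots> < 0" using C(1) d_ell dL by (simp add: mult_neg_pos divide_neg_pos)
  finally show "Ll (Suc ell - 1) ptY < 0" using lw by simp
  obtain s where s: "s \<in> affine hull {w, pt_V f \<beta>}" "s $ 1 = ptZ $ 1" "s $ 2 < ptZ $ 2"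
    using C(2) by (auto simp: above_line_def)
  have "Ll ell s = 0" by (rule affine_on_hull[OF Ll_affine lw line_V(3) s(1)])
  moreover have "Ll ell ptZ - Ll ell s = L.d ell / \<delta>L * (ptZ $ 2 - s $ 2)"
    unfolding Ll_affine s(2) by (simp add: algebra_simps)
  moreover have "L.d ell / \<delta>L * (ptZ $ 2 - s $ 2) < 0" using s d_ell dL by (simp add: mult_neg_pos divide_neg_pos)
  ultimately show "Ll (Suc ell - 1) ptZ < 0" by simp
  obtain t where t: "t \<in> affine hull {pt_V f \<beta>, f (pt_V f \<beta>)}" "t $ 2 = ptZ $ 2" "t $ 1 < ptZ $ 1"
    using C(3) by (auto simp: right_of_line_def)
  have "Ll (ell - 1) t = 0" by (rule affine_on_hull[OF Ll_affine line_V(1,2) t(1)])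
  moreover have "Ll (ell - 1) ptZ - Ll (ell - 1) t = L.d ell * (ptZ $ 1 - t $ 1)"
    unfolding Ll_affine t(2) ell_idx by (simp add: algebra_simps)
  moreover have "L.d ell * (ptZ $ 1 - t $ 1) < 0" using t d_ell by (simp add: mult_neg_pos)
  ultimately show "Ll (Suc ell - 2) ptZ < 0" by (simp add: ell_idx)
qed

sublocale trapped_polygon \<tau>L \<delta>L \<tau>R \<delta>R sR sL "Suc r" "Suc ell" \<beta>
  by (rule trapped)

lemma chi_L_finite:
  assumes "P \<in> Omega_L"
  obtains k where "chi_L AL P = enat k" "k \<ge> 1" "(fL ^^ k) P $ 1 > 0"
proof -
  have ex: "\<exists>k. k \<ge> 1 \<and> (bc_piece AL ^^ k) P \<notin> Pi_L"
    using exit_left_of_left[OF assms] by (auto simp: Pi_L_def fL_def not_le)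
  from LeastI_ex[OF ex] show ?thesis
    using that[of "LEAST k. k \<ge> 1 \<and> (bc_piece AL ^^ k) P \<notin> Pi_L"] ex
    by (auto simp: chi_L_def Pi_L_def fL_def)
qed

lemma chaotic_attractor:
  assumes "cond_C3 (word_matrix AL AR) (idx_set f AL \<beta>)" "cond_C4 (word_matrix AL AR) (idx_set f AL \<beta>)"
    "cond_C5 (word_matrix AL AR) (idx_set f AL \<beta>)"
  shows "\<exists>\<Omega>. trapping_region f \<Omega> \<and> (\<forall>x\<in>attracting_set f \<Omega>. \<exists>v. lyapunov_exponent f x v > 0)"
proof -
  obtain kY where Y: "chi_L AL ptY = enat kY" "kY \<ge> 1" "(fL ^^ kY) ptY $ 1 > 0" using chi_L_finite[OF ptY_in] .
  obtain kZ where Z: "chi_L AL ptZ = enat kZ" "kZ \<ge> 1" "(fL ^^ kZ) ptZ $ 1 > 0" using chi_L_finite[OF ptZ_in] .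
  define p where "p = max kY kZ"
  have "p_max f AL \<beta> = enat p" by (simp add: p_max_def pt_Y pt_Z Y Z p_def)
  \<comment> \<open>The bound \<open>Suc p\<close> is the word with one right step and the maximal
    number \<open>p\<close> of left steps.\<close>
  then have J: "idx_set f AL \<beta> = {1..Suc p}" by (auto simp: idx_set_def one_enat_def)
  obtain lo hi c where e: "lo \<le> hi" "c > 1"
    "\<And>j v. j \<in> {1..Suc p} \<Longrightarrow> v \<in> slope_cone lo hi \<Longrightarrow>
      word_matrix AL AR j *v v \<in> slope_cone lo hi \<and> norm (word_matrix AL AR j *v v) \<ge> c * norm v"
    using cone_expansion[of "{1..Suc p}" "word_matrix AL AR"] assms unfolding J by auto
  have run: "\<exists>k\<le>p. (fL ^^ k) (f x) $ 1 > 0" if "x \<in> Omega_R" for x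
    by (rule left_run_bounded[OF that, of p kY kZ]) (use Y Z in \<open>auto simp: p_def\<close>)
  obtain W where W: "trapping_region f W" "\<And>x. x \<in> attracting_set f W \<Longrightarrow> x \<in> Omega'" using trapping by blast
  have "\<exists>v. lyapunov_exponent f x v > 0" if "x \<in> attracting_set f W" for x
    by (rule lyapunov_positive[OF W(2)[OF that] e(1) run e(2)]) (use e(3) in auto)
  then show ?thesis using W(1) by blast
qed

end

theorem theorem7p2:
  fixes \<tau>L \<tau>R \<delta>L \<delta>R \<beta>min \<beta>step \<beta>max :: real
  assumes "\<delta>L > 0" and "\<delta>R > 0"
    and "\<beta>min > 0" and "\<beta>step > 0"
    and "chi_chaos \<tau>L \<delta>L \<tau>R \<delta>R \<beta>min \<beta>step \<beta>max"
  shows "\<exists>\<Omega>. trapping_region (bcnf \<tau>L \<delta>L \<tau>R \<delta>R) \<Omega> \<and>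
           (\<forall>x \<in> attracting_set (bcnf \<tau>L \<delta>L \<tau>R \<delta>R) \<Omega>.
              \<exists>v. lyapunov_exponent (bcnf \<tau>L \<delta>L \<tau>R \<delta>R) x v > 0)"
proof -
  obtain k where stop: "beta_stops (bcnf \<tau>L \<delta>L \<tau>R \<delta>R) \<beta>min \<beta>step \<beta>max k"
    and C: "cond_C3 (word_matrix (bc_matrix \<tau>L \<delta>L) (bc_matrix \<tau>R \<delta>R))
        (idx_set (bcnf \<tau>L \<delta>L \<tau>R \<delta>R) (bc_matrix \<tau>L \<delta>L) (\<beta>min + real k * \<beta>step))"
      "cond_C4 (word_matrix (bc_matrix \<tau>L \<delta>L) (bc_matrix \<tau>R \<delta>R))
        (idx_set (bcnf \<tau>L \<delta>L \<tau>R \<delta>R) (bc_matrix \<tau>L \<delta>L) (\<beta>min + real k * \<beta>step))"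
      "cond_C5 (word_matrix (bc_matrix \<tau>L \<delta>L) (bc_matrix \<tau>R \<delta>R))
        (idx_set (bcnf \<tau>L \<delta>L \<tau>R \<delta>R) (bc_matrix \<tau>L \<delta>L) (\<beta>min + real k * \<beta>step))"
    using assms(5) by (auto simp: chi_chaos_def Let_def)
  have "\<beta>min + real k * \<beta>step > 0" using assms by (simp add: add_pos_nonneg)
  then interpret detected \<tau>L \<delta>L \<tau>R \<delta>R "\<beta>min + real k * \<beta>step"
    using assms stop by unfold_locales (auto simp: beta_stops_def)
  show ?thesis using C by (rule chaotic_attractor)
qed

end
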